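(* Let $T$ be a tree with $n$ vertices and stability number $\alpha > n/2$, and assume $\ell(n,\alpha)\le 2$. Then $T$ is extremal if and only if $T$ satisfies the following three conditions: (i) $T$ is a balanced tree of stars; (ii) the center-tree of $T$ is isomorphic to a path $P$; and (iii) each light center of $T$ (if any) is an endpoint of $P$.
   Context: All graphs are finite, simple, undirected. $F(G)$ is the number of stable sets of $G$ (including the empty set); $\alpha(G)$ is the stability number. A tree $T$ is extremal if $F(T)$ is minimum among all trees with $|V(T)|$ vertices and stability number $\alpha(T)$. A leaf of a tree is a vertex of degree at most $1$. Trees of stars are defined inductively: a single vertex is a tree of stars; if $T_1,\dots,T_k$ ($k\ge2$) are disjoint trees of stars and $v_i$ is a leaf of $T_i$, then adding a new vertex $w$ adjacent to all $v_i$ gives a tree of stars. In a tree of stars, a vertex is a center if its distances to all leaves are odd (they all have the same parity). A tree of stars is balanced if the degrees of any two centers differ by at most $1$. The center-tree $C_T$ of a tree of stars $T$ has the centers of $T$ as vertices, two centers being adjacent iff they are at distance $2$ in $T$. For a balanced tree of stars with $n$ vertices and stability number $\alpha$, a center is heavy if its degree is $\lceil (n-1)/(n-\alpha)\rceil$ and light if its degree is $\lceil (n-1)/(n-\alpha)\rceil-1$. Define $h(n,\alpha) = (n-1) \bmod (n-\alpha)$ if this is nonzero and $h(n,\alpha)=n-\alpha$ otherwise, and $\ell(n,\alpha) = n-\alpha-h(n,\alpha)$ (the number of light centers of such a tree). *)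

theory Defs
  imports Complex_Main "Graph_Theory.Graph_Theory"
begin

text \<open>Finite simple undirected graphs are represented by \<^locale>\<open>pair_graph\<close>: finite,
  loop-free, with every edge present as two opposite arcs.\<close>

text \<open>The library notions \<open>forest\<close> and \<open>tree\<close> are of no use for these graphs: there the closed walk
  \<open>a, b, a\<close> along a single edge counts as a cycle. A cycle of an undirected graph is one
  of length at least 3. Library connectedness includes nonemptiness.\<close>

definition graph_tree :: "'a pair_pre_digraph \<Rightarrow> bool" where
  "graph_tree G \<longleftrightarrow> pair_graph G \<and> Digraph_Component.connected (with_proj G) \<and>
     \<not> (\<exists>p. pre_digraph.cycle (with_proj G) p \<and> length p \<ge> 3)"

definition stable_set :: "'a pair_pre_digraph \<Rightarrow> 'a set \<Rightarrow> bool" where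
  "stable_set G S \<longleftrightarrow> S \<subseteq> pverts G \<and> (\<forall>u\<in>S. \<forall>v\<in>S. (u, v) \<notin> parcs G)"

definition num_stable_sets :: "'a pair_pre_digraph \<Rightarrow> nat" where
  "num_stable_sets G = card {S. stable_set G S}"

definition stability_number :: "'a pair_pre_digraph \<Rightarrow> nat" where
  "stability_number G = Max (card ` {S. stable_set G S})"

text \<open>Comparing only with trees on the same type \<open>'a\<close> loses nothing: every tree with
  \<open>card (pverts T)\<close> vertices has an isomorphic copy on the vertex set \<open>pverts T\<close>.\<close>

definition extremal :: "'a pair_pre_digraph \<Rightarrow> bool" where
  "extremal T \<longleftrightarrow> graph_tree T \<and>
     (\<forall>T' :: 'a pair_pre_digraph. graph_tree T' \<and> card (pverts T') = card (pverts T) \<and>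
        stability_number T' = stability_number T \<longrightarrow> num_stable_sets T \<le> num_stable_sets T')"

text \<open>In a symmetric digraph without loops the out-degree is the degree of the undirected graph.\<close>

definition degree :: "'a pair_pre_digraph \<Rightarrow> 'a \<Rightarrow> nat" where
  "degree G v = out_degree (with_proj G) v"

definition leaf :: "'a pair_pre_digraph \<Rightarrow> 'a \<Rightarrow> bool" where
  "leaf G v \<longleftrightarrow> v \<in> pverts G \<and> degree G v \<le> 1"

definition distance :: "'a pair_pre_digraph \<Rightarrow> 'a \<Rightarrow> 'a \<Rightarrow> nat" where
  "distance G u v = (LEAST d. \<exists>p. pre_digraph.awalk (with_proj G) u p v \<and> length p = d)"

inductive tree_of_stars :: "'a pair_pre_digraph \<Rightarrow> bool" where
  single: "tree_of_stars \<lparr> pverts = {v}, parcs = {} \<rparr>"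
| join: "\<lbrakk> (k :: nat) \<ge> 2;
      \<And>i. i < k \<Longrightarrow> tree_of_stars (T i);
      \<And>i. i < k \<Longrightarrow> leaf (T i) (v i);
      \<And>i j. i < k \<Longrightarrow> j < k \<Longrightarrow> i \<noteq> j \<Longrightarrow> pverts (T i) \<inter> pverts (T j) = {};
      \<And>i. i < k \<Longrightarrow> w \<notin> pverts (T i) \<rbrakk>
    \<Longrightarrow> tree_of_stars \<lparr> pverts = insert w (\<Union>i<k. pverts (T i)),
          parcs = (\<Union>i<k. parcs (T i) \<union> {(w, v i), (v i, w)}) \<rparr>"

definition center :: "'a pair_pre_digraph \<Rightarrow> 'a \<Rightarrow> bool" where
  "center T v \<longleftrightarrow> v \<in> pverts T \<and> (\<forall>u. leaf T u \<longrightarrow> odd (distance T v u))"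

definition balanced_tree_of_stars :: "'a pair_pre_digraph \<Rightarrow> bool" where
  "balanced_tree_of_stars T \<longleftrightarrow> tree_of_stars T \<and>
     (\<forall>u v. center T u \<and> center T v \<longrightarrow> \<bar>int (degree T u) - int (degree T v)\<bar> \<le> 1)"

definition center_tree :: "'a pair_pre_digraph \<Rightarrow> 'a pair_pre_digraph" where
  "center_tree T = \<lparr> pverts = {v. center T v},
     parcs = {(u, v). center T u \<and> center T v \<and> distance T u v = 2} \<rparr>"

definition light_center :: "'a pair_pre_digraph \<Rightarrow> 'a \<Rightarrow> bool" where
  "light_center T v \<longleftrightarrow> center T v \<and>
     int (degree T v) =
       \<lceil>(real (card (pverts T)) - 1) / (real (card (pverts T)) - real (stability_number T))\<rceil> - 1"

text \<open>Since \<open>1 \<le> n\<close> and \<open>\<alpha> \<le> n\<close> for every tree, the subtractions on \<open>nat\<close> below do not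
  truncate. For \<open>n = \<alpha>\<close> (only the one-vertex tree) both counts are 0.\<close>

definition heavy_count :: "nat \<Rightarrow> nat \<Rightarrow> nat" where
  "heavy_count n \<alpha> =
     (if (n - 1) mod (n - \<alpha>) \<noteq> 0 then (n - 1) mod (n - \<alpha>) else n - \<alpha>)"

definition light_count :: "nat \<Rightarrow> nat \<Rightarrow> nat" where
  "light_count n \<alpha> = n - \<alpha> - heavy_count n \<alpha>"

text \<open>The path with \<open>k\<close> vertices. The value \<open>k = 0\<close> (the null graph) is allowed; it is the
  center-tree of the one-vertex tree, which has no center.\<close>

definition path_graph :: "nat \<Rightarrow> nat pair_pre_digraph" where
  "path_graph k = \<lparr> pverts = {..<k},
     parcs = {(i, j). i < k \<and> j < k \<and> (j = Suc i \<or> i = Suc j)} \<rparr>"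

definition path_endpoint :: "nat \<Rightarrow> nat \<Rightarrow> bool" where
  "path_endpoint k i \<longleftrightarrow> i < k \<and> (i = 0 \<or> Suc i = k)"

text \<open>\<open>hom\<close> is an isomorphism from \<open>G\<close> onto \<open>H\<close>, with the vertex map given by \<open>iso_verts hom\<close>
  (this is the witness in the library's \<open>digraph_iso\<close>).\<close>

definition graph_isomorphism ::
    "('a, 'a \<times> 'a, 'b, 'b \<times> 'b) digraph_isomorphism \<Rightarrow> 'a pair_pre_digraph \<Rightarrow>
      'b pair_pre_digraph \<Rightarrow> bool" where
  "graph_isomorphism hom G H \<longleftrightarrow>
     pre_digraph.digraph_isomorphism (with_proj G) hom \<and> with_proj H = app_iso hom (with_proj G)"

end

theory Submission
  imports Defs
begin

text \<open>Removing an edge \<open>xy\<close> splits a tree \<open>T\<close> into \<open>A\<close> and \<open>B\<close>, and \<open>F(T) = F(A) F(B) - F\<^sub>x(A) F\<^sub>y(B)\<close>,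
  where \<open>F\<^sub>v\<close> counts the stable sets containing \<open>v\<close>. If \<open>T\<close> minimizes \<open>F\<close> among the trees of its order
  with a stable set of size \<open>\<alpha>\<close>, then no replacement \<open>x'y'\<close> of \<open>xy\<close> that keeps some stable set \<open>D\<close> of size
  \<open>\<alpha>\<close> stable increases the product \<open>F\<^sub>x(A) F\<^sub>y(B)\<close>. This local condition determines \<open>T\<close>. A vertex with three
  neighbours that may all be exchanged is impossible, so the vertices outside \<open>D\<close> are stable and those in
  \<open>D\<close> have degree at most 2: \<open>T\<close> is a tree of stars. The odds that a center belongs to a random stable
  set are a product over its branches, whence the degrees of two centers differ by at most 1, and a
  center with three inner neighbours, or a light one with two, would have larger odds than a heavy end
  of the center-tree. Finally, \<open>F\<close> of a tree of stars over a path depends only on the degrees along the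
  path, which \<open>n\<close> and \<open>\<alpha>\<close> determine up to reversal, so all such trees attain the minimum.\<close>

text \<open>Minimality is taken over trees with some stable set of size at least \<open>a\<close>,
  not over those with stability number exactly \<open>a\<close>: after an exchange of edges it then
  suffices to exhibit one large stable set that survives. The assumption \<alpha> > n/2 excludes a
  surplus. With a larger stable set every exchange would be allowed, so all degrees would be at most
  2, and a path on n vertices has no stable set of more than (n+1)/2 vertices. The bound on the
  number of light centers enters through a count of the ends of the center-tree. A center with j
  \<ge> 2 inner neighbours forces at least j ends; at most two centers are light, and at most one
  end is light if that center is light itself. So whenever a center has to be excluded, there is a
  heavy end to compare it with. Trees with the three properties are never compared with arbitrary
  trees. Some optimal tree exists, it has the same degrees along its path of centers, and equal
  degrees give equal F.\<close>

section \<open>Trees and cutting of edges\<close>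

text \<open>Trees built by joining two trees by an edge, so that every edge can be cut
  (\<open>tr_split\<close>); by \<open>graph_tree_iff\<close> these are the trees of the theorem.\<close>

inductive tr :: "'a set \<Rightarrow> ('a \<times> 'a) set \<Rightarrow> bool" where
  tr_single: "tr {v} {}"
| tr_join: "\<lbrakk>tr A EA; tr B EB; A \<inter> B = {}; x \<in> A; y \<in> B\<rbrakk> \<Longrightarrow> tr (A \<union> B) (EA \<union> EB \<union> {(x, y), (y, x)})"

definition split :: "'a set \<Rightarrow> ('a \<times> 'a) set \<Rightarrow> 'a \<Rightarrow> 'a \<Rightarrow> 'a set \<Rightarrow> ('a \<times> 'a) set \<Rightarrow> 'a set \<Rightarrow> ('a \<times> 'a) set \<Rightarrow> bool" where
  "split V E x y A EA B EB \<longleftrightarrow> tr A EA \<and> tr B EB \<and> A \<inter> B = {} \<and> x \<in> A \<and> y \<in> B \<and>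
     V = A \<union> B \<and> E = EA \<union> EB \<union> {(x, y), (y, x)}"

definition nb :: "('a \<times> 'a) set \<Rightarrow> 'a \<Rightarrow> 'a set" where
  "nb E v = {u. (v, u) \<in> E}"

abbreviation deg :: "('a \<times> 'a) set \<Rightarrow> 'a \<Rightarrow> nat" where
  "deg E v \<equiv> card (nb E v)"

lemma split_tr: "split V E x y A EA B EB \<Longrightarrow> tr V E"
  unfolding split_def using tr_join[of A EA B EB x y] by simp

lemma split_sym: "split V E x y A EA B EB \<Longrightarrow> split V E y x B EB A EA"
  unfolding split_def by auto

lemma tr_finite: "tr V E \<Longrightarrow> finite V"
  by (induction rule: tr.induct) auto

lemma tr_nonempty: "tr V E \<Longrightarrow> V \<noteq> {}"
  by (induction rule: tr.induct) auto

lemma tr_sub: "tr V E \<Longrightarrow> E \<subseteq> V \<times> V"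
  by (induction rule: tr.induct) auto

lemma tr_finite_arcs: "tr V E \<Longrightarrow> finite E"
  by (rule finite_subset[OF tr_sub]) (auto dest: tr_finite)

lemma tr_sym: "tr V E \<Longrightarrow> (u, v) \<in> E \<Longrightarrow> (v, u) \<in> E"
  by (induction rule: tr.induct) auto

lemma tr_irrefl: "tr V E \<Longrightarrow> (v, v) \<notin> E"
proof (induction rule: tr.induct)
  case (tr_join A EA B EB x y)
  then show ?case by auto
qed auto

lemma tr_in: "tr V E \<Longrightarrow> (u, v) \<in> E \<Longrightarrow> u \<in> V \<and> v \<in> V"
  using tr_sub by blast

lemma tr_finite_nb [simp]: "tr V E \<Longrightarrow> finite (nb E v)"
  by (rule finite_subset[of _ V]) (auto simp: nb_def dest: tr_in tr_finite)

lemma tr_card_arcs: "tr V E \<Longrightarrow> card E + 2 = 2 * card V"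
proof (induction rule: tr.induct)
  case (tr_join A EA B EB x y)
  have s: "EA \<subseteq> A \<times> A" "EB \<subseteq> B \<times> B" using tr_join tr_sub by auto
  have f: "finite EA" "finite EB" "finite A" "finite B" using tr_join tr_finite_arcs tr_finite by auto
  have 1: "EA \<inter> EB = {}" using s tr_join by fastforce
  have 2: "(EA \<union> EB) \<inter> {(x, y), (y, x)} = {}" using s tr_join by auto
  have "x \<noteq> y" using tr_join by auto
  then have "card (EA \<union> EB \<union> {(x, y), (y, x)}) = card EA + card EB + 2"
    using 1 2 f by (subst card_Un_disjoint) (auto simp: card_Un_disjoint)
  moreover have "card (A \<union> B) = card A + card B" using f tr_join by (simp add: card_Un_disjoint)
  ultimately show ?case using tr_join.IH by simp
qed auto

text \<open>An edge inside one of two joined trees is cut by induction; the other tree then goes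
  with the side that contains the joining vertex. Hence any edge, not only the one joined last, can
  be cut.\<close>

lemma tr_split:
  assumes "tr V E" "(x, y) \<in> E"
  obtains A EA B EB where "split V E x y A EA B EB"
proof -
  have "\<exists>A EA B EB. split V E x y A EA B EB"
    using assms
  proof (induction arbitrary: x y rule: tr.induct)
    case (tr_join A EA B EB a b)
    have gen: "\<exists>C EC D ED. split (A \<union> B) (EA \<union> EB \<union> {(a, b), (b, a)}) x y C EC D ED"
      if "(x, y) \<in> EA" and h: "\<exists>C EC D ED. split A EA x y C EC D ED" and "tr A EA" "tr B EB" "A \<inter> B = {}" "a \<in> A" "b \<in> B"
      for A EA B EB and a b x y :: 'a
    proof -
      from h obtain C EC D ED where s: "split A EA x y C EC D ED" by auto
      show ?thesis
      proof (cases "a \<in> C")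
        case True
        have "tr (C \<union> B) (EC \<union> EB \<union> {(a, b), (b, a)})"
          using s that True unfolding split_def by (intro tr.tr_join) auto
        then have "split (A \<union> B) (EA \<union> EB \<union> {(a, b), (b, a)}) x y (C \<union> B) (EC \<union> EB \<union> {(a, b), (b, a)}) D ED"
          using s that unfolding split_def by auto
        then show ?thesis by blast
      next
        case False
        then have "tr (D \<union> B) (ED \<union> EB \<union> {(a, b), (b, a)})"
          using s that unfolding split_def by (intro tr.tr_join) auto
        then have "split (A \<union> B) (EA \<union> EB \<union> {(a, b), (b, a)}) x y C EC (D \<union> B) (ED \<union> EB \<union> {(a, b), (b, a)})"
          using s that False unfolding split_def by auto
        then show ?thesis by blast
      qed
    qed
    consider "(x, y) \<in> EA" | "(x, y) \<in> EB" | "x = a" "y = b" | "x = b" "y = a"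
      using tr_join.prems by auto
    then show ?case
    proof cases
      case 1
      then show ?thesis using gen[where x=x and y=y and A=A and EA=EA and B=B and EB=EB and a=a and b=b] tr_join by auto
    next
      case 2
      have e: "B \<union> A = A \<union> B" "EB \<union> EA \<union> {(b, a), (a, b)} = EA \<union> EB \<union> {(a, b), (b, a)}" by auto
      show ?thesis using gen[where x=x and y=y and A=B and EA=EB and B=A and EB=EA and a=b and b=a] 2 tr_join unfolding e by blast
    next
      case 3
      then have "split (A \<union> B) (EA \<union> EB \<union> {(a, b), (b, a)}) x y A EA B EB"
        using tr_join unfolding split_def by auto
      then show ?thesis by blast
    next
      case 4
      then have "split (A \<union> B) (EA \<union> EB \<union> {(a, b), (b, a)}) x y B EB A EA"
        using tr_join unfolding split_def by auto
      then show ?thesis by blast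
    qed
  qed auto
  then show ?thesis using that by blast
qed

text \<open>Connectedness without walks: to see that a local piece is the whole tree, it is enough
  to check that no arc leaves it.\<close>

lemma tr_conn:
  assumes "tr V E" "U \<subseteq> V" "U \<noteq> {}" "\<And>a b. (a, b) \<in> E \<Longrightarrow> a \<in> U \<Longrightarrow> b \<in> U"
  shows "U = V"
  using assms
proof (induction arbitrary: U rule: tr.induct)
  case (tr_join A EA B EB x y)
  have A: "U \<inter> A = A" if "U \<inter> A \<noteq> {}"
    using tr_join.IH(1)[of "U \<inter> A"] that tr_join.prems tr_in[OF tr_join.hyps(1)] by blast
  have B: "U \<inter> B = B" if "U \<inter> B \<noteq> {}"
    using tr_join.IH(2)[of "U \<inter> B"] that tr_join.prems tr_in[OF tr_join.hyps(2)] by blast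
  have "x \<in> U \<longleftrightarrow> y \<in> U" using tr_join.prems(3) by blast
  then show ?case using A B tr_join.prems tr_join.hyps by blast
qed auto

lemma tr_isolated:
  assumes t: "tr V E" and v: "v \<in> V" "nb E v = {}"
  shows "V = {v}" "E = {}"
proof -
  show V: "V = {v}" using tr_conn[OF t, of "{v}"] v unfolding nb_def by auto
  show "E = {}" using tr_sub[OF t] v unfolding V nb_def by auto
qed

text \<open>A neighbour of degree at most 1 leads only back to \<open>c\<close>, so no arc leaves
  the star. This settles trees with a single center.\<close>

lemma tr_star:
  assumes t: "tr V E" and c: "c \<in> V" and leaf: "\<And>w. w \<in> nb E c \<Longrightarrow> deg E w \<le> 1"
  shows "V = insert c (nb E c)"
proof -
  have "insert c (nb E c) = V"
  proof (rule tr_conn[OF t])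
    show "insert c (nb E c) \<subseteq> V" using c tr_in[OF t] unfolding nb_def by blast
    fix a b assume ab: "(a, b) \<in> E" "a \<in> insert c (nb E c)"
    show "b \<in> insert c (nb E c)"
    proof (cases "a = c")
      case False
      then have "a \<in> nb E c" using ab by auto
      then have "card (nb E a) \<le> Suc 0" "c \<in> nb E a" "b \<in> nb E a"
        using leaf ab(1) tr_sym[OF t, of c a] unfolding nb_def by auto
      then have "b = c" using card_le_Suc0_iff_eq[OF tr_finite_nb[OF t, of a]] by blast
      then show ?thesis by simp
    qed (use ab in \<open>auto simp: nb_def\<close>)
  qed simp
  then show ?thesis ..
qed

lemma split_nb:
  assumes "split V E x y A EA B EB"
  shows "nb E x = insert y (nb EA x)" "y \<notin> nb EA x"
    "\<And>v. v \<in> A \<Longrightarrow> v \<noteq> x \<Longrightarrow> nb E v = nb EA v"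
    "nb E y = insert x (nb EB y)" "x \<notin> nb EB y"
    "\<And>v. v \<in> B \<Longrightarrow> v \<noteq> y \<Longrightarrow> nb E v = nb EB v"
proof -
  have s: "EA \<subseteq> A \<times> A" "EB \<subseteq> B \<times> B" "A \<inter> B = {}" "x \<in> A" "y \<in> B" "E = EA \<union> EB \<union> {(x, y), (y, x)}"
    using assms tr_sub unfolding split_def by auto
  show "nb E x = insert y (nb EA x)" "y \<notin> nb EA x"
    "\<And>v. v \<in> A \<Longrightarrow> v \<noteq> x \<Longrightarrow> nb E v = nb EA v"
    "nb E y = insert x (nb EB y)" "x \<notin> nb EB y"
    "\<And>v. v \<in> B \<Longrightarrow> v \<noteq> y \<Longrightarrow> nb E v = nb EB v"
    using s unfolding nb_def by blast+
qed

lemma split_deg: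
  assumes "split V E x y A EA B EB"
  shows "deg E x = Suc (deg EA x)" "\<And>v. v \<in> A \<Longrightarrow> v \<noteq> x \<Longrightarrow> deg E v = deg EA v"
    "deg E y = Suc (deg EB y)" "\<And>v. v \<in> B \<Longrightarrow> v \<noteq> y \<Longrightarrow> deg E v = deg EB v"
  using split_nb[OF assms] assms unfolding split_def by auto

lemma split_card:
  assumes "split V E x y A EA B EB"
  shows "card V = card A + card B" "card A < card V" "card B < card V" "card A > 0" "card B > 0"
proof -
  have "finite A" "finite B" "A \<noteq> {}" "B \<noteq> {}" "A \<inter> B = {}" "V = A \<union> B"
    using assms tr_finite unfolding split_def by auto
  then show "card V = card A + card B" "card A < card V" "card B < card V" "card A > 0" "card B > 0"
    by (auto simp: card_Un_disjoint card_gt_0_iff)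
qed

text \<open>For two cuts in a row: \<open>B\<close> is put back on the part that contains
  \<open>x\<close>, so the second cut becomes one of the whole tree.\<close>

lemma split_lift:
  assumes "split V E x y A EA B EB" "split A EA u v C EC D ED" "x \<in> C"
  shows "split V E u v (C \<union> B) (EC \<union> EB \<union> {(x, y), (y, x)}) D ED"
proof -
  have "tr (C \<union> B) (EC \<union> EB \<union> {(x, y), (y, x)})"
    using assms unfolding split_def by (intro tr_join) auto
  then show ?thesis using assms unfolding split_def by auto
qed

text \<open>The same two cuts in the opposite order: what is left without \<open>D\<close> is cut at
  the first edge.\<close>

lemma split_lift':
  assumes "split V E x y A EA B EB" "split A EA u v C EC D ED" "x \<in> C"
  shows "split (C \<union> B) (EC \<union> EB \<union> {(x, y), (y, x)}) x y C EC B EB"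
  using assms unfolding split_def by auto

text \<open>Prescribing a vertex \<open>y\<close> to be avoided makes the induction work: at a join,
  the leaf is sought in the part without \<open>y\<close>, and there the joining vertex takes the
  role of \<open>y\<close>.\<close>

lemma tr_leaf_split:
  assumes "tr V E" "y \<in> V" "V \<noteq> {y}"
  shows "\<exists>l x A EA. l \<noteq> y \<and> split V E x l A EA {l} {}"
  using assms
proof (induction arbitrary: y rule: tr.induct)
  case (tr_join A EA B EB a b)
  have gen: "\<exists>l x A' EA'. l \<noteq> y \<and> split (A \<union> B) (EA \<union> EB \<union> {(a, b), (b, a)}) x l A' EA' {l} {}"
    if "tr A EA" "tr B EB" "A \<inter> B = {}" "a \<in> A" "b \<in> B" "y \<in> A"
      and IH: "B \<noteq> {b} \<Longrightarrow> \<exists>l x A' EA'. l \<noteq> b \<and> split B EB x l A' EA' {l} {}"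
    for A EA B EB and a b y :: 'a
  proof -
    have sp: "split (A \<union> B) (EA \<union> EB \<union> {(a, b), (b, a)}) a b A EA B EB"
      using that unfolding split_def by auto
    show ?thesis
    proof (cases "B = {b}")
      case True
      have "EB = {}"
        using tr_card_arcs[OF that(2)] tr_finite_arcs[OF that(2)] True by auto
      then show ?thesis using sp True that by (intro exI[of _ b] exI[of _ a]) auto
    next
      case False
      then obtain l x A' EA' where l: "l \<noteq> b" "split B EB x l A' EA' {l} {}" using IH by auto
      then have "b \<in> A'" using that unfolding split_def by auto
      from split_lift[OF split_sym[OF sp] l(2) this]
      have "split (A \<union> B) (EA \<union> EB \<union> {(a, b), (b, a)}) x l (A' \<union> A) (EA' \<union> EA \<union> {(b, a), (a, b)}) {l} {}" .
      moreover have "l \<noteq> y" using l that unfolding split_def by auto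
      ultimately show ?thesis by blast
    qed
  qed
  show ?case
  proof (cases "y \<in> A")
    case True
    then show ?thesis using gen[where y=y and A=A and EA=EA and B=B and EB=EB and a=a and b=b] tr_join by auto
  next
    case False
    have e: "B \<union> A = A \<union> B" "EB \<union> EA \<union> {(b, a), (a, b)} = EA \<union> EB \<union> {(a, b), (b, a)}" by auto
    have "y \<in> B" using False tr_join by auto
    then show ?thesis using gen[where y=y and A=B and EA=EB and B=A and EB=EA and a=b and b=a] tr_join unfolding e by blast
  qed
qed auto

lemma tr_singleton: "tr {v} E \<Longrightarrow> E = {}"
  using tr_sub tr_irrefl by fastforce

lemma tr_leaf_induct [consumes 1, case_names single leaf]:
  assumes "tr V E"
    and "\<And>v. P {v} {}"
    and "\<And>A EA a b. tr A EA \<Longrightarrow> P A EA \<Longrightarrow> a \<in> A \<Longrightarrow> b \<notin> A \<Longrightarrow> P (insert b A) (EA \<union> {(a, b), (b, a)})"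
  shows "P V E"
  using assms(1)
proof (induction "card V" arbitrary: V E rule: less_induct)
  case less
  obtain y where y: "y \<in> V" using tr_nonempty less by blast
  show ?case
  proof (cases "V = {y}")
    case True
    then have "E = {}" using tr_singleton[of y E] less.prems by simp
    then show ?thesis using True assms(2) by simp
  next
    case False
    then obtain l x A EA where s: "split V E x l A EA {l} {}" using tr_leaf_split less.prems y by metis
    then have t: "tr A EA" "x \<in> A" "l \<notin> A" "V = insert l A" "E = EA \<union> {(x, l), (l, x)}"
      unfolding split_def by auto
    have "P A EA" using less.hyps split_card[OF s] t by auto
    then show ?thesis using assms(3) t by auto
  qed
qed

lemma tr_deg_pos:
  assumes "tr V E" "v \<in> V" "card V \<ge> 2"
  shows "deg E v \<ge> 1"
proof (rule ccontr)
  assume "\<not> deg E v \<ge> 1"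
  then have "nb E v = {}" using tr_finite_nb[OF assms(1), of v] by (auto simp: not_le)
  then show False using tr_isolated(1)[OF assms(1,2)] assms(3) by simp
qed

text \<open>\<open>W\<close> induces a forest, which has fewer edges than vertices; every edge
  counts as two arcs.\<close>

lemma tr_inner_arcs:
  assumes "tr V E" "W \<subseteq> V" "W \<noteq> {}"
  shows "card (E \<inter> W \<times> W) + 2 \<le> 2 * card W"
  using assms
proof (induction arbitrary: W rule: tr_leaf_induct)
  case (single v)
  then have "W = {v}" by auto
  then show ?case by simp
next
  case (leaf A EA a b)
  have fin: "finite A" "finite EA" using tr_finite[OF leaf(1)] tr_finite_arcs[OF leaf(1)] by auto
  have sub: "EA \<subseteq> A \<times> A" using tr_sub[OF leaf(1)] .
  show ?case
  proof (cases "b \<in> W")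
    case False
    then have "(EA \<union> {(a, b), (b, a)}) \<inter> W \<times> W = EA \<inter> W \<times> W" by auto
    then show ?thesis using leaf False by (auto simp: subset_insert)
  next
    case True
    define U where "U = W - {b}"
    have W: "W = insert b U" "b \<notin> U" "U \<subseteq> A" "finite U" using True leaf fin unfolding U_def by (auto intro: finite_subset)
    have e: "(EA \<union> {(a, b), (b, a)}) \<inter> W \<times> W \<subseteq> EA \<inter> U \<times> U \<union> {(a, b), (b, a)}"
      using W sub leaf by auto
    then have "card ((EA \<union> {(a, b), (b, a)}) \<inter> W \<times> W) \<le> card (EA \<inter> U \<times> U \<union> {(a, b), (b, a)})"
      using fin by (intro card_mono) auto
    also have "\<dots> \<le> card (EA \<inter> U \<times> U) + card {(a, b), (b, a)}" by (rule card_Un_le)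
    also have "\<dots> \<le> card (EA \<inter> U \<times> U) + 2" by (simp add: card_insert_le_m1)
    finally have c: "card ((EA \<union> {(a, b), (b, a)}) \<inter> W \<times> W) \<le> card (EA \<inter> U \<times> U) + 2" .
    show ?thesis
    proof (cases "U = {}")
      case True
      then have "(EA \<union> {(a, b), (b, a)}) \<inter> W \<times> W = {}" using W leaf sub by auto
      then show ?thesis using W True by simp
    next
      case False
      then show ?thesis using leaf.IH[of U] W c by auto
    qed
  qed
qed

text \<open>Two common neighbours would close a 4-cycle: when the edge from \<open>c\<close> to
  \<open>w\<close> is cut, \<open>w'\<close> stays with \<open>c\<close> and \<open>c'\<close> with
  \<open>w\<close>, although they are adjacent.\<close>

lemma tr_common_nb_unique:
  assumes "tr V E" "(c, w) \<in> E" "(w, c') \<in> E" "(c, w') \<in> E" "(w', c') \<in> E" "c \<noteq> c'"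
  shows "w = w'"
proof (rule ccontr)
  assume ne: "w \<noteq> w'"
  obtain A EA B EB where s: "split V E c w A EA B EB" using tr_split assms by metis
  have "EA \<subseteq> A \<times> A" "EB \<subseteq> B \<times> B"
    using s tr_sub unfolding split_def by blast+
  moreover have "A \<inter> B = {}" "c \<in> A" "w \<in> B" "E = EA \<union> EB \<union> {(c, w), (w, c)}"
    using s unfolding split_def by blast+
  ultimately have sub: "EA \<subseteq> A \<times> A" "EB \<subseteq> B \<times> B" "A \<inter> B = {}" "c \<in> A" "w \<in> B"
    "E = EA \<union> EB \<union> {(c, w), (w, c)}" by blast+
  have "(w, c') \<in> EA \<or> (w, c') \<in> EB" using assms(3,6) unfolding sub(6) by auto
  then have "c' \<in> B" using sub(1-5) by blast
  moreover have "(c, w') \<in> EA \<or> (c, w') \<in> EB" using assms(4) ne sub(3-5) unfolding sub(6) by auto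
  then have "w' \<in> A" "w' \<notin> B" using sub(1-5) by blast+
  moreover have "(w', c') \<in> EA \<or> (w', c') \<in> EB" 
    using assms(5) ne \<open>w' \<in> A\<close> tr_irrefl[OF assms(1), of c] assms(4) sub(3-5) assms(6) unfolding sub(6) by auto
  ultimately have "c' \<in> A" using sub(1-5) by blast
  then show False using \<open>c' \<in> B\<close> sub(3) by blast
qed

section \<open>Counting stable sets and exchanging edges\<close>

definition stab :: "'a set \<Rightarrow> ('a \<times> 'a) set \<Rightarrow> 'a set set" where
  "stab V E = {S. S \<subseteq> V \<and> (\<forall>u\<in>S. \<forall>v\<in>S. (u, v) \<notin> E)}"

text \<open>The predicate lets one join formula serve for \<open>F\<close>, \<open>F1\<close>,
  \<open>F0\<close> and for sets containing two given vertices.\<close>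

definition cnt :: "'a set \<Rightarrow> ('a \<times> 'a) set \<Rightarrow> ('a set \<Rightarrow> bool) \<Rightarrow> nat" where
  "cnt V E P = card {S \<in> stab V E. P S}"

abbreviation F :: "'a set \<Rightarrow> ('a \<times> 'a) set \<Rightarrow> nat" where
  "F V E \<equiv> cnt V E (\<lambda>_. True)"

abbreviation F1 :: "'a set \<Rightarrow> ('a \<times> 'a) set \<Rightarrow> 'a \<Rightarrow> nat" where
  "F1 V E x \<equiv> cnt V E (\<lambda>S. x \<in> S)"

abbreviation F0 :: "'a set \<Rightarrow> ('a \<times> 'a) set \<Rightarrow> 'a \<Rightarrow> nat" where
  "F0 V E x \<equiv> cnt V E (\<lambda>S. x \<notin> S)"

lemma finite_stab: "finite V \<Longrightarrow> finite (stab V E)"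
  by (rule finite_subset[of _ "Pow V"]) (auto simp: stab_def)

lemma empty_stab [simp]: "{} \<in> stab V E"
  by (simp add: stab_def)

lemma stab_subset: "S \<in> stab V E \<Longrightarrow> S' \<subseteq> S \<Longrightarrow> S' \<in> stab V E"
  by (auto simp: stab_def)

lemma cnt_cases:
  assumes "finite V"
  shows "cnt V E P = cnt V E (\<lambda>S. P S \<and> Q S) + cnt V E (\<lambda>S. P S \<and> \<not> Q S)"
proof -
  have "{S \<in> stab V E. P S} = {S \<in> stab V E. P S \<and> Q S} \<union> {S \<in> stab V E. P S \<and> \<not> Q S}" by auto
  then show ?thesis unfolding cnt_def using finite_stab[OF assms, of E]
    by (simp add: card_Un_disjoint disjoint_iff)
qed

lemma F_eq: "finite V \<Longrightarrow> F V E = F0 V E x + F1 V E x"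
  using cnt_cases[of V E "\<lambda>_. True" "\<lambda>S. x \<in> S"] by simp

lemma cnt_pos: "finite V \<Longrightarrow> S \<in> stab V E \<Longrightarrow> P S \<Longrightarrow> cnt V E P > 0"
  unfolding cnt_def using finite_stab[of V E] by (auto simp: card_gt_0_iff)

lemma F0_pos: "finite V \<Longrightarrow> F0 V E x > 0"
  by (rule cnt_pos[of _ "{}"]) auto

lemma F1_pos: "tr V E \<Longrightarrow> x \<in> V \<Longrightarrow> F1 V E x > 0"
  by (rule cnt_pos[of _ "{x}"]) (auto simp: stab_def tr_finite tr_irrefl)

lemma F1_le_F0:
  assumes "finite V"
  shows "F1 V E x \<le> F0 V E x"
  unfolding cnt_def
proof (rule card_inj_on_le[where f = "\<lambda>S. S - {x}"])
  show "inj_on (\<lambda>S. S - {x}) {S \<in> stab V E. x \<in> S}" by (auto simp: inj_on_def)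
  show "(\<lambda>S. S - {x}) ` {S \<in> stab V E. x \<in> S} \<subseteq> {S \<in> stab V E. x \<notin> S}"
    by (auto intro: stab_subset)
  show "finite {S \<in> stab V E. x \<notin> S}" using finite_stab[OF assms] by simp
qed

text \<open>Deleting \<open>x\<close> is injective but does not reach \<open>{z}\<close>, since
  \<open>x\<close> and \<open>z\<close> are adjacent.\<close>

lemma F1_less_F0:
  assumes "tr V E" "(x, z) \<in> E"
  shows "F1 V E x < F0 V E x"
  unfolding cnt_def
proof -
  have fin: "finite (stab V E)" using finite_stab tr_finite assms by blast
  have "(\<lambda>S. S - {x}) ` {S \<in> stab V E. x \<in> S} \<subset> {S \<in> stab V E. x \<notin> S}"
  proof (rule psubsetI)
    show "(\<lambda>S. S - {x}) ` {S \<in> stab V E. x \<in> S} \<subseteq> {S \<in> stab V E. x \<notin> S}"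
      by (auto intro: stab_subset)
    have "{z} \<in> {S \<in> stab V E. x \<notin> S}"
      using assms tr_irrefl[OF assms(1)] tr_in[OF assms] by (auto simp: stab_def)
    moreover have "{z} \<notin> (\<lambda>S. S - {x}) ` {S \<in> stab V E. x \<in> S}"
      using assms(2) by (auto simp: stab_def)
    ultimately show "(\<lambda>S. S - {x}) ` {S \<in> stab V E. x \<in> S} \<noteq> {S \<in> stab V E. x \<notin> S}" by blast
  qed
  then have "card ((\<lambda>S. S - {x}) ` {S \<in> stab V E. x \<in> S}) < card {S \<in> stab V E. x \<notin> S}"
    using fin by (intro psubset_card_mono) auto
  moreover have "card ((\<lambda>S. S - {x}) ` {S \<in> stab V E. x \<in> S}) = card {S \<in> stab V E. x \<in> S}"
    by (rule card_image) (auto simp: inj_on_def)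
  ultimately show "card {S \<in> stab V E. x \<in> S} < card {S \<in> stab V E. x \<notin> S}" by simp
qed

lemma split_parts:
  assumes "split V E x y A EA B EB"
  shows "tr V E" "tr A EA" "tr B EB" "A \<inter> B = {}" "x \<in> A" "y \<in> B" "V = A \<union> B"
    "E = EA \<union> EB \<union> {(x, y), (y, x)}" "finite A" "finite B" "finite V"
proof -
  note d = assms[unfolded split_def]
  show "tr A EA" "tr B EB" "A \<inter> B = {}" "x \<in> A" "y \<in> B" "V = A \<union> B"
    "E = EA \<union> EB \<union> {(x, y), (y, x)}" using d by blast+
  show "tr V E" by (rule split_tr[OF assms])
  show "finite A" "finite B" "finite V" using d \<open>tr V E\<close> tr_finite by blast+
qed

text \<open>A stable set of the joined tree is a pair of stable sets of the parts that do not use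
  both \<open>x\<close> and \<open>y\<close>. As \<open>P\<close> and \<open>Q\<close> each look at
  one side only, the excluded pairs form a product as well. The sum on the left avoids a subtraction
  on \<open>nat\<close>.\<close>

lemma cnt_join:
  assumes "split V E x y A EA B EB"
  shows "cnt V E (\<lambda>S. P (S \<inter> A) \<and> Q (S \<inter> B)) + cnt A EA (\<lambda>S. P S \<and> x \<in> S) * cnt B EB (\<lambda>S. Q S \<and> y \<in> S)
    = cnt A EA P * cnt B EB Q"
proof -
  have sub: "EA \<subseteq> A \<times> A" "EB \<subseteq> B \<times> B" "A \<inter> B = {}" "x \<in> A" "y \<in> B"
    and V: "V = A \<union> B" and E: "E = EA \<union> EB \<union> {(x, y), (y, x)}"
    and fin: "finite A" "finite B"
    using split_parts[OF assms] tr_sub[of A EA] tr_sub[of B EB] by simp_all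
  let ?X = "{S \<in> stab V E. P (S \<inter> A) \<and> Q (S \<inter> B)}"
  let ?SA = "{S \<in> stab A EA. P S}" and ?SB = "{S \<in> stab B EB. Q S}"
  let ?TA = "{S \<in> stab A EA. P S \<and> x \<in> S}" and ?TB = "{S \<in> stab B EB. Q S \<and> y \<in> S}"
  have bij: "bij_betw (\<lambda>S. (S \<inter> A, S \<inter> B)) ?X (?SA \<times> ?SB - ?TA \<times> ?TB)"
  proof (rule bij_betw_byWitness[where f' = "\<lambda>(S, T). S \<union> T"])
    show "\<forall>S\<in>?X. (\<lambda>(S, T). S \<union> T) (S \<inter> A, S \<inter> B) = S" unfolding V stab_def by auto
    have "(S \<union> T) \<inter> A = S \<and> (S \<union> T) \<inter> B = T" if "S \<subseteq> A" "T \<subseteq> B" for S T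
      using that sub(3) by blast
    then show "\<forall>p\<in>?SA \<times> ?SB - ?TA \<times> ?TB. ((case p of (S, T) \<Rightarrow> S \<union> T) \<inter> A, (case p of (S, T) \<Rightarrow> S \<union> T) \<inter> B) = p"
      by (auto simp: stab_def)
    show "(\<lambda>S. (S \<inter> A, S \<inter> B)) ` ?X \<subseteq> ?SA \<times> ?SB - ?TA \<times> ?TB"
      unfolding E V by (auto simp: stab_def)
    show "(\<lambda>(S, T). S \<union> T) ` (?SA \<times> ?SB - ?TA \<times> ?TB) \<subseteq> ?X"
    proof
      fix U assume "U \<in> (\<lambda>(S, T). S \<union> T) ` (?SA \<times> ?SB - ?TA \<times> ?TB)"
      then obtain S T where U: "U = S \<union> T"
        and st: "S \<in> stab A EA" "P S" "T \<in> stab B EB" "Q T" "(S, T) \<notin> ?TA \<times> ?TB" by auto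
      have i: "(S \<union> T) \<inter> A = S" "(S \<union> T) \<inter> B = T" using st sub(3) unfolding stab_def by blast+
      have nxy: "\<not> (x \<in> S \<and> y \<in> T)" using st by auto
      have sa: "S \<subseteq> A" "T \<subseteq> B" using st unfolding stab_def by auto
      have "(u, v) \<notin> E" if uv: "u \<in> S \<union> T" "v \<in> S \<union> T" for u v
      proof
        assume "(u, v) \<in> E"
        then consider "(u, v) \<in> EA" | "(u, v) \<in> EB" | "u = x" "v = y" | "u = y" "v = x" unfolding E by blast
        then show False
        proof cases
          case 1
          then have "u \<in> S" "v \<in> S" using uv sub(1,3) sa by blast+
          then show ?thesis using st(1) 1 unfolding stab_def by blast
        next
          case 2
          then have "u \<in> T" "v \<in> T" using uv sub(2,3) sa by blast+
          then show ?thesis using st(3) 2 unfolding stab_def by blast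
        next
          case 3
          then have "x \<in> S" "y \<in> T" using uv sub(3-5) sa by blast+
          then show ?thesis using nxy by blast
        next
          case 4
          then have "x \<in> S" "y \<in> T" using uv sub(3-5) sa by blast+
          then show ?thesis using nxy by blast
        qed
      qed
      then have "S \<union> T \<in> stab V E" using sa unfolding stab_def V by blast
      then show "U \<in> ?X" using st(2,4) i unfolding U by simp
    qed
  qed
  have f: "finite ?SA" "finite ?SB" using finite_stab[OF fin(1), of EA] finite_stab[OF fin(2), of EB] by auto
  have diff: "card (X - Y) + card Y = card X" if "finite X" "Y \<subseteq> X" for X Y :: "('a set \<times> 'a set) set"
    using that card_mono[OF that] finite_subset[OF that(2,1)] by (simp add: card_Diff_subset)
  have "card (?SA \<times> ?SB - ?TA \<times> ?TB) + card (?TA \<times> ?TB) = card (?SA \<times> ?SB)"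
    using f by (intro diff) auto
  then show ?thesis unfolding cnt_def using bij_betw_same_card[OF bij] by (simp add: card_cartesian_product)
qed

lemma stab_Int_eq: "S \<in> stab V E \<Longrightarrow> S \<subseteq> V"
  by (simp add: stab_def)

lemma F_join:
  assumes "split V E x y A EA B EB"
  shows "F V E + F1 A EA x * F1 B EB y = F A EA * F B EB"
  using cnt_join[OF assms, of "\<lambda>_. True" "\<lambda>_. True"] by simp

lemma cnt_join_left:
  assumes "split V E x y A EA B EB"
  shows "cnt V E (\<lambda>S. P (S \<inter> A)) + cnt A EA (\<lambda>S. P S \<and> x \<in> S) * F1 B EB y = cnt A EA P * F B EB"
  using cnt_join[OF assms, of P "\<lambda>_. True"] by simp

lemma F1_join:
  assumes "split V E x y A EA B EB"
  shows "F1 V E x = F1 A EA x * F0 B EB y" "F0 V E x = F0 A EA x * F B EB"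
proof -
  have x: "x \<in> A" and fin: "finite B" using split_parts(5,10)[OF assms] .
  have "F1 V E x + F1 A EA x * F1 B EB y = F1 A EA x * F B EB"
    using cnt_join_left[OF assms, of "\<lambda>S. x \<in> S"] x by simp
  then show "F1 V E x = F1 A EA x * F0 B EB y"
    using F_eq[OF fin, of EB y] by (simp add: distrib_left)
  show "F0 V E x = F0 A EA x * F B EB"
    using cnt_join_left[OF assms, of "\<lambda>S. x \<notin> S"] x by (simp add: cnt_def)
qed

lemma cnt_single [simp]: "F1 {l} {} l = 1" "F0 {l} {} l = 1" "F {l} {} = 2"
proof -
  have s: "stab {l} {} = {{}, {l}}" by (auto simp: stab_def)
  have "{S \<in> stab {l} {}. l \<in> S} = {{l}}" "{S \<in> stab {l} {}. l \<notin> S} = {{}}" unfolding s by auto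
  then show "F1 {l} {} l = 1" "F0 {l} {} l = 1" unfolding cnt_def by simp_all
  then show "F {l} {} = 2" using F_eq[of "{l}" "{}" l] by simp
qed

text \<open>A leaf \<open>l\<close> can be added to or removed from any stable set that avoids its
  neighbour \<open>x\<close>, so exactly half of these sets contain \<open>l\<close>. The last
  identity is this remark for the sets that contain \<open>z\<close>.\<close>

lemma leaf_cnt:
  assumes "split V E x l A EA {l} {}"
  shows "F1 V E l = F0 A EA x" "F1 V E x = F1 A EA x" "F V E = 2 * F0 A EA x + F1 A EA x"
    "z \<in> A \<Longrightarrow> F1 V E z = cnt V E (\<lambda>S. x \<in> S \<and> z \<in> S) + 2 * cnt V E (\<lambda>S. l \<in> S \<and> z \<in> S)"
proof -
  have x: "x \<in> A" and fin: "finite A" using split_parts(5,9)[OF assms] .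
  have FA: "F A EA = F0 A EA x + F1 A EA x" by (rule F_eq[OF fin])
  show "F1 V E l = F0 A EA x"
    using F1_join(1)[OF split_sym[OF assms]] by simp
  show "F1 V E x = F1 A EA x" using F1_join(1)[OF assms] by simp
  show "F V E = 2 * F0 A EA x + F1 A EA x"
    using F_join[OF assms] FA by simp
  assume z: "z \<in> A"
  have "F1 V E z + cnt A EA (\<lambda>S. z \<in> S \<and> x \<in> S) = 2 * F1 A EA z"
    using cnt_join_left[OF assms, of "\<lambda>S. z \<in> S"] z by simp
  moreover have "cnt V E (\<lambda>S. (z \<in> S \<and> x \<in> S)) + cnt A EA (\<lambda>S. z \<in> S \<and> x \<in> S) = 2 * cnt A EA (\<lambda>S. z \<in> S \<and> x \<in> S)"
    using cnt_join_left[OF assms, of "\<lambda>S. z \<in> S \<and> x \<in> S"] z x by simp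
  moreover have "cnt V E (\<lambda>S. z \<in> S \<and> l \<in> S) + cnt A EA (\<lambda>S. z \<in> S \<and> x \<in> S) = F1 A EA z"
    using cnt_join[OF assms, of "\<lambda>S. z \<in> S" "\<lambda>S. l \<in> S"] z by simp
  ultimately show "F1 V E z = cnt V E (\<lambda>S. x \<in> S \<and> z \<in> S) + 2 * cnt V E (\<lambda>S. l \<in> S \<and> z \<in> S)"
    by (simp add: conj_commute)
qed

text \<open>Expanding \<open>F1 V E l\<close> at the cut and eliminating the leaf by
  \<open>leaf_cnt\<close> turns the exchange inequality for \<open>l\<close> into
  \<open>f0 * (k0 + a - X) \<le> f1 * (k0 + X - J)\<close>. As \<open>X \<le> a\<close>, the left
  side is at least \<open>f0 * k0\<close> and the right side at most \<open>f1 * (k0 + a)\<close>;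
  one of \<open>X < a\<close> and \<open>J > 0\<close> makes it strict.\<close>

lemma branch_ineq:
  assumes V: "split V E y y1 A EA K EK"
    and K: "split K EK x l K' EK' {l} {}" and "l \<noteq> y1"
    and X: "F1 K EK x \<le> F1 K EK y1"
    and strict: "F1 K EK x < F1 K EK y1 \<or> cnt K EK (\<lambda>S. x \<in> S \<and> y1 \<in> S) > 0"
    and le: "F1 V E l \<le> F1 V E y"
  shows "F0 A EA y * F0 K EK y1 < F1 A EA y * F K EK"
proof -
  have trs: "tr A EA" "tr K EK" "y \<in> A" "y1 \<in> K" "l \<in> K" "y1 \<in> K'"
    using split_parts(2-6)[OF V] split_parts(6,7)[OF K] \<open>l \<noteq> y1\<close> by auto
  have fin: "finite A" "finite K" using trs tr_finite by auto
  define f0 f1 k0 a X J e h where d: "f0 = int (F0 A EA y)" "f1 = int (F1 A EA y)" "k0 = int (F0 K EK y1)"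
    "a = int (F1 K EK y1)" "X = int (F1 K EK x)" "J = int (cnt K EK (\<lambda>S. x \<in> S \<and> y1 \<in> S))"
    "e = int (F1 K EK l)" "h = int (cnt K EK (\<lambda>S. l \<in> S \<and> y1 \<in> S))"
  have k: "int (F K EK) = k0 + a" using F_eq[OF fin(2), of EK y1] unfolding d by simp
  have 1: "F1 V E y = F1 A EA y * F0 K EK y1" using F1_join(1)[OF V] .
  have "F1 V E l + F1 A EA y * cnt K EK (\<lambda>S. l \<in> S \<and> y1 \<in> S) = F A EA * F1 K EK l"
    using cnt_join_left[OF split_sym[OF V], of "\<lambda>S. l \<in> S"] trs by (simp add: mult.commute)
  then have "int (F1 V E l) + f1 * h = (f0 + f1) * e"
    unfolding d F_eq[OF fin(1), of EA y] by (simp flip: of_nat_mult of_nat_add)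
  then have 2: "(f0 + f1) * e - f1 * h \<le> f1 * k0"
  proof -
    have "int (F1 V E l) \<le> f1 * k0" using le 1 unfolding d by (metis of_nat_le_iff of_nat_mult)
    then show ?thesis using \<open>int (F1 V E l) + f1 * h = (f0 + f1) * e\<close> by linarith
  qed
  have 3: "2 * e + X = k0 + a" "2 * h + J = a"
    using leaf_cnt[OF K] trs(6) k unfolding d by simp_all
  have "f0 * (k0 + a - X) + f1 * (k0 + a - X) - f1 * (a - J) \<le> 2 * (f1 * k0)"
  proof -
    have "2 * ((f0 + f1) * e - f1 * h) = (f0 + f1) * (2 * e) - f1 * (2 * h)" by (simp add: algebra_simps)
    moreover have "2 * e = k0 + a - X" "2 * h = a - J" using 3 by auto
    ultimately have "2 * ((f0 + f1) * e - f1 * h) = (f0 + f1) * (k0 + a - X) - f1 * (a - J)" by metis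
    then show ?thesis using 2 by (simp add: distrib_right)
  qed
  then have 4: "f0 * (k0 + a - X) \<le> f1 * (k0 + X - J)"
    by (simp add: algebra_simps)
  have pos: "f1 > 0" "f0 \<ge> 0" "J \<ge> 0" using F1_pos[OF trs(1,3)] unfolding d by auto
  have Xa: "X \<le> a" using X unfolding d by simp
  have st: "X < a \<or> J > 0" using strict unfolding d by auto
  have "f0 * k0 \<le> f0 * (k0 + a - X)" using pos Xa by (intro mult_left_mono) auto
  also have "\<dots> \<le> f1 * (k0 + X - J)" by (rule 4)
  also have "\<dots> < f1 * (k0 + a)" using pos Xa st by (intro mult_strict_left_mono) auto
  finally have "int (F0 A EA y * F0 K EK y1) < int (F1 A EA y * F K EK)"
    unfolding of_nat_mult k unfolding d .
  then show ?thesis by linarith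
qed

section \<open>Optimal trees and allowed exchanges of edges\<close>

definition has_stable :: "'a set \<Rightarrow> ('a \<times> 'a) set \<Rightarrow> nat \<Rightarrow> bool" where
  "has_stable V E a \<longleftrightarrow> (\<exists>D\<in>stab V E. a \<le> card D)"

definition optimal :: "'a set \<Rightarrow> ('a \<times> 'a) set \<Rightarrow> nat \<Rightarrow> bool" where
  "optimal V E a \<longleftrightarrow> tr V E \<and> has_stable V E a \<and>
     (\<forall>(V' :: 'a set) E'. tr V' E' \<and> card V' = card V \<and> has_stable V' E' a \<longrightarrow> F V E \<le> F V' E')"

text \<open>A new edge from \<open>x\<close> to \<open>y\<close> spoils a stable set only if both
  ends belong to it. The witness may depend on the pair; this makes all pairs movable as soon as one
  stable set is larger than \<open>a\<close>.\<close>

definition movable :: "'a set \<Rightarrow> ('a \<times> 'a) set \<Rightarrow> nat \<Rightarrow> 'a \<Rightarrow> 'a \<Rightarrow> bool" where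
  "movable V E a x y \<longleftrightarrow> (\<exists>D\<in>stab V E. a \<le> card D \<and> \<not> (x \<in> D \<and> y \<in> D))"

lemma opt_move:
  assumes "optimal V E a" and s: "split V E x y A EA B EB" and "x' \<in> A" "y' \<in> B" and "movable V E a x' y'"
  shows "F1 A EA x' * F1 B EB y' \<le> F1 A EA x * F1 B EB y"
proof -
  let ?E = "EA \<union> EB \<union> {(x', y'), (y', x')}"
  have V: "V = A \<union> B" and E: "E = EA \<union> EB \<union> {(x, y), (y, x)}" using s unfolding split_def by auto
  have s': "split V ?E x' y' A EA B EB" using assms unfolding split_def by auto
  obtain D where D: "D \<in> stab V E" "a \<le> card D" "\<not> (x' \<in> D \<and> y' \<in> D)" using assms(5) unfolding movable_def by auto
  have "D \<in> stab V ?E" using D(1,3) unfolding stab_def E by blast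
  then have "has_stable V ?E a" using D unfolding has_stable_def by auto
  then have "F V E \<le> F V ?E" using assms(1) split_tr[OF s'] unfolding optimal_def by blast
  then show ?thesis using F_join[OF s] F_join[OF s'] by linarith
qed

lemma opt_move_right:
  assumes "optimal V E a" and s: "split V E x y A EA B EB" and "y' \<in> B" and "movable V E a x y'"
  shows "F1 B EB y' \<le> F1 B EB y"
proof -
  have "F1 A EA x > 0" "x \<in> A" using s F1_pos unfolding split_def by auto
  then show ?thesis using opt_move[OF assms(1,2) _ assms(3,4)] by simp
qed

lemma movable_sym: "movable V E a x y = movable V E a y x"
  unfolding movable_def by blast

text \<open>With the branch of \<open>y3\<close> detached, comparing \<open>y\<close> with a leaf in the branch of \<open>y1\<close> shows that \<open>y1\<close>
  belongs to a larger share of the stable sets of its branch than \<open>y2\<close> does in its own. The roles of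
  \<open>y1\<close> and \<open>y2\<close> can be exchanged.\<close>

lemma no_three_branches:
  assumes opt: "optimal V E a"
    and nb: "y1 \<in> nb E y" "y2 \<in> nb E y" "y3 \<in> nb E y" "y1 \<noteq> y2" "y1 \<noteq> y3" "y2 \<noteq> y3"
    and mvs: "\<And>l x. l \<in> V \<Longrightarrow> nb E l = {x} \<Longrightarrow>
      movable V E a y x \<and> movable V E a l y3 \<and> (movable V E a y l \<or> nb E x \<inter> nb E y = {})"
  shows False
proof -
  have tr: "tr V E" using opt unfolding optimal_def by auto
  obtain A EA B EB where s3: "split V E y y3 A EA B EB"
    using tr_split[OF tr] nb unfolding nb_def by blast
  have trA: "tr A EA" "y \<in> A" using s3 unfolding split_def by auto
  have nbA: "nb E y = insert y3 (nb EA y)" using split_nb[OF s3] by auto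
  have key: "F0 C EC y * F0 K EK z < F1 C EC y * F K EK"
    if z: "z \<in> nb EA y" and sz: "split A EA y z C EC K EK" for z C EC K EK
  proof -
    have yC: "y \<in> C" and zK: "z \<in> K" and trK: "tr K EK" and trC: "tr C EC" using sz unfolding split_def by auto
    have sV: "split V E y z (C \<union> B) (EC \<union> EB \<union> {(y, y3), (y3, y)}) K EK"
      using split_lift[OF s3 sz yC] .
    have zy: "z \<in> nb E y" using z nbA by auto
    have moveA: "F1 A EA l \<le> F1 A EA y" if "l \<in> A" "movable V E a l y3" for l
      using opt_move_right[OF opt split_sym[OF s3] that(1)] that(2) by (simp add: movable_sym)
    show ?thesis
    proof (cases "K = {z}")
      case True
      have EK: "EK = {}" using tr_singleton[OF trK[unfolded True]] .
      have "nb E z = {y}" using split_nb(4)[OF sV] EK by (simp add: nb_def)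
      then have "movable V E a z y3" using mvs[of z y] zy tr_in[OF tr] unfolding nb_def by blast
      moreover have "z \<in> A" using sz unfolding split_def by auto
      ultimately have "F1 A EA z \<le> F1 A EA y" using moveA by blast
      then have "F0 C EC y \<le> F1 C EC y"
        using leaf_cnt(1,2)[OF sz[unfolded True EK]] by simp
      then show ?thesis using F1_pos[OF trC yC] unfolding True EK by simp
    next
      case False
      then obtain l x K' EK' where l: "l \<noteq> z" "split K EK x l K' EK' {l} {}"
        using tr_leaf_split[OF trK zK] by blast
      have in_K: "l \<in> K" "x \<in> K'" "z \<in> K'" "x \<in> K" "tr K' EK'" "x \<noteq> l" using l zK unfolding split_def by auto
      have "nb EK l = {x}" using split_nb(4)[OF l(2)] by (simp add: nb_def)
      then have nl: "nb E l = {x}" using split_nb(6)[OF sV in_K(1) l(1)] by simp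
      have lV: "l \<in> V" "l \<in> A" using in_K(1) sV sz unfolding split_def by auto
      note m = mvs[OF lV(1) nl]
      have xz: "F1 K EK x \<le> F1 K EK z" using opt_move_right[OF opt sV in_K(4)] m by blast
      \<comment> \<open>If \<open>x\<close> is adjacent to \<open>z\<close>, then \<open>l\<close>
        and \<open>y\<close> may be joined as well, and \<open>l\<close> already lies in more sets
        than \<open>x\<close>. Otherwise \<open>{x, z}\<close> is a stable set that contains
        both.\<close>
      have st: "F1 K EK x < F1 K EK z \<or> cnt K EK (\<lambda>S. x \<in> S \<and> z \<in> S) > 0"
      proof (cases "(x, z) \<in> EK")
        case True
        then have "z \<in> nb E x" using sV unfolding split_def nb_def by auto
        then have "movable V E a y l" using m zy by blast
        then have "F1 K EK l \<le> F1 K EK z" using opt_move_right[OF opt sV in_K(1)] by blast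
        moreover have "(x, z) \<in> EK'" using True l in_K tr_irrefl[OF trK] unfolding split_def by auto
        then have "F1 K EK x < F1 K EK l" using leaf_cnt[OF l(2)] F1_less_F0[OF in_K(5)] by simp
        ultimately show ?thesis by simp
      next
        case False
        then have "(z, x) \<notin> EK" using tr_sym[OF trK] by blast
        then have "{x, z} \<in> stab K EK" using False in_K zK tr_irrefl[OF trK] unfolding stab_def by auto
        then have "cnt K EK (\<lambda>S. x \<in> S \<and> z \<in> S) > 0" using cnt_pos[OF tr_finite[OF trK], of "{x, z}"] by simp
        then show ?thesis ..
      qed
      have "F1 A EA l \<le> F1 A EA y" using moveA lV m by blast
      then show ?thesis using branch_ineq[OF sz l(2,1) xz st] by blast
    qed
  qed
  have y1: "y1 \<in> nb EA y" and y2: "y2 \<in> nb EA y" using nb nbA by auto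
  obtain A1 EA1 K1 EK1 where s1: "split A EA y y1 A1 EA1 K1 EK1"
    using tr_split[OF trA(1)] y1 unfolding nb_def by blast
  have y2': "y2 \<in> nb EA1 y" using split_nb(1)[OF s1] y2 nb by auto
  have trA1: "tr A1 EA1" using s1 unfolding split_def by auto
  obtain R ER K2 EK2 where s2: "split A1 EA1 y y2 R ER K2 EK2"
    using tr_split[OF trA1] y2' unfolding nb_def by blast
  have yR: "y \<in> R" and trR: "tr R ER" and trK: "tr K1 EK1" "tr K2 EK2" "y1 \<in> K1" "y2 \<in> K2"
    using s1 s2 unfolding split_def by auto
  note s2' = split_lift[OF s1 s2 yR] and sR = split_lift'[OF s1 s2 yR]
  define r0 r1 k1 k10 k2 k20 where d: "r0 = F0 R ER y" "r1 = F1 R ER y" "k1 = F K1 EK1" "k10 = F0 K1 EK1 y1"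
    "k2 = F K2 EK2" "k20 = F0 K2 EK2 y2"
  \<comment> \<open>\<open>R\<close> is what remains without all three branches. Since
    \<open>r1 \<le> r0\<close>, the first inequality implies \<open>k2 * k10 < k1 * k20\<close>, the
    second one the reverse.\<close>
  have i1: "r0 * (k2 * k10) < r1 * (k1 * k20)"
    using key[OF y1 s1] F1_join[OF s2] unfolding d by (simp add: ac_simps)
  have i2: "r0 * (k1 * k20) < r1 * (k2 * k10)"
    using key[OF y2 s2'] F1_join[OF sR] unfolding d by (simp add: ac_simps)
  have r: "r1 \<le> r0" using F1_le_F0[OF tr_finite[OF trR]] unfolding d by simp
  have "r1 * (k2 * k10) \<le> r0 * (k2 * k10)" "r1 * (k1 * k20) \<le> r0 * (k1 * k20)" using r by (auto intro: mult_right_mono)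
  then show False using i1 i2 by linarith
qed

section \<open>Optimal trees are trees of stars\<close>

lemma two_elems:
  assumes "card S \<ge> 2"
  shows "\<exists>x\<in>S. \<exists>y\<in>S. x \<noteq> y"
proof (rule ccontr)
  assume "\<not> ?thesis"
  moreover have "finite S" using assms by (metis card.infinite not_numeral_le_zero)
  ultimately have "card S \<le> Suc 0" by (subst card_le_Suc0_iff_eq) auto
  then show False using assms by simp
qed

lemma sum_deg:
  assumes "tr V E" "U \<subseteq> V"
  shows "(\<Sum>v\<in>U. deg E v) = card (E \<inter> U \<times> UNIV)"
proof -
  have "E \<inter> U \<times> UNIV = (SIGMA v:U. nb E v)" unfolding nb_def by auto
  moreover have "finite U" using assms tr_finite finite_subset by blast
  ultimately show ?thesis using tr_finite_nb[OF assms(1)] by (simp add: card_SigmaI)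
qed

lemma sum_deg_stable:
  assumes t: "tr V E" and D: "D \<in> stab V E"
  shows "(\<Sum>v\<in>D. deg E v) + card (E \<inter> (V - D) \<times> (V - D)) = (\<Sum>v\<in>V - D. deg E v)"
    "(\<Sum>v\<in>D. deg E v) + (\<Sum>v\<in>V - D. deg E v) + 2 = 2 * card V"
proof -
  have sub: "D \<subseteq> V" using D unfolding stab_def by auto
  have fin: "finite E" using tr_finite_arcs[OF t] .
  have EV: "E \<subseteq> V \<times> V" using tr_sub[OF t] .
  have "(x, y) \<in> E \<inter> D \<times> UNIV \<longleftrightarrow> (y, x) \<in> E \<inter> (V - D) \<times> D" for x y
    using D EV tr_sym[OF t, of x y] tr_sym[OF t, of y x] unfolding stab_def by blast
  then have "E \<inter> D \<times> UNIV = (E \<inter> (V - D) \<times> D)\<inverse>" by auto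
  then have 1: "card (E \<inter> D \<times> UNIV) = card (E \<inter> (V - D) \<times> D)"
    by (metis card_inverse)
  have "E \<inter> (V - D) \<times> UNIV = (E \<inter> (V - D) \<times> D) \<union> (E \<inter> (V - D) \<times> (V - D))" using EV by auto
  then have 2: "card (E \<inter> (V - D) \<times> UNIV) = card (E \<inter> (V - D) \<times> D) + card (E \<inter> (V - D) \<times> (V - D))"
    using fin by (simp add: card_Un_disjoint disjoint_iff)
  show "(\<Sum>v\<in>D. deg E v) + card (E \<inter> (V - D) \<times> (V - D)) = (\<Sum>v\<in>V - D. deg E v)"
    using sum_deg[OF t sub] sum_deg[OF t, of "V - D"] 1 2 by simp
  have "E = (E \<inter> D \<times> UNIV) \<union> (E \<inter> (V - D) \<times> UNIV)" using EV by auto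
  then have "card E = card (E \<inter> D \<times> UNIV) + card (E \<inter> (V - D) \<times> UNIV)"
    using fin by (metis (no_types, lifting) Diff_disjoint Sigma_Int_distrib1 Sigma_empty1 card_Un_disjoint finite_Int inf.left_idem inf_assoc inf_bot_right inf_commute)
  then show "(\<Sum>v\<in>D. deg E v) + (\<Sum>v\<in>V - D. deg E v) + 2 = 2 * card V"
    using sum_deg[OF t sub] sum_deg[OF t, of "V - D"] tr_card_arcs[OF t] by simp
qed

text \<open>Such a tree is a path, where a stable set has hardly more than half of the vertices, and
  fewer if some edges avoid it. The contradictions to \<open>card V < 2 * a\<close> come from this
  inequality.\<close>

lemma deg_le_2_bound:
  assumes t: "tr V E" and D: "D \<in> stab V E" and deg: "\<And>v. v \<in> V \<Longrightarrow> deg E v \<le> 2"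
  shows "2 * card V + card (E \<inter> (V - D) \<times> (V - D)) \<le> 4 * (card V - card D) + 2"
proof -
  have sub: "D \<subseteq> V" "finite V" "finite D" using D tr_finite[OF t] unfolding stab_def by (auto intro: finite_subset)
  have "(\<Sum>v\<in>V - D. deg E v) \<le> (\<Sum>v\<in>V - D. 2)" using deg by (intro sum_mono) auto
  also have "\<dots> = 2 * (card V - card D)" using sub by (simp add: card_Diff_subset)
  finally show ?thesis using sum_deg_stable[OF t D] by linarith
qed

lemma optimal_tr: "optimal V E a \<Longrightarrow> tr V E"
  unfolding optimal_def by auto

lemma optimal_no_bigger_stable:
  assumes opt: "optimal V E a" and n: "card V < 2 * a" and D: "D \<in> stab V E"
  shows "card D \<le> a"
proof (rule ccontr)
  assume big: "\<not> card D \<le> a"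
  have t: "tr V E" using optimal_tr[OF opt] .
  have fin: "finite D" using D tr_finite[OF t] unfolding stab_def by (auto intro: finite_subset)
  have movable: "movable V E a x y" for x y
  proof -
    have "a \<le> card (D - {x})" using big fin card_Diff_singleton_if[of D x] by auto
    then show ?thesis unfolding movable_def using stab_subset[OF D, of "D - {x}"] by blast
  qed
  have "deg E v \<le> 2" for v
  proof (rule ccontr)
    assume "\<not> deg E v \<le> 2"
    then obtain y3 where y3: "y3 \<in> nb E v" by (cases "nb E v = {}") auto
    then have "card (nb E v - {y3}) \<ge> 2" using \<open>\<not> deg E v \<le> 2\<close> by simp
    then obtain y1 y2 where "y1 \<in> nb E v - {y3}" "y2 \<in> nb E v - {y3}" "y1 \<noteq> y2" using two_elems by blast
    then show False using no_three_branches[OF opt, of y1 v y2 y3] y3 movable by blast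
  qed
  then have "2 * card V \<le> 4 * (card V - card D) + 2"
    using deg_le_2_bound[OF t D] by fastforce
  moreover have "card D \<le> card V" using D tr_finite[OF t] unfolding stab_def by (auto intro: card_mono)
  ultimately show False using big n by linarith
qed

definition valid :: "'a set \<Rightarrow> ('a \<times> 'a) set \<Rightarrow> nat \<Rightarrow> 'a set \<Rightarrow> bool" where
  "valid V E a D \<longleftrightarrow> D \<in> stab V E \<and> card D = a \<and> (\<forall>v\<in>V. deg E v \<le> 1 \<longrightarrow> v \<in> D)"

lemma card_1_eq: "card S = 1 \<Longrightarrow> x \<in> S \<Longrightarrow> S = {x}"
  by (auto simp: card_1_singleton_iff)

lemma adjacent_leaves:
  assumes t: "tr V E" and "nb E u = {w}" "nb E w = {u}" "u \<in> V"
  shows "V = {u, w}"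
proof -
  have "w \<in> V" using assms(2) tr_in[OF t] unfolding nb_def by auto
  then show ?thesis using tr_conn[OF t, of "{u, w}"] assms unfolding nb_def by auto
qed

lemma stab_swap:
  assumes t: "tr V E" and D: "D \<in> stab V E" and u: "u \<in> V" "u \<notin> D" "nb E u \<inter> D \<subseteq> {w}"
  shows "insert u (D - {w}) \<in> stab V E" "w \<in> D \<Longrightarrow> card (insert u (D - {w})) = card D"
proof -
  have "(u, v) \<notin> E \<and> (v, u) \<notin> E" if "v \<in> D - {w}" for v
    using that u(3) tr_sym[OF t, of v u] unfolding nb_def by blast
  then show "insert u (D - {w}) \<in> stab V E"
    using D u tr_irrefl[OF t] unfolding stab_def by blast
  assume w: "w \<in> D"
  have "finite D" using D tr_finite[OF t] unfolding stab_def by (auto intro: finite_subset)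
  then show "card (insert u (D - {w})) = card D" using card_Suc_Diff1[OF _ w] u(2) by simp
qed

text \<open>Among the stable sets of size \<open>a\<close>, one with the most leaves is chosen. A
  leaf outside it could be added, giving too large a set, or exchanged for its neighbour, which is
  no leaf as there are at least three vertices.\<close>

lemma ex_valid:
  assumes opt: "optimal V E a" and n: "card V < 2 * a" "3 \<le> card V"
  shows "\<exists>D. valid V E a D"
proof -
  have t: "tr V E" using optimal_tr[OF opt] .
  have finV: "finite V" using tr_finite[OF t] .
  let ?L = "{v \<in> V. deg E v \<le> 1}"
  let ?P = "\<lambda>D. D \<in> stab V E \<and> card D = a"
  obtain D0 where "D0 \<in> stab V E" "a \<le> card D0" using opt unfolding optimal_def has_stable_def by auto
  then have D0: "?P D0" using optimal_no_bigger_stable[OF opt n(1)] by (simp add: le_antisym)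
  have "\<forall>D. ?P D \<longrightarrow> card (D \<inter> ?L) < Suc (card V)"
    using finV by (auto intro!: card_mono simp: stab_def less_Suc_eq_le)
  from ex_has_greatest_nat[of ?P D0 "\<lambda>D. card (D \<inter> ?L)" "Suc (card V)", OF D0 this]
  obtain D where Dm: "?P D \<and> (\<forall>D'. ?P D' \<longrightarrow> card (D' \<inter> ?L) \<le> card (D \<inter> ?L))" ..
  then have D: "?P D" ..
  have max: "card (D' \<inter> ?L) \<le> card (D \<inter> ?L)" if "?P D'" for D' using Dm that by simp
  have "v \<in> D" if v: "v \<in> V" "deg E v \<le> 1" for v
  proof (rule ccontr)
    assume vD: "v \<notin> D"
    have "deg E v = 1" using tr_deg_pos[OF t v(1)] v(2) n(2) by auto
    then obtain w where w: "nb E v = {w}" using card_1_singletonE by blast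
    have "(v, w) \<in> E" using w unfolding nb_def by auto
    then have wv: "v \<in> nb E w" "w \<in> V" using tr_sym[OF t] tr_in[OF t] unfolding nb_def by blast+
    show False
    proof (cases "w \<in> D")
      case False
      then have "insert v (D - {w}) \<in> stab V E" using stab_swap(1)[OF t _ v(1) vD, of w] D w by auto
      then have "card (insert v (D - {w})) \<le> a" using optimal_no_bigger_stable[OF opt n(1)] by blast
      moreover have "finite D" using D finV unfolding stab_def by (auto intro: finite_subset)
      ultimately show False using D False vD by simp
    next
      case True
      let ?D = "insert v (D - {w})"
      have "deg E w \<noteq> 1"
      proof
        assume "deg E w = 1"
        then have "nb E w = {v}" using card_1_eq wv by metis
        then have "V = {v, w}" using adjacent_leaves[OF t w] v by simp
        then have "card V \<le> 2" by (simp add: card_insert_if)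
        then show False using n(2) by simp
      qed
      then have "w \<notin> ?L" using tr_deg_pos[OF t wv(2)] n(2) by auto
      then have "?D \<inter> ?L = insert v (D \<inter> ?L)" using v by auto
      moreover have "finite (D \<inter> ?L)" using finV by simp
      ultimately have "card (?D \<inter> ?L) = Suc (card (D \<inter> ?L))" using vD by simp
      moreover have "?P ?D" using stab_swap[OF t _ v(1) vD, of w] D w True by auto
      ultimately show False using max by fastforce
    qed
  qed
  then show ?thesis using D unfolding valid_def by blast
qed

text \<open>Every exchange considered in \<open>no_three_branches\<close> involves the vertex
  \<open>c\<close> or the third neighbour \<open>c'\<close>. Neither is in \<open>D\<close>, so
  \<open>D\<close> stays stable.\<close>

lemma valid_inner_arc_deg:
  assumes opt: "optimal V E a" and D: "valid V E a D" and c: "(c, c') \<in> E" "c \<notin> D" "c' \<notin> D"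
  shows "deg E c \<le> 2"
proof (rule ccontr)
  assume "\<not> deg E c \<le> 2"
  moreover have cn: "c' \<in> nb E c" using c unfolding nb_def by auto
  ultimately have "card (nb E c - {c'}) \<ge> 2" by simp
  then obtain y1 y2 where y: "y1 \<in> nb E c - {c'}" "y2 \<in> nb E c - {c'}" "y1 \<noteq> y2" using two_elems by blast
  have "movable V E a x y" if "x \<notin> D \<or> y \<notin> D" for x y
    using D that unfolding valid_def movable_def by auto
  then show False using no_three_branches[OF opt, of y1 c y2 c'] y cn c by blast
qed

text \<open>If \<open>c\<close> has degree 2, with neighbours \<open>c'\<close> and \<open>w\<close> and with \<open>w\<close> in \<open>D\<close>, then exchanging \<open>w\<close> for \<open>c\<close> in \<open>D\<close>
  pushes the arc that avoids \<open>D\<close> one step away from \<open>c'\<close>.\<close>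

lemma valid_inner_arc_path:
  assumes opt: "optimal V E a" and n: "card V < 2 * a"
  shows "valid V E a D \<Longrightarrow> c \<notin> D \<Longrightarrow> c' \<notin> D \<Longrightarrow> split V E c c' A EA B EB \<Longrightarrow> v \<in> A \<Longrightarrow> deg E v \<le> 2"
proof (induction "card A" arbitrary: D c c' A EA B EB rule: less_induct)
  case less
  note s = less.prems(4)
  have t: "tr V E" using optimal_tr[OF opt] .
  have D: "D \<in> stab V E" "card D = a" using less.prems(1) unfolding valid_def by auto
  have Dd: "(x, y) \<notin> E" if "x \<in> D" "y \<in> D" for x y using D(1) that unfolding stab_def by blast
  have finD: "finite D" using D tr_finite[OF t] unfolding stab_def by (auto intro: finite_subset)
  note sp = split_parts[OF s]
  have cV: "c \<in> V" "(c, c') \<in> E" unfolding sp(7,8) using sp(5) by auto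
  have dc: "deg E c \<le> 2" using valid_inner_arc_deg[OF opt less.prems(1) cV(2) less.prems(2,3)] .
  obtain w where w: "w \<in> nb E c" "w \<in> D"
  proof -
    have "nb E c \<inter> D \<noteq> {}"
    proof
      assume "nb E c \<inter> D = {}"
      \<comment> \<open>As \<open>c'\<close> is not in \<open>D\<close>, this merely adds
        \<open>c\<close> and yields a stable set of size \<open>a + 1\<close>.\<close>
      then have "insert c (D - {c'}) \<in> stab V E" using stab_swap(1)[OF t D(1) cV(1) less.prems(2), of c'] by auto
      then have "card (insert c (D - {c'})) \<le> a" using optimal_no_bigger_stable[OF opt n] by blast
      then show False using finD less.prems(2,3) D(2) by simp
    qed
    then show ?thesis using that by blast
  qed
  have wc': "w \<noteq> c'" using w less.prems(3) by auto
  have nbc: "nb E c = {c', w}"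
  proof -
    have "{c', w} \<subseteq> nb E c" using w cV unfolding nb_def by auto
    moreover have "card {c', w} = 2" using wc' by auto
    ultimately show ?thesis using dc tr_finite_nb[OF t] by (metis card_seteq)
  qed
  have nbEAc: "nb EA c = {w}" using split_nb(1,2)[OF s] nbc wc' by auto
  have wA: "w \<in> A" "(c, w) \<in> EA" using nbEAc tr_in[OF sp(2), of c w] unfolding nb_def by blast+
  have wc: "w \<noteq> c" "(w, c) \<in> EA" using wA tr_irrefl[OF sp(2), of c] tr_sym[OF sp(2), of c w] by auto
  have nbw: "nb E w = nb EA w" using split_nb(3)[OF s wA(1) wc(1)] .
  have wV: "w \<in> V" "c \<in> nb E w" using wA(1) sp(7) nbw wc(2) unfolding nb_def by auto
  show ?case
  proof (cases "deg E w = 1")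
    case True
    then have "nb EA w = {c}" using card_1_eq wV(2) nbw by metis
    then have "A = {w, c}" using adjacent_leaves[OF sp(2) _ nbEAc] wA by simp
    then show ?thesis using less.prems(5) dc True by auto
  next
    case False
    have dw1: "deg E w > 1" using False wV(2) tr_finite_nb[OF t, of w] by (metis One_nat_def Suc_lessI card_gt_0_iff empty_iff)
    define D' where "D' = insert c (D - {w})"
    have D': "valid V E a D'"
      using stab_swap[OF t D(1) cV(1) less.prems(2), of w] w nbc less.prems(1,3) dw1
      unfolding D'_def valid_def by auto
    have nD': "u \<notin> D'" if "u \<in> nb E w" "u \<noteq> c" for u
      using Dd[of w u] w(2) that unfolding D'_def nb_def by auto
    have wD': "w \<notin> D'" using wc(1) unfolding D'_def by auto
    have "\<exists>u\<in>nb E w. u \<noteq> c"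
    proof (rule ccontr)
      assume "\<not> ?thesis"
      then have "nb E w \<subseteq> {c}" by auto
      then have "deg E w \<le> card {c}" by (intro card_mono) auto
      then show False using dw1 by simp
    qed
    then obtain u where u: "u \<in> nb E w" "u \<noteq> c" by blast
    have uE: "(w, u) \<in> E" "(u, w) \<in> E" using u tr_sym[OF t, of w u] unfolding nb_def by auto
    have uw: "(u, w) \<in> EA" using u(1) tr_sym[OF sp(2), of w u] unfolding nbw by (auto simp: nb_def)
    have dw: "deg E w \<le> 2" using valid_inner_arc_deg[OF opt D' uE(1) wD' nD'[OF u]] .
    obtain A' EA' W EW where s': "split A EA u w A' EA' W EW" using tr_split[OF sp(2) uw] by blast
    note sp' = split_parts[OF s']
    have nbw2: "nb E w = {c, u}"
    proof -
      have "{c, u} \<subseteq> nb E w" using u wV by auto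
      moreover have "card {c, u} = 2" using u by auto
      ultimately show ?thesis using dw tr_finite_nb[OF t] by (metis card_seteq)
    qed
    have nW: "nb EW w = {c}" using split_nb(4,5)[OF s'] nbw nbw2 u(2) by auto
    have cW: "c \<in> W" using nW tr_in[OF sp'(3), of w c] unfolding nb_def by blast
    have "nb EW c = {w}" using split_nb(6)[OF s' cW] wc nbEAc by simp
    then have W: "W = {c, w}" using adjacent_leaves[OF sp'(3) _ nW cW] by simp
    \<comment> \<open>Now \<open>u\<close> and \<open>w\<close> play the roles of \<open>c\<close>
      and \<open>c'\<close>, with \<open>D'\<close> for \<open>D\<close>. The part on the side of
      \<open>u\<close> has lost only \<open>c\<close> and \<open>w\<close>, whose degrees are
      already bounded.\<close>
    have sV: "split V E u w A' EA' (W \<union> B) (EW \<union> EB \<union> {(c, c'), (c', c)})"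
      using split_sym[OF split_lift[OF s split_sym[OF s'] cW]] .
    have small: "card A' < card A" using split_card(2)[OF s'] .
    show ?thesis
    proof (cases "v \<in> A'")
      case True
      show ?thesis using less.hyps[OF small D' nD'[OF u] wD' sV True] .
    next
      case False
      then have "v = c \<or> v = w" using less.prems(5) sp'(7) W by auto
      then show ?thesis using dc dw by auto
    qed
  qed
qed

text \<open>The non-inductive form of a tree of stars, with \<open>V - D\<close> as its set of
  centers; \<open>tree_of_stars_star_tree\<close> and \<open>star_tree_tree_of_stars\<close> give
  the equivalence. For the one-vertex tree, \<open>D = V\<close>.\<close>

definition star_tree :: "'a set \<Rightarrow> ('a \<times> 'a) set \<Rightarrow> 'a set \<Rightarrow> bool" where
  "star_tree V E D \<longleftrightarrow> tr V E \<and> D \<subseteq> V \<and> (\<forall>u v. (u, v) \<in> E \<longrightarrow> (u \<in> D \<longleftrightarrow> v \<notin> D)) \<and>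
     (\<forall>v\<in>V. deg E v \<le> 1 \<longrightarrow> v \<in> D) \<and> (\<forall>v\<in>D. deg E v \<le> 2)"

lemma optimal_star_tree:
  assumes opt: "optimal V E a" and n: "card V < 2 * a" "3 \<le> card V"
  shows "\<exists>D. star_tree V E D \<and> card D = a"
proof -
  have t: "tr V E" using optimal_tr[OF opt] .
  obtain D where D: "valid V E a D" using ex_valid[OF assms] by blast
  then have Ds: "D \<in> stab V E" "card D = a" "\<And>v. v \<in> V \<Longrightarrow> deg E v \<le> 1 \<Longrightarrow> v \<in> D"
    unfolding valid_def by auto
  have Dd: "(x, y) \<notin> E" if "x \<in> D" "y \<in> D" for x y using Ds(1) that unfolding stab_def by blast
  \<comment> \<open>Followed in both directions, an edge that avoids \<open>D\<close> would bound
    all degrees by 2, and a path is too small for \<open>D\<close>.\<close>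
  have noarc: "x \<in> D \<or> y \<in> D" if xy: "(x, y) \<in> E" for x y
  proof (rule ccontr)
    assume c: "\<not> (x \<in> D \<or> y \<in> D)"
    obtain A EA B EB where s: "split V E x y A EA B EB" using tr_split[OF t xy] by blast
    have "deg E v \<le> 2" if "v \<in> V" for v
      using valid_inner_arc_path[OF opt n(1) D _ _ s] valid_inner_arc_path[OF opt n(1) D _ _ split_sym[OF s]]
        that c split_parts(7)[OF s] by blast
    then have le: "2 * card V + card (E \<inter> (V - D) \<times> (V - D)) \<le> 4 * (card V - card D) + 2"
      using deg_le_2_bound[OF t Ds(1)] by blast
    have "(x, y) \<in> E \<inter> (V - D) \<times> (V - D)" using c xy tr_in[OF t] by blast
    then have "card (E \<inter> (V - D) \<times> (V - D)) > 0"
      using tr_finite_arcs[OF t] by (auto simp: card_gt_0_iff)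
    moreover have "card D \<le> card V" using Ds(1) tr_finite[OF t] unfolding stab_def by (auto intro: card_mono)
    ultimately show False using le n Ds(2) by linarith
  qed
  have degD: "deg E v \<le> 2" if v: "v \<in> D" for v
  proof (rule ccontr)
    assume d: "\<not> deg E v \<le> 2"
    then obtain y3 where y3: "y3 \<in> nb E v" by (cases "nb E v = {}") auto
    then have "card (nb E v - {y3}) \<ge> 2" using d by simp
    then obtain y1 y2 where y: "y1 \<in> nb E v - {y3}" "y2 \<in> nb E v - {y3}" "y1 \<noteq> y2" using two_elems by blast
    have movable: "movable V E a x y" if "x \<notin> D \<or> y \<notin> D" for x y
      using Ds that unfolding movable_def by auto
    have y3D: "y3 \<notin> D" using y3 v Dd unfolding nb_def by auto
    have "movable V E a v x \<and> movable V E a l y3 \<and> (movable V E a v l \<or> nb E x \<inter> nb E v = {})"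
      if l: "l \<in> V" "nb E l = {x}" for l x
    proof -
      have "l \<in> D" using Ds(3) l by simp
      then have x: "x \<notin> D" using Dd[of l x] l unfolding nb_def by auto
      \<comment> \<open>Both \<open>v\<close> and \<open>l\<close> are in \<open>D\<close>, so
        joining them might spoil \<open>D\<close>; the other alternative in
        \<open>no_three_branches\<close> applies, since neighbours of \<open>x\<close> lie in
        \<open>D\<close> and those of \<open>v\<close> outside.\<close>
      have "nb E x \<inter> nb E v = {}"
        using x v Dd noarc unfolding nb_def by blast
      then show ?thesis using movable x y3D by blast
    qed
    then show False using no_three_branches[OF opt, of y1 v y2 y3] y y3 by blast
  qed
  have "star_tree V E D" unfolding star_tree_def
    using t Ds Dd noarc degD stab_Int_eq by blast
  then show ?thesis using Ds(2) by blast
qed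

section \<open>Balance of the degrees of centers\<close>

text \<open>\<open>r w\<close> is the share of the stable sets of the branch at \<open>w\<close>
  that avoid \<open>w\<close>. A stable set without \<open>c\<close> is an independent choice in
  each branch, and \<open>c\<close> can be added exactly if every branch avoids its root.\<close>

lemma F1_prod_eq:
  assumes "tr V E" "c \<in> V"
  shows "\<exists>r. real (F1 V E c) = (\<Prod>w\<in>nb E c. r w) * real (F0 V E c) \<and>
    (\<forall>w\<in>nb E c. \<exists>A EA B EB. split V E c w A EA B EB \<and> r w * real (F B EB) = real (F0 B EB w))"
  using assms
proof (induction "card V" arbitrary: V E rule: less_induct)
  case less
  note t = less.prems(1)
  show ?case
  proof (cases "nb E c = {}")
    case True
    then show ?thesis using tr_isolated[OF less.prems True] by simp
  next
    case False
    then obtain w where w: "(c, w) \<in> E" unfolding nb_def by blast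
    obtain A EA B EB where s: "split V E c w A EA B EB" using tr_split[OF t w] by blast
    note sp = split_parts[OF s]
    have nb: "nb E c = insert w (nb EA c)" "w \<notin> nb EA c" using split_nb[OF s] by auto
    obtain r where r: "real (F1 A EA c) = (\<Prod>w\<in>nb EA c. r w) * real (F0 A EA c)"
      "\<forall>u\<in>nb EA c. \<exists>C EC B' EB'. split A EA c u C EC B' EB' \<and> r u * real (F B' EB') = real (F0 B' EB' u)"
      using less.hyps[OF split_card(2)[OF s] sp(2,5)] by blast
    have pos: "F B EB > 0" using F_eq[OF sp(10), of EB w] F0_pos[OF sp(10), of EB w] by simp
    define q where "q = r(w := real (F0 B EB w) / real (F B EB))"
    have qw: "q w * real (F B EB) = real (F0 B EB w)" using pos unfolding q_def by simp
    have "(\<Prod>u\<in>nb EA c. q u) = (\<Prod>u\<in>nb EA c. r u)" using nb(2) unfolding q_def by (intro prod.cong) auto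
    then have "(\<Prod>u\<in>nb E c. q u) = q w * (\<Prod>u\<in>nb EA c. r u)"
      unfolding nb(1) using nb(2) tr_finite_nb[OF sp(2)] by simp
    then have "real (F1 V E c) = (\<Prod>u\<in>nb E c. q u) * real (F0 V E c)"
      using F1_join[OF s] r(1) qw[symmetric] by simp
    moreover have "\<exists>A EA B EB. split V E c u A EA B EB \<and> q u * real (F B EB) = real (F0 B EB u)" if u: "u \<in> nb E c" for u
    proof (cases "u = w")
      case True
      then show ?thesis using s qw by blast
    next
      case False
      then obtain C EC B' EB' where C: "split A EA c u C EC B' EB'" "r u * real (F B' EB') = real (F0 B' EB' u)"
        using r(2) u nb(1) by blast
      have "q u = r u" using False unfolding q_def by simp
      then show ?thesis using split_lift[OF s C(1) split_parts(5)[OF C(1)]] C(2) by metis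
    qed
    ultimately show ?thesis by blast
  qed
qed

lemma F1_prod:
  fixes b :: "'a \<Rightarrow> real"
  assumes t: "tr V E" and c: "c \<in> V" and b: "\<And>w. b w \<ge> 0"
  shows "(\<And>w A EA B EB. split V E c w A EA B EB \<Longrightarrow> real (F0 B EB w) \<le> b w * real (F B EB)) \<Longrightarrow>
      real (F1 V E c) \<le> (\<Prod>w\<in>nb E c. b w) * real (F0 V E c)"
    and "(\<And>w A EA B EB. split V E c w A EA B EB \<Longrightarrow> b w * real (F B EB) \<le> real (F0 B EB w)) \<Longrightarrow>
      (\<Prod>w\<in>nb E c. b w) * real (F0 V E c) \<le> real (F1 V E c)"
proof -
  obtain r where r: "real (F1 V E c) = (\<Prod>w\<in>nb E c. r w) * real (F0 V E c)"
    and ex: "\<And>w. w \<in> nb E c \<Longrightarrow> \<exists>A EA B EB. split V E c w A EA B EB \<and> r w * real (F B EB) = real (F0 B EB w)"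
    using F1_prod_eq[OF t c] by blast
  have branch: "\<exists>A EA B EB. split V E c w A EA B EB \<and> r w * real (F B EB) = real (F0 B EB w) \<and>
      real (F B EB) > 0 \<and> r w \<ge> 0" if w: "w \<in> nb E c" for w
  proof -
    obtain A EA B EB where s: "split V E c w A EA B EB" "r w * real (F B EB) = real (F0 B EB w)" using ex[OF w] by blast
    have "F B EB > 0"
      using F_eq[OF split_parts(10)[OF s(1)], of EB w] F0_pos[OF split_parts(10)[OF s(1)], of EB w] by simp
    then have pos: "real (F B EB) > 0" by simp
    then have "r w = real (F0 B EB w) / real (F B EB)" using s(2) by (simp add: eq_divide_eq)
    then have "r w \<ge> 0" by simp
    then show ?thesis using s pos by blast
  qed
  have r0: "r w \<ge> 0" if "w \<in> nb E c" for w using branch[OF that] by blast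
  {
    assume h: "\<And>w A EA B EB. split V E c w A EA B EB \<Longrightarrow> real (F0 B EB w) \<le> b w * real (F B EB)"
    have "r w \<le> b w" if "w \<in> nb E c" for w using branch[OF that] h by (metis mult_le_cancel_right_pos)
    then have "(\<Prod>w\<in>nb E c. r w) \<le> (\<Prod>w\<in>nb E c. b w)" using r0 by (intro prod_mono) auto
    then show "real (F1 V E c) \<le> (\<Prod>w\<in>nb E c. b w) * real (F0 V E c)" unfolding r by (intro mult_right_mono) auto
  }
  {
    assume h: "\<And>w A EA B EB. split V E c w A EA B EB \<Longrightarrow> b w * real (F B EB) \<le> real (F0 B EB w)"
    have "b w \<le> r w" if "w \<in> nb E c" for w using branch[OF that] h by (metis mult_le_cancel_right_pos)
    then have "(\<Prod>w\<in>nb E c. b w) \<le> (\<Prod>w\<in>nb E c. r w)" using b by (intro prod_mono) auto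
    then show "(\<Prod>w\<in>nb E c. b w) * real (F0 V E c) \<le> real (F1 V E c)" unfolding r by (intro mult_right_mono) auto
  }
qed

section \<open>Bounds for the odds of a center in terms of its branches\<close>

lemma half_F_le_F0: "finite V \<Longrightarrow> 1 / 2 * real (F V E) \<le> real (F0 V E x)"
  using F1_le_F0[of V E x] F_eq[of V E x] by simp

text \<open>A neighbour is absent from at least half of the stable sets of its branch, so each
  branch at most halves the odds of \<open>c\<close>.\<close>

lemma F0_le_power_F1:
  assumes "tr V E" "c \<in> V"
  shows "real (F0 V E c) \<le> 2 ^ deg E c * real (F1 V E c)"
proof -
  have "(\<Prod>w\<in>nb E c. 1 / 2) * real (F0 V E c) \<le> real (F1 V E c)"
    by (rule F1_prod(2)[OF assms]) (auto intro: half_F_le_F0[simplified] dest: split_parts(10))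
  then show ?thesis by (simp add: power_one_over field_simps)
qed

text \<open>A branch that starts with a vertex \<open>w\<close> of degree 2 is \<open>w\<close>
  followed by a branch \<open>K\<close> at the next center \<open>c'\<close>: without
  \<open>w\<close> the stable sets of \<open>K\<close> are free, with \<open>w\<close> they have to
  avoid \<open>c'\<close>. All recursive bounds on branches pass through these two
  identities.\<close>

lemma branch_shape:
  assumes s: "split V E c w A EA B EB" and nb: "nb E w = {c, c'}" "c \<noteq> c'"
  obtains X XE K EK where "split V E w c' X XE K EK" "A \<subseteq> X" "K \<subseteq> B" "card K < card B"
    "F0 B EB w = F K EK" "F B EB = F K EK + F0 K EK c'" "finite K"
proof -
  note sp = split_parts[OF s]
  have nbB: "nb EB w = {c'}" using split_nb(4,5)[OF s] nb by auto
  then have "(w, c') \<in> EB" unfolding nb_def by auto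
  then obtain W EW K EK where s2: "split B EB w c' W EW K EK" using tr_split[OF sp(3)] by blast
  note sp2 = split_parts[OF s2]
  have "nb EW w = {}" using split_nb(1,2)[OF s2] nbB by auto
  note W = tr_isolated(1)[OF sp2(2,5) this] and EW = tr_isolated(2)[OF sp2(2,5) this]
  have sV: "split V E w c' (W \<union> A) (EW \<union> EA \<union> {(w, c), (c, w)}) K EK"
    using split_lift[OF split_sym[OF s] s2 sp2(5)] .
  have 1: "F0 B EB w = F K EK" using F1_join(2)[OF s2] unfolding W EW by simp
  have 2: "F1 B EB w = F0 K EK c'" using F1_join(1)[OF s2] unfolding W EW by simp
  have 3: "F B EB = F0 B EB w + F1 B EB w" by (rule F_eq[OF sp(10)])
  show ?thesis using that[OF sV] sp2(7,10) split_card(3)[OF s2] 1 2 3 by auto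
qed

text \<open>A part of a tree of stars left after cutting edges; only \<open>r\<close> may have lost an arc below the degree
  bound \<open>d\<close> for centers.\<close>

definition star_branch :: "'a set \<Rightarrow> ('a \<times> 'a) set \<Rightarrow> 'a set \<Rightarrow> 'a \<Rightarrow> nat \<Rightarrow> bool" where
  "star_branch V E D r d \<longleftrightarrow> tr V E \<and> (\<forall>u v. (u, v) \<in> E \<longrightarrow> (u \<in> D \<longleftrightarrow> v \<notin> D)) \<and>
     (\<forall>v\<in>V. v \<in> D \<longrightarrow> deg E v \<le> 2) \<and> (\<forall>v\<in>V. v \<notin> D \<and> v \<noteq> r \<longrightarrow> d \<le> deg E v)"

lemma branch_cases:
  assumes t: "tr V E" and s: "split V E c w A EA B EB" and d: "deg E w \<le> 2"
  obtains "deg E w = 1" "B = {w}" "EB = {}"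
  | c' where "deg E w = 2" "nb E w = {c, c'}" "c \<noteq> c'"
proof -
  note sp = split_parts[OF s]
  have cn: "c \<in> nb E w" using sp(8) unfolding nb_def by auto
  have fin: "finite (nb E w)" using tr_finite_nb[OF t] .
  have "deg E w > 0" using cn fin by (auto simp: card_gt_0_iff)
  then consider "deg E w = 1" | "deg E w = 2" using d by linarith
  then show ?thesis
  proof cases
    case 1
    then have "nb EB w = {}" using split_deg(3)[OF s] tr_finite_nb[OF sp(3)] by auto
    then show ?thesis using that(1) 1 tr_isolated[OF sp(3,6)] by blast
  next
    case 2
    then obtain x y where "nb E w = {x, y}" "x \<noteq> y" by (auto simp: card_2_iff)
    then show ?thesis using that(2) cn 2 by (metis doubleton_eq_iff empty_iff insert_iff)
  qed
qed

text \<open>If the next center \<open>c'\<close> has odds \<open>o\<close> in its branch, then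
  \<open>w\<close> is absent from the share \<open>(1 + o) / (2 + o)\<close>, which is at most
  \<open>b\<close> iff \<open>(1 - b) * o \<le> 2 * b - 1\<close>. By induction
  \<open>o \<le> b ^ (d - 1)\<close>, because \<open>c'\<close> has at least \<open>d - 1\<close>
  further branches, and the hypothesis on \<open>b\<close> closes the circle. Keeping
  \<open>r\<close> in the part cut off ensures \<open>c' \<noteq> r\<close>.\<close>

lemma branch_upper:
  fixes b :: real
  assumes star_branch: "star_branch V E D r d" and b: "1 / 2 \<le> b" "b \<le> 1" "(1 - b) * b ^ (d - 1) \<le> 2 * b - 1"
  shows "split V E c w A EA B EB \<Longrightarrow> c \<notin> D \<Longrightarrow> r \<in> A \<Longrightarrow> real (F0 B EB w) \<le> b * real (F B EB)"
    and "split V E w' c' X XE K EK \<Longrightarrow> c' \<notin> D \<Longrightarrow> r \<in> X \<Longrightarrow> real (F1 K EK c') \<le> b ^ (deg E c' - 1) * real (F0 K EK c')"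
proof -
  have t: "tr V E" and bip: "\<And>u v. (u, v) \<in> E \<Longrightarrow> (u \<in> D \<longleftrightarrow> v \<notin> D)"
    and dD: "\<And>v. v \<in> V \<Longrightarrow> v \<in> D \<Longrightarrow> deg E v \<le> 2" and dC: "\<And>v. v \<in> V \<Longrightarrow> v \<notin> D \<Longrightarrow> v \<noteq> r \<Longrightarrow> d \<le> deg E v"
    using star_branch unfolding star_branch_def by auto
  \<comment> \<open>The second claim for one branch from the first claim for all smaller ones. It
    serves inside the induction and again at the end.\<close>
  have K: "real (F1 K EK c') \<le> b ^ (deg E c' - 1) * real (F0 K EK c')"
    if s: "split V E w' c' X XE K EK" "c' \<notin> D" "r \<in> X"
      and IH: "\<And>c w A EA B EB. card B < card K \<Longrightarrow> split V E c w A EA B EB \<Longrightarrow> c \<notin> D \<Longrightarrow> r \<in> A \<Longrightarrow> real (F0 B EB w) \<le> b * real (F B EB)"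
    for w' c' X XE K EK
  proof -
    note sp = split_parts[OF s(1)]
    have "real (F1 K EK c') \<le> (\<Prod>w\<in>nb EK c'. b) * real (F0 K EK c')"
    proof (rule F1_prod(1)[OF sp(3,6)])
      show "b \<ge> 0" using b by simp
      fix u C EC B' EB' assume s': "split K EK c' u C EC B' EB'"
      have "split V E c' u (C \<union> X) (EC \<union> XE \<union> {(c', w'), (w', c')}) B' EB'"
        using split_lift[OF split_sym[OF s(1)] s' split_parts(5)[OF s']] .
      then show "real (F0 B' EB' u) \<le> b * real (F B' EB')"
        using IH[OF split_card(3)[OF s']] s by blast
    qed
    then show ?thesis using split_deg(3)[OF s(1)] by simp
  qed
  have B: "real (F0 B EB w) \<le> b * real (F B EB)"
    if "split V E c w A EA B EB" "c \<notin> D" "r \<in> A" for c w A EA B EB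
    using that
  proof (induction "card B" arbitrary: c w A EA B EB rule: less_induct)
    case less
    note s = less.prems(1)
    note sp = split_parts[OF s]
    have cw: "(c, w) \<in> E" "(w, c) \<in> E" using sp(8) by auto
    have w: "w \<in> D" "w \<in> V" using bip[OF cw(1)] less.prems(2) tr_in[OF t cw(1)] by auto
    show ?case
    proof (rule branch_cases[OF t s dD[OF w(2,1)]])
      assume "B = {w}" "EB = {}"
      then show ?thesis using b by simp
    next
      fix c' assume nb: "nb E w = {c, c'}" "c \<noteq> c'"
      have wc': "(w, c') \<in> E" using nb unfolding nb_def by auto
      then have c': "c' \<notin> D" "c' \<in> V" using bip[OF wc'] w tr_in[OF t wc'] by auto
      obtain X XE K EK where K': "split V E w c' X XE K EK" "A \<subseteq> X" "K \<subseteq> B" "card K < card B"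
        "F0 B EB w = F K EK" "F B EB = F K EK + F0 K EK c'" "finite K"
        using branch_shape[OF s nb] by blast
      have rX: "r \<in> X" using less.prems(3) K' by auto
      have "real (F1 K EK c') \<le> b ^ (deg E c' - 1) * real (F0 K EK c')"
        using less.hyps K'(4) by (intro K[OF K'(1) c'(1) rX]) auto
      also have "c' \<noteq> r" using rX split_parts(4,6)[OF K'(1)] by auto
      then have "b ^ (deg E c' - 1) \<le> b ^ (d - 1)" using dC[OF c'(2,1)] b by (intro power_decreasing) auto
      then have "b ^ (deg E c' - 1) * real (F0 K EK c') \<le> b ^ (d - 1) * real (F0 K EK c')" by (intro mult_right_mono) auto
      finally have 1: "real (F1 K EK c') \<le> b ^ (d - 1) * real (F0 K EK c')" .
      have "(1 - b) * real (F1 K EK c') \<le> (1 - b) * (b ^ (d - 1) * real (F0 K EK c'))"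
        using 1 b by (intro mult_left_mono) auto
      also have "\<dots> = ((1 - b) * b ^ (d - 1)) * real (F0 K EK c')" by simp
      also have "\<dots> \<le> (2 * b - 1) * real (F0 K EK c')" using b by (intro mult_right_mono) auto
      finally have "(1 - b) * real (F1 K EK c') \<le> (2 * b - 1) * real (F0 K EK c')" .
      then show ?thesis using K'(5,6) F_eq[OF K'(7), of EK c'] by (simp add: algebra_simps)
    qed
  qed
  show "split V E c w A EA B EB \<Longrightarrow> c \<notin> D \<Longrightarrow> r \<in> A \<Longrightarrow> real (F0 B EB w) \<le> b * real (F B EB)"
    using B by blast
  show "split V E w' c' X XE K EK \<Longrightarrow> c' \<notin> D \<Longrightarrow> r \<in> X \<Longrightarrow> real (F1 K EK c') \<le> b ^ (deg E c' - 1) * real (F0 K EK c')"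
    using K B by blast
qed

lemma root_upper:
  fixes b :: real
  assumes star_branch: "star_branch V E D r d" and r: "r \<in> V" "r \<notin> D"
    and b: "1 / 2 \<le> b" "b \<le> 1" "(1 - b) * b ^ (d - 1) \<le> 2 * b - 1"
  shows "real (F1 V E r) \<le> b ^ deg E r * real (F0 V E r)"
proof -
  have t: "tr V E" using star_branch unfolding star_branch_def by auto
  have "real (F1 V E r) \<le> (\<Prod>w\<in>nb E r. b) * real (F0 V E r)"
  proof (rule F1_prod(1)[OF t r(1)])
    show "0 \<le> b" using b by simp
    show "real (F0 B EB w) \<le> b * real (F B EB)" if "split V E r w A EA B EB" for w A EA B EB
      using branch_upper(1)[OF star_branch b that r(2) split_parts(5)[OF that]] .
  qed
  then show ?thesis by simp
qed

text \<open>Upper bound for the share of the stable sets of a branch that avoid its root, if all centers in it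
  have degree at least \<open>d\<close>. It must be inherited from smaller branches, which is
  \<open>(1 - b) b\<^bsup>d-1\<^esup> \<le> 2 b - 1\<close>, and still satisfy \<open>b\<^bsup>d+1\<^esup> < 1/2\<^bsup>d\<^esup>\<close> to exclude degree \<open>d + 2\<close>.\<close>

definition rate :: "nat \<Rightarrow> real" where
  "rate d = (2 * real d + 1) / (4 * real d)"

lemma rate_eq: "d > 0 \<Longrightarrow> rate d = (1 + 1 / (2 * real d)) / 2"
  unfolding rate_def by (simp add: field_simps)

lemma rate_bounds:
  assumes "d \<ge> 2"
  shows "1 / 2 < rate d" "rate d < 1" "(1 - rate d) * rate d ^ (d - 1) \<le> 2 * rate d - 1"
    "rate d ^ (d + 1) < (1 / 2) ^ d"
proof -
  show "1 / 2 < rate d" "rate d < 1" using assms unfolding rate_def by (auto simp: field_simps)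
  have d: "real d \<ge> 2" using assms by simp
  \<comment> \<open>The third claim multiplied by \<open>4 * real d\<close>.\<close>
  have key: "rate d ^ (d - 1) * (2 * real d - 1) \<le> 2"
  proof -
    consider "d = 2" | "d = 3" | "d \<ge> 4" using assms by linarith
    then show ?thesis
    proof cases
      case 3
      \<comment> \<open>9/16 is \<open>rate 4\<close>, and \<open>rate\<close> is
        decreasing.\<close>
      have le: "rate d \<le> 9 / 16" "rate d \<ge> 0" using 3 unfolding rate_def by (auto simp: field_simps)
      have ind: "(9 / 16) ^ k * (2 * real k + 1) \<le> 2" if "k \<ge> 3" for k
        using that
      proof (induction k rule: dec_induct)
        case base
        show ?case by (simp add: power3_eq_cube)
      next
        case (step k)
        have "(9 / 16) ^ Suc k * (2 * real (Suc k) + 1) = (9 / 16) ^ k * (9 / 16 * (2 * real k + 3))" by (simp add: algebra_simps)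
        also have "\<dots> \<le> (9 / 16) ^ k * (2 * real k + 1)"
          using step(1) by (intro mult_left_mono) auto
        finally show ?case using step.IH by linarith
      qed
      have "rate d ^ (d - 1) * (2 * real d - 1) \<le> (9 / 16) ^ (d - 1) * (2 * real d - 1)"
        using le d by (intro mult_right_mono power_mono) auto
      also have "\<dots> = (9 / 16) ^ (d - 1) * (2 * real (d - 1) + 1)" using 3 by (simp add: of_nat_diff)
      also have "\<dots> \<le> 2" using 3 by (intro ind) auto
      finally show ?thesis .
    qed (auto simp: rate_def power2_eq_square numeral_eq_Suc)
  qed
  have e: "1 - rate d = (2 * real d - 1) / (4 * real d)" "2 * rate d - 1 = 2 / (4 * real d)"
    using d unfolding rate_def by (auto simp: field_simps)
  have "(1 - rate d) * rate d ^ (d - 1) = rate d ^ (d - 1) * (2 * real d - 1) / (4 * real d)"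
    unfolding e(1) by simp
  also have "\<dots> \<le> 2 / (4 * real d)" using key d by (intro divide_right_mono) auto
  finally show "(1 - rate d) * rate d ^ (d - 1) \<le> 2 * rate d - 1" unfolding e(2) .
  \<comment> \<open>The fourth claim multiplied by \<open>2 ^ (d + 1)\<close>. For
    \<open>d \<ge> 4\<close> the power is at most \<open>exp ((d + 1) / (2 * d))\<close>, whose
    exponent is at most 5/8.\<close>
  have lt2: "(1 + 1 / (2 * real d)) ^ (d + 1) < 2"
  proof -
    consider "d = 2" | "d = 3" | "d \<ge> 4" using assms by linarith
    then show ?thesis
    proof cases
      case 3
      have "(1 + 1 / (2 * real d)) ^ (d + 1) \<le> exp (1 / (2 * real d)) ^ (d + 1)"
        by (intro power_mono exp_ge_add_one_self) auto
      also have "\<dots> = exp (real (d + 1) * (1 / (2 * real d)))" by (rule exp_of_nat_mult[symmetric])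
      also have "\<dots> \<le> exp (5 / 8)" using 3 by (simp add: field_simps)
      also have "\<dots> < 2"
      \<comment> \<open>Eighth powers are compared: \<open>exp 5 \<le> 3 ^ 5\<close>, which is 243,
        while \<open>2 ^ 8\<close> is 256.\<close>
      proof (rule power_less_imp_less_base)
        have "exp (5 / 8) ^ 8 = exp (5 * 1 :: real)" by (simp add: exp_of_nat_mult[symmetric])
        also have "\<dots> = exp 1 ^ 5" using exp_of_nat_mult[of 5 "1 :: real"] by simp
        also have "\<dots> \<le> 3 ^ 5" using exp_le by (intro power_mono) auto
        finally show "exp (5 / 8) ^ 8 < (2 :: real) ^ 8" by simp
      qed simp
      finally show ?thesis by simp
    qed (simp_all add: numeral_eq_Suc)
  qed
  have "rate d ^ (d + 1) = (1 + 1 / (2 * real d)) ^ (d + 1) / 2 ^ (d + 1)"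
    using assms by (simp only: rate_eq power_divide)
  also have "\<dots> < 2 / 2 ^ (d + 1)" using lt2 by (intro divide_strict_right_mono) auto
  also have "\<dots> = (1 / 2) ^ d" by (simp add: power_one_over)
  finally show "rate d ^ (d + 1) < (1 / 2) ^ d" .
qed

text \<open>Both vertices have the same total \<open>F0 + F1\<close>, so the one with larger odds
  lies in more stable sets.\<close>

lemma odds_less:
  fixes p q :: real
  assumes "finite V" "real (F1 V E z) \<le> p * real (F0 V E z)" "q * real (F0 V E x) \<le> real (F1 V E x)" "p < q" "0 \<le> p"
  shows "F1 V E z < F1 V E x"
proof (rule ccontr)
  assume "\<not> ?thesis"
  then have le: "F1 V E x \<le> F1 V E z" by simp
  moreover have "F0 V E x + F1 V E x = F0 V E z + F1 V E z" using F_eq[OF assms(1), of E x] F_eq[OF assms(1), of E z] by simp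
  ultimately have "F0 V E z \<le> F0 V E x" by linarith
  then have "p * real (F0 V E z) \<le> p * real (F0 V E x)" using assms by (intro mult_left_mono) auto
  also have "\<dots> < q * real (F0 V E x)" using assms(4) F0_pos[OF assms(1)] by (intro mult_strict_right_mono) auto
  finally show False using assms(2,3) le by linarith
qed

lemma opt_move_left:
  assumes "optimal V E a" and s: "split V E x y A EA B EB" and "x' \<in> A" and "movable V E a x' y"
  shows "F1 A EA x' \<le> F1 A EA x"
  using opt_move_right[OF assms(1) split_sym[OF s] assms(3)] assms(4) movable_sym[of V E a x' y] by blast

text \<open>\<open>z\<close> lies in at most one of the two branches at \<open>c\<close>; the other
  one is cut off.\<close>

lemma ex_split_away:
  assumes t: "tr V E" and e: "(c, w1) \<in> E" "(c, w2) \<in> E" "w1 \<noteq> w2" and z: "z \<in> V"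
  obtains w A EA B EB where "w \<in> {w1, w2}" "split V E c w A EA B EB" "z \<in> A"
proof -
  obtain A EA B EB where s: "split V E c w1 A EA B EB" using tr_split[OF t e(1)] by blast
  show ?thesis
  proof (cases "z \<in> A")
    case True
    then show ?thesis using that s by blast
  next
    case False
    then have zB: "z \<in> B" using z split_parts(7)[OF s] by auto
    have "w2 \<in> nb EA c" using split_nb(1)[OF s] e unfolding nb_def by auto
    then obtain A' EA' B' EB' where s': "split A EA c w2 A' EA' B' EB'"
      using tr_split[OF split_parts(2)[OF s]] unfolding nb_def by blast
    show ?thesis using that[OF _ split_lift[OF s s' split_parts(5)[OF s']]] zB by blast
  qed
qed

text \<open>Here the cut is made one edge further out, so that \<open>w\<close> remains attached to
  \<open>x\<close>, as a leaf if its degree was 2.\<close>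

lemma ex_split_away2:
  assumes t: "tr V E" and e: "(x, w1) \<in> E" "(w1, y1) \<in> E" "(x, w2) \<in> E" "(w2, y2) \<in> E" "w1 \<noteq> w2" "y1 \<noteq> x" "y2 \<noteq> x"
    and z: "z \<in> V"
  obtains w y A EA B EB where "(w, y) \<in> {(w1, y1), (w2, y2)}" "split V E w y A EA B EB" "z \<in> A" "x \<in> A"
proof -
  obtain w A EA B EB where w: "w \<in> {w1, w2}" and s: "split V E x w A EA B EB" "z \<in> A"
    using ex_split_away[OF t e(1,3,5) z] by blast
  obtain y where y: "(w, y) \<in> {(w1, y1), (w2, y2)}" "(w, y) \<in> E" "y \<noteq> x" using w e by blast
  have "y \<in> nb EB w" using split_nb(4)[OF s(1)] y unfolding nb_def by auto
  then obtain B1 EB1 B2 EB2 where s': "split B EB w y B1 EB1 B2 EB2"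
    using tr_split[OF split_parts(3)[OF s(1)]] unfolding nb_def by blast
  show ?thesis using that[OF y(1) split_lift[OF split_sym[OF s(1)] s' split_parts(5)[OF s']]]
      s(2) split_parts(5)[OF s(1)] by blast
qed

text \<open>Used to compare two leaves of one tree: the one in fewer stable sets has the neighbour
  in more of them.\<close>

lemma leaf_eq:
  assumes t: "tr V E" and l: "nb E l = {x}"
  shows "2 * F1 V E l + F1 V E x = F V E"
proof -
  have lx: "(x, l) \<in> E" "(l, x) \<in> E" using l tr_sym[OF t, of l x] unfolding nb_def by auto
  obtain A EA B EB where s: "split V E x l A EA B EB" using tr_split[OF t lx(1)] by blast
  have "nb EB l = {}" using split_nb(4,5)[OF s] l by auto
  then have "B = {l}" "EB = {}" using tr_isolated[OF split_parts(3,6)[OF s]] by auto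
  then show ?thesis using leaf_cnt(1-3)[of V E x l A EA] s by simp
qed

lemma staticD:
  assumes "star_tree V E D"
  shows "tr V E" "D \<subseteq> V" "\<And>u v. (u, v) \<in> E \<Longrightarrow> (u \<in> D \<longleftrightarrow> v \<notin> D)"
    "\<And>v. v \<in> V \<Longrightarrow> v \<notin> D \<Longrightarrow> 2 \<le> deg E v" "\<And>v. v \<in> D \<Longrightarrow> deg E v \<le> 2" "D \<in> stab V E"
proof -
  show "tr V E" "D \<subseteq> V" "\<And>u v. (u, v) \<in> E \<Longrightarrow> (u \<in> D \<longleftrightarrow> v \<notin> D)" "\<And>v. v \<in> D \<Longrightarrow> deg E v \<le> 2"
    using assms unfolding star_tree_def by auto
  show "2 \<le> deg E v" if "v \<in> V" "v \<notin> D" for v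
    using assms that unfolding star_tree_def by (metis Suc_1 not_less_eq_eq)
  show "D \<in> stab V E" using assms unfolding star_tree_def stab_def by blast
qed

text \<open>Only the degree of \<open>x\<close> drops. If \<open>x\<close> lies in \<open>D\<close>,
  no center loses an arc, so any \<open>r\<close> is admissible.\<close>

lemma split_star_branch:
  assumes st: "star_tree V E D" and s: "split V E x y A EA B EB" and d: "\<And>v. v \<in> A \<Longrightarrow> v \<notin> D \<Longrightarrow> v \<noteq> r \<Longrightarrow> d \<le> deg E v"
    and r: "r = x \<or> x \<in> D"
  shows "star_branch A EA D r d"
proof -
  note sp = split_parts[OF s]
  have "\<And>u v. (u, v) \<in> EA \<Longrightarrow> (u \<in> D \<longleftrightarrow> v \<notin> D)" using staticD(3)[OF st] unfolding sp(8) by blast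
  moreover have "deg EA v \<le> deg E v" for v using sp(8) tr_finite_nb[OF sp(1)] by (intro card_mono) (auto simp: nb_def)
  then have "deg EA v \<le> 2" if "v \<in> D" for v using staticD(5)[OF st that] order_trans by blast
  moreover have "d \<le> deg EA v" if "v \<in> A" "v \<notin> D" "v \<noteq> r" for v
  proof -
    have "v \<noteq> x" using that r by auto
    then show ?thesis using d[OF that] split_deg(2)[OF s that(1)] by simp
  qed
  ultimately show ?thesis using sp(2) unfolding star_branch_def by blast
qed

lemma star_tree_movable:
  assumes "star_tree V E D" "card D = a" "x \<notin> D \<or> y \<notin> D"
  shows "movable V E a x y"
  using assms staticD(6) unfolding movable_def by blast

text \<open>If the degree of \<open>c\<close> exceeded the minimum d by 2 or more, some branch of
  \<open>c\<close> would better be attached to \<open>c'\<close>. Without that branch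
  \<open>c\<close> still has at least d + 1 others, so its odds are at most
  \<open>rate d ^ (d + 1)\<close>, which is below \<open>(1 / 2) ^ d\<close>, a lower bound for the
  odds of \<open>c'\<close>.\<close>

lemma star_tree_balanced:
  assumes opt: "optimal V E a" and st: "star_tree V E D" "card D = a"
    and c: "c \<in> V" "c \<notin> D" and c': "c' \<in> V" "c' \<notin> D"
    and min: "\<And>v. v \<in> V \<Longrightarrow> v \<notin> D \<Longrightarrow> deg E c' \<le> deg E v"
  shows "deg E c \<le> deg E c' + 1"
proof (rule ccontr)
  let ?d = "deg E c'"
  assume neg: "\<not> deg E c \<le> ?d + 1"
  have t: "tr V E" using staticD(1)[OF st(1)] .
  have d2: "?d \<ge> 2" using staticD(4)[OF st(1) c'] .
  have "card (nb E c) \<ge> 2" using neg by simp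
  then obtain w1 w2 where w: "(c, w1) \<in> E" "(c, w2) \<in> E" "w1 \<noteq> w2" using two_elems unfolding nb_def by blast
  obtain w A EA B EB where "w \<in> {w1, w2}" and s: "split V E c w A EA B EB" "c' \<in> A"
    by (rule ex_split_away[OF t w c'(1)])
  note sp = split_parts[OF s(1)]
  have ne: "c' \<noteq> c" using neg by auto
  have "F1 A EA c' \<le> F1 A EA c" using opt_move_left[OF opt s star_tree_movable[OF st]] c'(2) by blast
  moreover have "F1 A EA c < F1 A EA c'"
  proof (rule odds_less[OF sp(9)])
    have star_branch: "star_branch A EA D c ?d" using split_star_branch[OF st(1) s(1), of c ?d] min sp(7) by blast
    have "deg EA c \<ge> ?d + 1" using neg split_deg(1)[OF s(1)] by simp
    then have le: "rate ?d ^ deg EA c \<le> rate ?d ^ (?d + 1)" using rate_bounds(1,2)[OF d2] by (intro power_decreasing) auto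
    show "real (F1 A EA c) \<le> rate ?d ^ deg EA c * real (F0 A EA c)"
      using root_upper[OF star_branch sp(5) c(2)] rate_bounds[OF d2] by simp
    show "rate ?d ^ deg EA c < (1 / 2) ^ ?d" using le rate_bounds(4)[OF d2] by linarith
    show "0 \<le> rate ?d ^ deg EA c" using rate_bounds(1)[OF d2] by simp
    have "deg EA c' = ?d" using split_deg(2)[OF s ne] by simp
    then have "real (F0 A EA c') \<le> 2 ^ ?d * real (F1 A EA c')" using F0_le_power_F1[OF sp(2) s(2)] by simp
    then show "(1 / 2) ^ ?d * real (F0 A EA c') \<le> real (F1 A EA c')" by (simp add: power_one_over field_simps)
  qed
  ultimately show False by simp
qed

section \<open>Shape of the center-tree\<close>

text \<open>For a center \<open>c\<close> of a tree of stars, these are the neighbours that lead on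
  to another center; their number is the degree of \<open>c\<close> in the center-tree.\<close>

definition inner_nb :: "('a \<times> 'a) set \<Rightarrow> 'a \<Rightarrow> 'a set" where
  "inner_nb E c = {w \<in> nb E c. deg E w = 2}"

lemma star_tree_sums:
  assumes st: "star_tree V E D"
  shows "(\<Sum>v\<in>V - D. deg E v) + 1 = card V" "(\<Sum>v\<in>D. deg E v) + 1 = card V"
    "card V = card D + card (V - D)"
proof -
  note s = staticD[OF st]
  have "E \<inter> (V - D) \<times> (V - D) = {}" using s(3) by blast
  then show "(\<Sum>v\<in>V - D. deg E v) + 1 = card V" "(\<Sum>v\<in>D. deg E v) + 1 = card V"
    using sum_deg_stable[OF s(1,6)] by simp_all
  have "finite D" using finite_subset[OF s(2) tr_finite[OF s(1)]] .
  then show "card V = card D + card (V - D)"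
    using s(2) tr_finite[OF s(1)] by (simp add: card_Diff_subset card_mono)
qed

text \<open>The handshake identity of the center-tree. Its edges correspond to the vertices of
  degree 2 in \<open>D\<close>, and the sum of the degrees in \<open>D\<close> shows that there is
  one fewer of these than centers.\<close>

lemma sum_inner_nb:
  assumes st: "star_tree V E D" and n: "card V \<ge> 2"
  shows "(\<Sum>c\<in>V - D. card (inner_nb E c)) + 2 = 2 * card (V - D)"
proof -
  note s = staticD[OF st]
  have fin: "finite V" "finite D" using tr_finite[OF s(1)] finite_subset[OF s(2)] by auto
  let ?D2 = "{w \<in> D. deg E w = 2}"
  have d: "deg E w = 1 + of_bool (deg E w = 2)" if "w \<in> D" for w
    using s(5)[OF that] tr_deg_pos[OF s(1) _ n, of w] that s(2) by auto
  have "(\<Sum>w\<in>D. deg E w) = (\<Sum>w\<in>D. 1 + of_bool (deg E w = 2))" using d by (intro sum.cong) auto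
  also have "\<dots> = (\<Sum>w\<in>D. 1) + (\<Sum>w\<in>D. of_bool (deg E w = 2))" by (rule sum.distrib)
  also have "\<dots> = card D + card ?D2" using fin by (simp add: sum_of_bool_eq Collect_conj_eq)
  finally have 1: "card ?D2 + 1 = card (V - D)" using star_tree_sums[OF st] by simp
  have "(\<Sum>c\<in>V - D. card {w \<in> ?D2. (c, w) \<in> E}) = 2 * card ?D2"
  proof (rule sum_multicount)
    show "\<forall>w\<in>?D2. card {c \<in> V - D. (c, w) \<in> E} = 2"
    proof
      fix w assume w: "w \<in> ?D2"
      have "{c \<in> V - D. (c, w) \<in> E} = nb E w"
        using s(3) tr_sym[OF s(1)] tr_in[OF s(1)] w unfolding nb_def by blast
      then show "card {c \<in> V - D. (c, w) \<in> E} = 2" using w by simp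
    qed
  qed (use fin in auto)
  moreover have "{w \<in> ?D2. (c, w) \<in> E} = inner_nb E c" if "c \<in> V - D" for c
    using that s(3) unfolding inner_nb_def nb_def by blast
  ultimately have "(\<Sum>c\<in>V - D. card (inner_nb E c)) = 2 * card ?D2" by simp
  then show ?thesis using 1 by simp
qed

lemma inner_nb_nonempty:
  assumes st: "star_tree V E D" and c: "c \<in> V" "c \<notin> D" and C: "V - D \<noteq> {c}"
  shows "inner_nb E c \<noteq> {}"
proof
  assume i: "inner_nb E c = {}"
  note s = staticD[OF st]
  have nD: "nb E c \<subseteq> D" using s(3) c unfolding nb_def by blast
  have "deg E a \<le> 1" if a: "a \<in> nb E c" for a
  proof -
    have "deg E a \<le> 2" "deg E a \<noteq> 2" using s(5)[of a] i a nD unfolding inner_nb_def by auto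
    then show ?thesis by simp
  qed
  then have "V = insert c (nb E c)" by (rule tr_star[OF s(1) c(1)])
  then show False using C c nD by blast
qed

lemma inner_nb_other:
  assumes st: "star_tree V E D" and w: "w \<in> inner_nb E x" "x \<notin> D"
  obtains y where "nb E w = {x, y}" "y \<noteq> x" "y \<in> V" "y \<notin> D" "(x, w) \<in> E" "(w, x) \<in> E" "(w, y) \<in> E" "w \<in> D" "w \<in> V"
proof -
  note s = staticD[OF st]
  have xw: "(x, w) \<in> E" "(w, x) \<in> E" and d: "deg E w = 2" using w tr_sym[OF s(1), of x w] unfolding inner_nb_def nb_def by auto
  obtain p q where pq: "nb E w = {p, q}" "p \<noteq> q" using d by (auto simp: card_2_iff)
  have "x \<in> nb E w" using xw unfolding nb_def by auto
  then have "nb E w = {x, if x = p then q else p}" "(if x = p then q else p) \<noteq> x" using pq by auto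
  then obtain y where y: "nb E w = {x, y}" "y \<noteq> x" by metis
  then have wy: "(w, y) \<in> E" unfolding nb_def by auto
  have "w \<in> D" using s(3)[OF xw(1)] w by auto
  then have "y \<notin> D" using s(3)[OF wy] by auto
  then show ?thesis using that y xw wy \<open>w \<in> D\<close> tr_in[OF s(1) wy] by blast
qed

text \<open>In the center-tree the numbers degree minus 2 add up to -2. The center \<open>x\<close>
  contributes \<open>card (inner_nb E x) - 2\<close>, and only ends contribute a negative amount, -1
  each; degree 0 does not occur, as there are at least two centers.\<close>

lemma end_count:
  assumes st: "star_tree V E D" and x: "x \<in> V" "x \<notin> D" "card (inner_nb E x) \<ge> 2"
  shows "card (inner_nb E x) \<le> card {c \<in> V - D. card (inner_nb E c) \<le> 1}"
proof -
  note s = staticD[OF st]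
  have fin: "finite (V - D)" using tr_finite[OF s(1)] by auto
  obtain w where "w \<in> inner_nb E x" using x(3) two_elems by blast
  then obtain y where y: "y \<noteq> x" "y \<in> V" "y \<notin> D" using inner_nb_other[OF st _ x(2)] by blast
  have n: "card V \<ge> 2" using y x(1) tr_finite[OF s(1)] by (metis card_le_Suc0_iff_eq not_less_eq_eq numeral_2_eq_2)
  let ?L = "{c \<in> V - D. card (inner_nb E c) \<le> 1}"
  have fi: "finite (inner_nb E c)" for c unfolding inner_nb_def using tr_finite_nb[OF s(1)] by auto
  have "2 + (if c = x then card (inner_nb E x) - 2 else 0) \<le> card (inner_nb E c) + (if card (inner_nb E c) \<le> 1 then 1 else 0)"
    if c: "c \<in> V - D" for c
  proof -
    have "x \<in> V - D" "y \<in> V - D" using x y by auto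
    then have "V - D \<noteq> {c}" using y(1) by (metis singletonD)
    then have "card (inner_nb E c) > 0" using inner_nb_nonempty[OF st] c fi by (auto simp: card_gt_0_iff)
    then show ?thesis using x(3) by auto
  qed
  then have "(\<Sum>c\<in>V - D. 2 + (if c = x then card (inner_nb E x) - 2 else 0)) \<le>
      (\<Sum>c\<in>V - D. card (inner_nb E c) + (if card (inner_nb E c) \<le> 1 then 1 else 0))" by (intro sum_mono) auto
  moreover have "(\<Sum>c\<in>V - D. 2 + (if c = x then card (inner_nb E x) - 2 else 0)) = 2 * card (V - D) + (card (inner_nb E x) - 2)"
    unfolding sum.distrib using fin x by (simp add: sum.delta)
  moreover have "(\<Sum>c\<in>V - D. card (inner_nb E c) + (if card (inner_nb E c) \<le> 1 then 1 else 0)) = (\<Sum>c\<in>V - D. card (inner_nb E c)) + card ?L"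
  proof -
    have "(\<Sum>c\<in>V - D. (if card (inner_nb E c) \<le> 1 then 1 else 0)) = (\<Sum>c\<in>?L. 1 :: nat)"
      using fin by (rule sum.inter_filter[symmetric])
    then show ?thesis by (simp add: sum.distrib)
  qed
  ultimately show ?thesis using sum_inner_nb[OF st n] x(3) by linarith
qed

text \<open>A leaf at \<open>z\<close> gives the factor 1/2 exactly, so at most one factor, that of
  the inner neighbour, can exceed 1/2. Without inner neighbours, \<open>1 / 2 \<le> g\<close> makes
  up for the factor \<open>g\<close>.\<close>

lemma upper_inner_nb:
  fixes g :: real
  assumes star_branch: "star_branch A EA D z d" and z: "z \<in> A" and zD: "z \<notin> D" and d1: "deg EA z \<ge> 1" and g: "1 / 2 \<le> g" "card (inner_nb EA z) \<le> 1"
    and h: "\<And>v A' EA' B EB. v \<in> inner_nb EA z \<Longrightarrow> split A EA z v A' EA' B EB \<Longrightarrow> real (F0 B EB v) \<le> g * real (F B EB)"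
  shows "real (F1 A EA z) \<le> g * (1 / 2) ^ (deg EA z - 1) * real (F0 A EA z)"
proof -
  have t: "tr A EA" using star_branch unfolding star_branch_def by auto
  have finn: "finite (nb EA z)" using tr_finite_nb[OF t] .
  have "real (F1 A EA z) \<le> (\<Prod>v\<in>nb EA z. if v \<in> inner_nb EA z then g else 1 / 2) * real (F0 A EA z)"
  proof (rule F1_prod(1)[OF t z])
    show "0 \<le> (if v \<in> inner_nb EA z then g else 1 / 2)" for v using g by simp
    fix v A' EA' B EB assume s: "split A EA z v A' EA' B EB"
    show "real (F0 B EB v) \<le> (if v \<in> inner_nb EA z then g else 1 / 2) * real (F B EB)"
    proof (cases "v \<in> inner_nb EA z")
      case False
      have zv: "(z, v) \<in> EA" using split_parts(8)[OF s] by auto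
      then have "v \<in> D" "v \<in> A" using star_branch zD tr_in[OF t zv] unfolding star_branch_def by auto
      then have dv: "deg EA v \<le> 2" using star_branch unfolding star_branch_def by auto
      show ?thesis
      proof (rule branch_cases[OF t s dv])
        assume "B = {v}" "EB = {}"
        then show ?thesis using False by simp
      next
        assume "deg EA v = 2"
        then show ?thesis using False zv unfolding inner_nb_def nb_def by auto
      qed
    qed (use h s in auto)
  qed
  also have "(\<Prod>v\<in>nb EA z. if v \<in> inner_nb EA z then g else 1 / 2) \<le> g * (1 / 2) ^ (deg EA z - 1)"
  proof (cases "inner_nb EA z = {}")
    case True
    then have "(\<Prod>v\<in>nb EA z. if v \<in> inner_nb EA z then g else 1 / 2) = (1 / 2) ^ deg EA z" by simp
    also have "\<dots> = 1 / 2 * (1 / 2) ^ (deg EA z - 1)" using d1 by (metis One_nat_def Suc_le_eq power_eq_if not_less_zero)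
    also have "\<dots> \<le> g * (1 / 2) ^ (deg EA z - 1)" using g by (intro mult_right_mono) auto
    finally show ?thesis .
  next
    case False
    then obtain u where u: "u \<in> inner_nb EA z" by blast
    have "finite (inner_nb EA z)" using finn unfolding inner_nb_def by auto
    then have inner_nb: "inner_nb EA z = {u}" using u g(2) False
      by (metis One_nat_def card_1_singletonE card_eq_0_iff le_Suc_eq le_zero_eq singletonD)
    have un: "u \<in> nb EA z" using u unfolding inner_nb_def by auto
    have "(\<Prod>v\<in>nb EA z. if v \<in> inner_nb EA z then g else 1 / 2) = g * (\<Prod>v\<in>nb EA z - {u}. if v = u then g else 1 / 2)"
      unfolding inner_nb using prod.remove[OF finn un, of "\<lambda>v. if v = u then g else 1 / 2"] by simp
    also have "(\<Prod>v\<in>nb EA z - {u}. if v = u then g else 1 / 2) = (\<Prod>v\<in>nb EA z - {u}. 1 / 2)"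
      by (intro prod.cong) auto
    also have "\<dots> = (1 / 2) ^ (deg EA z - 1)" using finn un by simp
    finally show ?thesis by simp
  qed
  finally show ?thesis by (simp add: mult_right_mono)
qed

text \<open>The counterpart of \<open>upper_inner_nb\<close> for a center that keeps two inner
  neighbours: all remaining factors, from leaves or not, are still at least 1/2.\<close>

lemma lower_inner_nb:
  fixes g :: real
  assumes t: "tr A EA" and x: "x \<in> A" and g: "0 \<le> g" and u: "u1 \<in> inner_nb EA x" "u2 \<in> inner_nb EA x" "u1 \<noteq> u2"
    and h: "\<And>v A' EA' B EB. v \<in> inner_nb EA x \<Longrightarrow> split A EA x v A' EA' B EB \<Longrightarrow> g * real (F B EB) \<le> real (F0 B EB v)"
  shows "g\<^sup>2 * (1 / 2) ^ (deg EA x - 2) * real (F0 A EA x) \<le> real (F1 A EA x)"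
proof -
  have finn: "finite (nb EA x)" using tr_finite_nb[OF t] .
  let ?b = "\<lambda>v. if v = u1 \<or> v = u2 then g else 1 / 2"
  have un: "u1 \<in> nb EA x" "u2 \<in> nb EA x" using u unfolding inner_nb_def by auto
  have "(\<Prod>v\<in>nb EA x. ?b v) = g * (\<Prod>v\<in>nb EA x - {u1}. ?b v)"
    using prod.remove[OF finn un(1), of ?b] by simp
  also have "(\<Prod>v\<in>nb EA x - {u1}. ?b v) = g * (\<Prod>v\<in>nb EA x - {u1} - {u2}. ?b v)"
    using prod.remove[of "nb EA x - {u1}" u2 ?b] finn un u(3) by simp
  also have "(\<Prod>v\<in>nb EA x - {u1} - {u2}. ?b v) = (\<Prod>v\<in>nb EA x - {u1} - {u2}. 1 / 2)"
    by (intro prod.cong) auto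
  also have "\<dots> = (1 / 2) ^ (deg EA x - 2)" using finn un u(3) by (simp add: numeral_2_eq_2)
  finally have e: "(\<Prod>v\<in>nb EA x. ?b v) = g\<^sup>2 * (1 / 2) ^ (deg EA x - 2)" by (simp add: power2_eq_square)
  have "(\<Prod>v\<in>nb EA x. ?b v) * real (F0 A EA x) \<le> real (F1 A EA x)"
  proof (rule F1_prod(2)[OF t x])
    show "0 \<le> ?b v" for v using g by simp
    show "?b v * real (F B EB) \<le> real (F0 B EB v)" if s: "split A EA x v A' EA' B EB" for v A' EA' B EB
      using h[OF _ s] u half_F_le_F0[OF split_parts(10)[OF s]] by auto
  qed
  then show ?thesis unfolding e .
qed

text \<open>Beyond some inner neighbour \<open>w\<close> of \<open>x\<close> there is a branch
  without \<open>z\<close>; once it is cut off, \<open>w\<close> is a leaf at \<open>x\<close>.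
  Attaching the branch to the leaf \<open>l\<close> of \<open>z\<close> instead is an allowed
  exchange, so \<open>l\<close> lies in no more stable sets of \<open>A\<close> than
  \<open>w\<close>. By \<open>leaf_eq\<close> the order is reversed for \<open>z\<close> and
  \<open>x\<close>. The contradictions below come from \<open>x\<close> having the larger
  odds.\<close>

lemma leaf_compare:
  assumes opt: "optimal V E a" and st: "star_tree V E D" "card D = a"
    and x: "x \<in> V" "x \<notin> D" "card (inner_nb E x) \<ge> 2"
    and z: "z \<in> V" "z \<notin> D" "z \<noteq> x" "l \<in> nb E z" "deg E l = 1"
    and d: "\<And>v. v \<in> V \<Longrightarrow> v \<notin> D \<Longrightarrow> d \<le> deg E v"
  obtains w A EA where "w \<in> inner_nb E x" "\<And>r. star_branch A EA D r d" "x \<in> A" "z \<in> A" "A \<subseteq> V" "F1 A EA x \<le> F1 A EA z"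
    "\<And>v. v \<in> A \<Longrightarrow> v \<noteq> w \<Longrightarrow> nb EA v = nb E v" "nb EA w = {x}"
proof -
  note s = staticD[OF st(1)]
  obtain w1 w2 where w12: "w1 \<in> inner_nb E x" "w2 \<in> inner_nb E x" "w1 \<noteq> w2" using two_elems[OF x(3)] by blast
  obtain y1 where y1: "nb E w1 = {x, y1}" "y1 \<noteq> x" "y1 \<notin> D" "(x, w1) \<in> E" "(w1, y1) \<in> E" "w1 \<in> D"
    using inner_nb_other[OF st(1) w12(1) x(2)] by metis
  obtain y2 where y2: "nb E w2 = {x, y2}" "y2 \<noteq> x" "y2 \<notin> D" "(x, w2) \<in> E" "(w2, y2) \<in> E" "w2 \<in> D"
    using inner_nb_other[OF st(1) w12(2) x(2)] by metis
  obtain w y A EA B EB where wy: "(w, y) \<in> {(w1, y1), (w2, y2)}" and sp: "split V E w y A EA B EB" "z \<in> A" "x \<in> A"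
    by (rule ex_split_away2[OF s(1) y1(4,5) y2(4,5) w12(3) y1(2) y2(2) z(1)])
  have w: "w \<in> inner_nb E x" "nb E w = {x, y}" "y \<noteq> x" "y \<notin> D" "w \<in> D" using wy w12 y1 y2 by auto
  note p = split_parts[OF sp(1)]
  have nbA: "nb EA v = nb E v" if "v \<in> A" "v \<noteq> w" for v using split_nb(3)[OF sp(1) that] by simp
  have nbw: "nb EA w = {x}" using split_nb(1,2)[OF sp(1)] w by auto
  have zl: "z \<noteq> w" using z(2) w(5) by auto
  then have lA: "l \<in> A" using nbA[OF sp(2)] z(4) tr_in[OF p(2), of z l] unfolding nb_def by blast
  have "z \<in> nb E l" using z(4) tr_sym[OF s(1), of z l] unfolding nb_def by auto
  then have nbl: "nb E l = {z}" using card_1_eq[OF z(5)] by blast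
  have lw: "l \<noteq> w" using nbl w by auto
  have "F1 A EA l \<le> F1 A EA w" using opt_move_left[OF opt sp(1) lA star_tree_movable[OF st]] w(4) by blast
  moreover have "2 * F1 A EA l + F1 A EA z = F A EA" using leaf_eq[OF p(2)] nbA[OF lA lw] nbl by simp
  moreover have "2 * F1 A EA w + F1 A EA x = F A EA" using leaf_eq[OF p(2) nbw] .
  ultimately have "F1 A EA x \<le> F1 A EA z" by linarith
  moreover have "star_branch A EA D r d" for r using split_star_branch[OF st(1) sp(1), of r d] d w(5) p(7) by blast
  ultimately show ?thesis using that[of w A EA] w sp nbA nbw p(7) by blast
qed

lemma inner_nb_eq_away:
  assumes t: "tr V E" and nbA: "\<And>v. v \<in> A \<Longrightarrow> v \<noteq> w \<Longrightarrow> nb EA v = nb E v" "nb EA w = {x}" and trA: "tr A EA"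
    and z: "z \<in> A" "z \<noteq> w" "z \<noteq> x"
  shows "inner_nb EA z = inner_nb E z"
proof -
  have "deg EA v = deg E v" if "v \<in> nb EA z" for v
  proof -
    have zv: "(z, v) \<in> EA" "(v, z) \<in> EA" using that tr_sym[OF trA, of z v] unfolding nb_def by auto
    then have "v \<noteq> w" using nbA(2) z(3) unfolding nb_def by auto
    then show ?thesis using nbA(1) tr_in[OF trA zv(1)] by simp
  qed
  then show ?thesis using nbA(1)[OF z(1,2)] unfolding inner_nb_def by auto
qed

lemma ex_leaf_nb:
  assumes st: "star_tree V E D" and z: "z \<in> V" "z \<notin> D" "card (inner_nb E z) \<le> 1" and n: "card V \<ge> 2"
  shows "\<exists>l\<in>nb E z. deg E l = 1"
proof (rule ccontr)
  assume h: "\<not> ?thesis"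
  note s = staticD[OF st]
  have "nb E z \<subseteq> inner_nb E z"
  proof
    fix v assume v: "v \<in> nb E z"
    then have "v \<in> D" "v \<in> V" using s(3)[of z v] z tr_in[OF s(1), of z v] unfolding nb_def by auto
    then have "deg E v \<le> 2" "deg E v \<ge> 1" using s(5) tr_deg_pos[OF s(1) _ n] by auto
    then show "v \<in> inner_nb E z" using h v unfolding inner_nb_def by fastforce
  qed
  moreover have "finite (inner_nb E z)" using tr_finite_nb[OF s(1)] unfolding inner_nb_def by auto
  ultimately have "deg E z \<le> 1" using card_mono z(3) le_trans by blast
  then show False using s(4)[OF z(1,2)] by simp
qed

text \<open>All factors of the odds of \<open>z\<close> but one are 1/2, and the remaining one is
  below 1. As \<open>z\<close> has at least one neighbour more than \<open>x\<close>, its odds stay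
  below \<open>(1 / 2) ^ deg E x\<close>, a lower bound for those of \<open>x\<close>.\<close>

lemma light_inner_contradiction:
  assumes opt: "optimal V E a" and st: "star_tree V E D" "card D = a" and n: "card V \<ge> 2"
    and x: "x \<in> V" "x \<notin> D" "card (inner_nb E x) \<ge> 2"
    and z: "z \<in> V" "z \<notin> D" "card (inner_nb E z) \<le> 1" "deg E x < deg E z"
    and d: "\<And>v. v \<in> V \<Longrightarrow> v \<notin> D \<Longrightarrow> d \<le> deg E v" "2 \<le> d"
  shows False
proof -
  note s = staticD[OF st(1)]
  have zx: "z \<noteq> x" using z(4) by auto
  obtain l where l: "l \<in> nb E z" "deg E l = 1" using ex_leaf_nb[OF st(1) z(1-3) n] by blast
  obtain w A EA where A: "w \<in> inner_nb E x" "\<And>r. star_branch A EA D r d" "x \<in> A" "z \<in> A" "A \<subseteq> V" "F1 A EA x \<le> F1 A EA z"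
    "\<And>v. v \<in> A \<Longrightarrow> v \<noteq> w \<Longrightarrow> nb EA v = nb E v" "nb EA w = {x}"
    using leaf_compare[OF opt st x z(1,2) zx l, of d] d(1) by blast
  have t: "tr A EA" using A(2) unfolding star_branch_def by auto
  have "w \<in> D" using A(1) x(2) inner_nb_other[OF st(1)] by blast
  then have ne: "z \<noteq> w" "x \<noteq> w" using z x by auto
  have dg: "deg EA z = deg E z" "deg EA x = deg E x" using A(7) A(3,4) ne by auto
  have innz: "inner_nb EA z = inner_nb E z" using inner_nb_eq_away[OF s(1) A(7,8) t A(4) ne(1) zx] .
  note rb = rate_bounds[OF d(2)]
  have "F1 A EA z < F1 A EA x"
  proof (rule odds_less[OF tr_finite[OF t]])
    show "real (F1 A EA z) \<le> rate d * (1 / 2) ^ (deg EA z - 1) * real (F0 A EA z)"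
    proof (rule upper_inner_nb[OF A(2,4) z(2)])
      show "1 \<le> deg EA z" using dg z(4) by simp
      show "1 / 2 \<le> rate d" "card (inner_nb EA z) \<le> 1" using rb innz z by auto
      show "real (F0 B EB v) \<le> rate d * real (F B EB)" if "split A EA z v A' EA' B EB" for v A' EA' B EB
        using branch_upper(1)[OF A(2)[of z] _ _ rb(3) that z(2) split_parts(5)[OF that]] rb by simp
    qed
    show "(1 / 2) ^ deg EA x * real (F0 A EA x) \<le> real (F1 A EA x)"
      using F0_le_power_F1[OF t A(3)] by (simp add: power_one_over field_simps)
    have "rate d * (1 / 2) ^ (deg EA z - 1) < 1 * (1 / 2) ^ (deg EA z - 1)" using rb by (intro mult_strict_right_mono) auto
    also have "\<dots> \<le> (1 / 2) ^ deg EA x" using dg z(4) by (simp add: power_decreasing)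
    finally show "rate d * (1 / 2) ^ (deg EA z - 1) < (1 / 2) ^ deg EA x" .
    show "0 \<le> rate d * (1 / 2) ^ (deg EA z - 1)" using rb by simp
  qed
  then show False using A(6) by simp
qed

text \<open>With equal degrees the inner neighbours decide: \<open>x\<close> keeps two of them after
  the cut, \<open>z\<close> has at most one. Their shares have the form
  \<open>(1 + o) / (2 + o)\<close>, where \<open>o\<close> is the odds of the next center in its
  branch. With \<open>M = 2 ^ (k - 1)\<close>, \<open>o\<close> is at least \<open>1 / M\<close> for
  any center of degree at most \<open>k\<close>, and at most \<open>2 / M\<close> for one of degree
  \<open>k\<close>. Two shares of the first kind outweigh one of the second together with a factor
  1/2.\<close>

lemma heavy_branching_contradiction:
  assumes opt: "optimal V E a" and st: "star_tree V E D" "card D = a" and n: "card V \<ge> 2"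
    and x: "x \<in> V" "x \<notin> D" "card (inner_nb E x) \<ge> 3"
    and z: "z \<in> V" "z \<notin> D" "card (inner_nb E z) \<le> 1" "deg E x = k" "deg E z = k"
    and d: "\<And>v. v \<in> V \<Longrightarrow> v \<notin> D \<Longrightarrow> d \<le> deg E v \<and> deg E v \<le> k" "2 \<le> d" "k \<le> d + 1"
    and inner: "\<And>v. v \<in> V \<Longrightarrow> v \<notin> D \<Longrightarrow> card (inner_nb E v) \<ge> 2 \<Longrightarrow> deg E v = k"
  shows False
proof -
  note s = staticD[OF st(1)]
  have zx: "z \<noteq> x" using z(3) x(3) by auto
  have x2: "card (inner_nb E x) \<ge> 2" using x(3) by simp
  obtain l where l: "l \<in> nb E z" "deg E l = 1" using ex_leaf_nb[OF st(1) z(1-3) n] by blast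
  obtain w A EA where A: "w \<in> inner_nb E x" "\<And>r. star_branch A EA D r d" "x \<in> A" "z \<in> A" "A \<subseteq> V" "F1 A EA x \<le> F1 A EA z"
    "\<And>v. v \<in> A \<Longrightarrow> v \<noteq> w \<Longrightarrow> nb EA v = nb E v" "nb EA w = {x}"
    using leaf_compare[OF opt st x(1,2) x2 z(1,2) zx l, of d] d(1) by blast
  have t: "tr A EA" using A(2) unfolding star_branch_def by auto
  have wD: "w \<in> D" using A(1) x(2) inner_nb_other[OF st(1)] by blast
  then have ne: "z \<noteq> w" "x \<noteq> w" using z x by auto
  have dg: "deg EA z = k" "deg EA x = k" using A(7) A(3,4) ne z by auto
  have innz: "inner_nb EA z = inner_nb E z" using inner_nb_eq_away[OF s(1) A(7,8) t A(4) ne(1) zx] .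
  note rb = rate_bounds[OF d(2)]
  have k2: "k \<ge> 2" using d(1)[OF x(1,2)] d(2) by simp
  define M :: real where "M = 2 ^ (k - 1)"
  have M2: "M \<ge> 2" unfolding M_def using k2 power_increasing[of 1 "k - 1" "2 :: real"] by simp
  have half: "(1 / 2) ^ (k - 1) = 1 / M" unfolding M_def by (simp add: power_one_over)
  \<comment> \<open>The center next to \<open>z\<close> is heavy: otherwise it would also be an end,
    and these two centers with their neighbours would be the whole tree, without room for
    \<open>x\<close>.\<close>
  have K_deg: "deg E c = k" if c: "c \<in> V" "c \<notin> D" "v \<in> inner_nb E z" "(v, c) \<in> E" "c \<noteq> z" for c v
  proof (rule inner[OF c(1,2)], rule ccontr)
    assume neg: "\<not> 2 \<le> card (inner_nb E c)"
    have vz: "nb E v = {z, c}"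
      using inner_nb_other[OF st(1) c(3) z(2)] c(4,5) by (metis (no_types, lifting) insertE mem_Collect_eq nb_def singletonD)
    have vc: "v \<in> inner_nb E c" using c(3,4) tr_sym[OF s(1) c(4)] unfolding inner_nb_def nb_def by auto
    have one: "u = v" if "u \<in> inner_nb E z \<or> u \<in> inner_nb E c" for u
    proof -
      have "finite (inner_nb E z)" "finite (inner_nb E c)" using tr_finite_nb[OF s(1)] unfolding inner_nb_def by auto
      then show ?thesis using that vc c(3) neg z(3) card_le_Suc0_iff_eq by (metis One_nat_def Suc_1 not_less_eq_eq)
    qed
    have nbc: "u \<in> D \<and> u \<in> V" if "u \<in> nb E z \<union> nb E c" for u
      using that s(3) z(2) c(2) tr_in[OF s(1)] unfolding nb_def by blast
    have "insert z (insert c (nb E z \<union> nb E c)) = V"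
    proof (rule tr_conn[OF s(1)])
      show "insert z (insert c (nb E z \<union> nb E c)) \<subseteq> V" using z c nbc by auto
      fix p q assume pq: "(p, q) \<in> E" "p \<in> insert z (insert c (nb E z \<union> nb E c))"
      show "q \<in> insert z (insert c (nb E z \<union> nb E c))"
      proof (cases "p = z \<or> p = c")
        case True
        then show ?thesis using pq unfolding nb_def by auto
      next
        case False
        then have pn: "p \<in> nb E z \<union> nb E c" using pq by auto
        show ?thesis
        proof (cases "p = v")
          case True
          then show ?thesis using pq vz unfolding nb_def by auto
        next
          case False
          then have "deg E p \<noteq> 2" using one[of p] pn unfolding inner_nb_def by blast
          then have "card (nb E p) \<le> Suc 0" using s(5)[of p] nbc[OF pn] by auto
          moreover have "q \<in> nb E p" "z \<in> nb E p \<or> c \<in> nb E p"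
            using pq pn tr_sym[OF s(1), of z p] tr_sym[OF s(1), of c p] unfolding nb_def by auto
          ultimately show ?thesis using card_le_Suc0_iff_eq[OF tr_finite_nb[OF s(1), of p]] by blast
        qed
      qed
    qed simp
    then have "x \<in> insert z (insert c (nb E z \<union> nb E c))" using x(1) by simp
    then have "x = c" using zx nbc x(2) by blast
    then show False using neg x2 by simp
  qed
  have "F1 A EA z < F1 A EA x"
  proof (rule odds_less[OF tr_finite[OF t]])
    \<comment> \<open>An inner neighbour of \<open>x\<close> is absent from at least the share \<open>?g\<close> of the stable sets of its branch,
      an inner neighbour of \<open>z\<close> from at most the share \<open>?h\<close>.\<close>
    let ?g = "(M + 1) / (2 * M + 1)" and ?h = "(M + 2) / (2 * M + 2)"
    show "real (F1 A EA z) \<le> ?h * (1 / 2) ^ (deg EA z - 1) * real (F0 A EA z)"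
    proof (rule upper_inner_nb[OF A(2,4) z(2)])
      show "1 \<le> deg EA z" using dg k2 by simp
      show "1 / 2 \<le> ?h" "card (inner_nb EA z) \<le> 1" using M2 innz z by (auto simp: field_simps)
      fix v A' EA' B EB assume v: "v \<in> inner_nb EA z" and sp: "split A EA z v A' EA' B EB"
      have "deg EA v = 2" using v unfolding inner_nb_def by auto
      then obtain c' where c': "nb EA v = {z, c'}" "z \<noteq> c'" using branch_cases[OF t sp] by (metis One_nat_def numeral_eq_one_iff order_refl semiring_norm(85))
      obtain X XE K EK where K: "split A EA v c' X XE K EK" "A' \<subseteq> X"
        "F0 B EB v = F K EK" "F B EB = F K EK + F0 K EK c'" "finite K"
        using branch_shape[OF sp c'] by metis
      have vc: "(v, c') \<in> EA" "(v, z) \<in> EA" using c' unfolding nb_def by auto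
      have c'A: "c' \<in> A" "v \<in> A" using tr_in[OF t vc(1)] by auto
      have "v \<in> D" using A(2) vc(2) z(2) unfolding star_branch_def by blast
      then have c'D: "c' \<notin> D" using A(2) vc(1) unfolding star_branch_def by blast
      then have c'w: "c' \<noteq> w" using wD by auto
      have "c' \<in> nb E v" "v \<noteq> w"
      proof -
        show "v \<noteq> w" using c' A(8) zx by auto
        then show "c' \<in> nb E v" using A(7)[OF c'A(2)] c' by auto
      qed
      then have "deg E c' = k" using K_deg[of c' v] c'A A(5) c'D v innz c'(2) unfolding nb_def by auto
      then have dc: "deg EA c' = k" using A(7)[OF c'A(1) c'w] by simp
      have zX: "z \<in> X" using K(2) split_parts(5)[OF sp] by auto
      have "real (F1 K EK c') \<le> rate d ^ (k - 1) * real (F0 K EK c')"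
        using branch_upper(2)[OF A(2)[of z] _ _ rb(3) K(1) c'D zX] rb dc by simp
      \<comment> \<open>The bound on \<open>rate d ^ (d + 1)\<close> that excludes degree
        \<open>d + 2\<close> is used a second time.\<close>
      moreover have "M * rate d ^ (k - 1) \<le> 2"
      proof -
        have "M * rate d ^ (k - 1) = (2 * rate d) ^ (k - 1)" unfolding M_def by (simp add: power_mult_distrib)
        also have "\<dots> \<le> (2 * rate d) ^ (d + 1)" using rb(1) d(3) by (intro power_increasing) auto
        also have "\<dots> = 2 ^ (d + 1) * rate d ^ (d + 1)" by (rule power_mult_distrib)
        also have "\<dots> \<le> 2 ^ (d + 1) * (1 / 2) ^ d" using rb(4) by (intro mult_left_mono) auto
        also have "\<dots> = 2" by (simp add: power_one_over)
        finally show ?thesis .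
      qed
      ultimately have "M * real (F1 K EK c') \<le> 2 * real (F0 K EK c')"
      proof -
        assume 1: "real (F1 K EK c') \<le> rate d ^ (k - 1) * real (F0 K EK c')" and 2: "M * rate d ^ (k - 1) \<le> 2"
        have "M * real (F1 K EK c') \<le> M * (rate d ^ (k - 1) * real (F0 K EK c'))" using 1 M2 by (intro mult_left_mono) auto
        also have "\<dots> = (M * rate d ^ (k - 1)) * real (F0 K EK c')" by simp
        also have "\<dots> \<le> 2 * real (F0 K EK c')" using 2 by (intro mult_right_mono) auto
        finally show ?thesis .
      qed
      then have "(2 * M + 2) * real (F0 B EB v) \<le> (M + 2) * real (F B EB)"
        using K(3,4) F_eq[OF K(5), of EK c'] by (simp add: algebra_simps)
      then show "real (F0 B EB v) \<le> ?h * real (F B EB)" using M2 by (simp add: field_simps)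
    qed
    have "inner_nb E x - {w} \<subseteq> inner_nb EA x"
    proof
      fix u assume u: "u \<in> inner_nb E x - {w}"
      have "u \<in> nb EA x" using u A(7)[OF A(3) ne(2)] unfolding inner_nb_def by auto
      then have "u \<in> A" using tr_in[OF t] unfolding nb_def by auto
      then show "u \<in> inner_nb EA x" using u A(7)[OF A(3) ne(2)] A(7)[of u] unfolding inner_nb_def by auto
    qed
    moreover have "card (inner_nb E x - {w}) \<ge> 2" using x(3) A(1) by simp
    ultimately obtain u1 u2 where u: "u1 \<in> inner_nb EA x" "u2 \<in> inner_nb EA x" "u1 \<noteq> u2" using two_elems by blast
    show "?g\<^sup>2 * (1 / 2) ^ (deg EA x - 2) * real (F0 A EA x) \<le> real (F1 A EA x)"
    proof (rule lower_inner_nb[OF t A(3) _ u])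
      show "0 \<le> ?g" using M2 by simp
      fix v A' EA' B EB assume v: "v \<in> inner_nb EA x" and sp: "split A EA x v A' EA' B EB"
      have "deg EA v = 2" using v unfolding inner_nb_def by auto
      then obtain c' where c': "nb EA v = {x, c'}" "x \<noteq> c'" using branch_cases[OF t sp] by (metis One_nat_def numeral_eq_one_iff order_refl semiring_norm(85))
      obtain X XE K EK where K: "split A EA v c' X XE K EK"
        "F0 B EB v = F K EK" "F B EB = F K EK + F0 K EK c'" "finite K"
        using branch_shape[OF sp c'] by metis
      have vc: "(v, c') \<in> EA" "(v, x) \<in> EA" using c' unfolding nb_def by auto
      have c'A: "c' \<in> A" using tr_in[OF t vc(1)] by auto
      have "v \<in> D" using A(2) vc(2) x(2) unfolding star_branch_def by blast
      then have c'D: "c' \<notin> D" using A(2) vc(1) unfolding star_branch_def by blast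
      then have "c' \<noteq> w" using wD by auto
      then have "deg EA c' \<le> k" using A(7)[OF c'A] d(1) c'A A(5) c'D by auto
      then have "deg EK c' \<le> k - 1" using split_deg(3)[OF K(1)] by simp
      then have "(2 :: real) ^ deg EK c' \<le> M" unfolding M_def by (intro power_increasing) auto
      then have "2 ^ deg EK c' * real (F1 K EK c') \<le> M * real (F1 K EK c')" by (intro mult_right_mono) auto
      then have "real (F0 K EK c') \<le> M * real (F1 K EK c')"
        using F0_le_power_F1[OF split_parts(3,6)[OF K(1)]] by linarith
      then have "(M + 1) * real (F B EB) \<le> (2 * M + 1) * real (F0 B EB v)"
        using K(2,3) F_eq[OF K(4), of EK c'] by (simp add: algebra_simps)
      then show "?g * real (F B EB) \<le> real (F0 B EB v)" using M2 by (simp add: field_simps)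
    qed
    \<comment> \<open>\<open>?h < 2 * ?g\<^sup>2\<close> with denominators cleared; the two sides
      differ by \<open>3 * M + 2\<close>.\<close>
    have "(M + 2) * (2 * M + 1)\<^sup>2 < 4 * (M + 1) ^ 3"
      using M2 by (simp add: power2_eq_square power3_eq_cube algebra_simps)
    then have "?h < 2 * ?g\<^sup>2"
      using M2 by (simp add: power_divide divide_simps) (simp add: power2_eq_square power3_eq_cube algebra_simps)
    then have "?h * (1 / M) < 2 * ?g\<^sup>2 * (1 / M)" using M2 by (intro mult_strict_right_mono) auto
    moreover have "(1 / 2) ^ (k - 2) = 2 * (1 / M)"
    proof -
      have "k - 1 = Suc (k - 2)" using k2 by simp
      then show ?thesis unfolding M_def by (simp add: power_one_over)
    qed
    ultimately show "?h * (1 / 2) ^ (deg EA z - 1) < ?g\<^sup>2 * (1 / 2) ^ (deg EA x - 2)"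
      unfolding dg half by (metis mult.assoc mult.commute)
    show "0 \<le> ?h * (1 / 2) ^ (deg EA z - 1)" using M2 by simp
  qed
  then show False using A(6) by simp
qed

text \<open>\<open>k\<close> is the average of the values rounded up and \<open>l\<close> the total
  deficit from it. Since the minimum \<open>d\<close> is attained, either all values are
  \<open>d\<close> and \<open>k = d\<close>, or \<open>k = d + 1\<close> and the deficit counts the
  values \<open>d\<close>.\<close>

lemma balanced_values:
  fixes f :: "'b \<Rightarrow> nat"
  assumes fin: "finite C" and sum: "(\<Sum>c\<in>C. f c) + l = card C * k" and l: "l < card C"
    and b: "\<And>c. c \<in> C \<Longrightarrow> d \<le> f c \<and> f c \<le> d + 1" and c0: "c0 \<in> C" "f c0 = d"
  shows "\<forall>c\<in>C. f c = k \<or> Suc (f c) = k" "card {c \<in> C. Suc (f c) = k} = l" "k \<le> d + 1" "d \<le> k"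
proof -
  let ?H = "{c \<in> C. f c = d + 1}" and ?L = "{c \<in> C. f c = d}"
  have "f c = d + of_bool (f c = d + 1)" if "c \<in> C" for c using b[OF that] by auto
  then have "(\<Sum>c\<in>C. f c) = (\<Sum>c\<in>C. d + of_bool (f c = d + 1))" by (intro sum.cong) auto
  also have "\<dots> = card C * d + card ?H" using fin by (simp add: sum.distrib Collect_conj_eq)
  finally have s: "card C * d + card ?H + l = card C * k" using sum by simp
  have "C = ?H \<union> ?L" using b by fastforce
  moreover have "?H \<inter> ?L = {}" by auto
  ultimately have cC: "card C = card ?H + card ?L" using fin by (metis (no_types, lifting) card_Un_disjoint finite_Un)
  have "card ?L > 0" using c0 fin by (auto simp: card_gt_0_iff)
  then have hl: "card ?H + l < 2 * card C" using cC l by linarith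
  have m: "card C > 0" using l by simp
  have "card C * d \<le> card C * k" using s by linarith
  then have dk: "d \<le> k" using m by simp
  then obtain e where e: "k = d + e" using le_Suc_ex by blast
  have s': "card ?H + l = card C * e" using s unfolding e by (simp add: distrib_left)
  then have "card C * e < card C * 2" using hl by simp
  then have "e < 2" using m by simp
  then consider "e = 0" | "e = 1" by linarith
  then have "(\<forall>c\<in>C. f c = k \<or> Suc (f c) = k) \<and> card {c \<in> C. Suc (f c) = k} = l \<and> k \<le> d + 1 \<and> d \<le> k"
  proof cases
    case 1
    then have "card ?H = 0" "l = 0" using s' by auto
    then have "f c = k" if "c \<in> C" for c using b[OF that] that fin 1 e by (auto simp: le_Suc_eq)
    then have fk: "\<And>c. c \<in> C \<Longrightarrow> f c = k" by blast
    have "Suc (f c) \<noteq> k" if "c \<in> C" for c using fk[OF that] by simp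
    then have emp: "{c \<in> C. Suc (f c) = k} = {}" by blast
    show "(\<forall>c\<in>C. f c = k \<or> Suc (f c) = k) \<and> card {c \<in> C. Suc (f c) = k} = l \<and> k \<le> d + 1 \<and> d \<le> k"
      unfolding emp using \<open>l = 0\<close> 1 e fk by simp
  next
    case 2
    then have "{c \<in> C. Suc (f c) = k} = ?L" using e by auto
    moreover have "card ?L = l" using s' cC 2 by simp
    moreover have "f c = k \<or> Suc (f c) = k" if "c \<in> C" for c using b[OF that] 2 e by linarith
    ultimately show "(\<forall>c\<in>C. f c = k \<or> Suc (f c) = k) \<and> card {c \<in> C. Suc (f c) = k} = l \<and> k \<le> d + 1 \<and> d \<le> k"
      using 2 e by simp
  qed
  then show "\<forall>c\<in>C. f c = k \<or> Suc (f c) = k" "card {c \<in> C. Suc (f c) = k} = l" "k \<le> d + 1" "d \<le> k"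
    by simp_all
qed

text \<open>\<open>k\<close> is the degree of the heavy centers and \<open>l\<close> the number of
  light ones.\<close>

definition light_ends :: "'a set \<Rightarrow> ('a \<times> 'a) set \<Rightarrow> 'a set \<Rightarrow> nat \<Rightarrow> nat \<Rightarrow> bool" where
  "light_ends V E D k l \<longleftrightarrow> star_tree V E D \<and> (\<forall>c\<in>V - D. deg E c = k \<or> Suc (deg E c) = k) \<and>
     card {c \<in> V - D. Suc (deg E c) = k} = l \<and> (\<forall>c\<in>V - D. card (inner_nb E c) \<le> 2) \<and>
     (\<forall>c\<in>V - D. Suc (deg E c) = k \<longrightarrow> card (inner_nb E c) \<le> 1)"

lemma optimal_light_ends:
  assumes opt: "optimal V E a" and n: "card V < 2 * a" "3 \<le> card V"
    and k: "card V - 1 + l = (card V - a) * k" "l < card V - a" "l \<le> 2"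
  shows "\<exists>D. light_ends V E D k l \<and> card D = a"
proof -
  obtain D where st: "star_tree V E D" "card D = a" using optimal_star_tree[OF opt n] by blast
  note s = staticD[OF st(1)]
  let ?C = "V - D"
  have fin: "finite ?C" using tr_finite[OF s(1)] by auto
  have cC: "card ?C = card V - a" using star_tree_sums(3)[OF st(1)] st(2) by simp
  then have C: "?C \<noteq> {}" using k(2) by (metis card.empty not_less_zero)
  have n2: "card V \<ge> 2" using n by simp
  obtain c0 where c0: "c0 \<in> ?C" "\<And>v. v \<in> ?C \<Longrightarrow> deg E c0 \<le> deg E v"
    using arg_min_if_finite(1)[OF fin C, of "deg E"] arg_min_least[OF fin C, of _ "deg E"] by blast
  let ?d = "deg E c0"
  have d2: "2 \<le> ?d" using s(4) c0(1) by auto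
  have b: "?d \<le> deg E c \<and> deg E c \<le> ?d + 1" if "c \<in> ?C" for c
    using star_tree_balanced[OF opt st, of c c0] that c0 by auto
  have "(\<Sum>c\<in>?C. deg E c) + l = card ?C * k" using star_tree_sums(1)[OF st(1)] k(1) cC by simp
  note bv = balanced_values[OF fin this _ b c0(1) refl] 
  have lC: "l < card ?C" using k(2) cC by simp
  have val: "deg E c = k \<or> Suc (deg E c) = k" if "c \<in> ?C" for c using bv(1)[OF lC] that by blast
  have cl: "card {c \<in> ?C. Suc (deg E c) = k} = l" and kd: "k \<le> ?d + 1" using bv[OF lC] by auto
  have heavy_end: "\<exists>z\<in>?C. card (inner_nb E z) \<le> 1 \<and> deg E z = k"
    if "card {c \<in> ?C. card (inner_nb E c) \<le> 1 \<and> Suc (deg E c) = k} < card {c \<in> ?C. card (inner_nb E c) \<le> 1}"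
  proof (rule ccontr)
    assume "\<not> ?thesis"
    then have "{c \<in> ?C. card (inner_nb E c) \<le> 1} \<subseteq> {c \<in> ?C. card (inner_nb E c) \<le> 1 \<and> Suc (deg E c) = k}" using val by auto
    moreover have "finite {c \<in> ?C. card (inner_nb E c) \<le> 1 \<and> Suc (deg E c) = k}"
      by (rule finite_subset[OF _ fin]) auto
    ultimately have "card {c \<in> ?C. card (inner_nb E c) \<le> 1} \<le> card {c \<in> ?C. card (inner_nb E c) \<le> 1 \<and> Suc (deg E c) = k}"
      by (rule card_mono[rotated])
    then show False using that by simp
  qed
  have light: "card (inner_nb E x) \<le> 1" if x: "x \<in> ?C" "Suc (deg E x) = k" for x
  proof (rule ccontr)
    assume neg: "\<not> card (inner_nb E x) \<le> 1"
    \<comment> \<open>Strict, since \<open>x\<close> itself is light without being an end.\<close>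
    have "card {c \<in> ?C. card (inner_nb E c) \<le> 1 \<and> Suc (deg E c) = k} < card {c \<in> ?C. Suc (deg E c) = k}"
      using tr_finite[OF s(1)] x neg by (intro psubset_card_mono) auto
    also have "\<dots> \<le> 2" using cl k(3) by simp
    also have "2 \<le> card (inner_nb E x)" using neg by simp
    also have "\<dots> \<le> card {c \<in> ?C. card (inner_nb E c) \<le> 1}" using end_count[OF st(1)] x neg by simp
    finally obtain z where z: "z \<in> ?C" "card (inner_nb E z) \<le> 1" "deg E z = k" using heavy_end by blast
    show False
      using light_inner_contradiction[OF opt st n2, of x z ?d] x neg z b d2 by auto
  qed
  have two: "card (inner_nb E x) \<le> 2" if x: "x \<in> ?C" for x
  proof (rule ccontr)
    assume neg: "\<not> card (inner_nb E x) \<le> 2"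
    have "card {c \<in> ?C. card (inner_nb E c) \<le> 1 \<and> Suc (deg E c) = k} \<le> card {c \<in> ?C. Suc (deg E c) = k}"
      using tr_finite[OF s(1)] by (intro card_mono) auto
    also have "\<dots> \<le> 2" using cl k(3) by simp
    also have "2 < card (inner_nb E x)" using neg by simp
    also have "\<dots> \<le> card {c \<in> ?C. card (inner_nb E c) \<le> 1}" using end_count[OF st(1)] x neg by simp
    finally obtain z where z: "z \<in> ?C" "card (inner_nb E z) \<le> 1" "deg E z = k" using heavy_end by blast
    have inner: "deg E v = k" if "v \<in> ?C" "card (inner_nb E v) \<ge> 2" for v
      using val[OF that(1)] light[OF that(1)] that(2) by auto
    show False
    proof (rule heavy_branching_contradiction[OF opt st n2, of x z k ?d])
      show "?d \<le> deg E v \<and> deg E v \<le> k" if "v \<in> V" "v \<notin> D" for v using b[of v] val[of v] that by auto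
    qed (use x neg z inner d2 kd in auto)
  qed
  have "light_ends V E D k l" unfolding light_ends_def using st(1) val cl two light by blast
  then show ?thesis using st(2) by blast
qed

section \<open>The minimum as a function of the degrees\<close>

text \<open>Distance 2 expressed by a common neighbour; \<open>star_tree_distance_2\<close> shows
  the agreement.\<close>

definition center_adj :: "'a set \<Rightarrow> ('a \<times> 'a) set \<Rightarrow> 'a set \<Rightarrow> ('a \<times> 'a) set" where
  "center_adj V E D = {(c, c'). c \<in> V - D \<and> c' \<in> V - D \<and> c \<noteq> c' \<and> (\<exists>w. (c, w) \<in> E \<and> (w, c') \<in> E)}"

text \<open>A vertex of degree 2 in \<open>D\<close> joins two smaller pieces by an edge of the
  center-tree; if there is none, the tree is a star with one center. The bound 0 in
  \<open>star_branch\<close> leaves the degrees of centers free, since they drop when edges are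
  cut.\<close>

lemma tr_center_adj:
  assumes "star_branch V E D r 0" "V - D \<noteq> {}"
  shows "tr (V - D) (center_adj V E D)"
  using assms
proof (induction "card V" arbitrary: V E rule: less_induct)
  case less
  have t: "tr V E" and bip: "\<And>u v. (u, v) \<in> E \<Longrightarrow> (u \<in> D \<longleftrightarrow> v \<notin> D)"
    and dD: "\<And>v. v \<in> V \<Longrightarrow> v \<in> D \<Longrightarrow> deg E v \<le> 2"
    using less.prems(1) unfolding star_branch_def by auto
  show ?case
  proof (cases "\<exists>w\<in>V. w \<in> D \<and> deg E w = 2")
    case True
    then obtain w where w: "w \<in> V" "w \<in> D" "deg E w = 2" by blast
    then obtain c c' where cc: "nb E w = {c, c'}" "c \<noteq> c'" by (auto simp: card_2_iff)
    have wc: "(w, c) \<in> E" "(w, c') \<in> E" using cc unfolding nb_def by auto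
    have cD: "c \<notin> D" "c' \<notin> D" using bip[OF wc(1)] bip[OF wc(2)] w by auto
    obtain A EA B EB where s: "split V E c w A EA B EB" using tr_split[OF t] tr_sym[OF t wc(1)] by blast
    note p = split_parts[OF s]
    have nbB: "nb EB w = {c'}" using split_nb(4,5)[OF s] cc by auto
    then have "(w, c') \<in> EB" unfolding nb_def by auto
    then obtain W EW K EK where s2: "split B EB w c' W EW K EK" using tr_split[OF p(3)] by blast
    note q = split_parts[OF s2]
    have "nb EW w = {}" using split_nb(1,2)[OF s2] nbB by auto
    note W = tr_isolated(1)[OF q(2,5) this] and EW = tr_isolated(2)[OF q(2,5) this]
    have E: "E = EA \<union> EK \<union> {(c, w), (w, c), (w, c'), (c', w)}" unfolding p(8) q(8) EW by auto
    have V: "V = A \<union> insert w K" unfolding p(7) q(7) W by auto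
    have disj: "A \<inter> K = {}" "w \<notin> A" "w \<notin> K" using p(4) q(4) W unfolding q(7) by auto
    have sub: "EA \<subseteq> A \<times> A" "EK \<subseteq> K \<times> K" using tr_sub p(2) q(3) by auto
    have cA: "c \<in> A" "c' \<in> K" using p(5) q(6) by auto
    have sem: "star_branch X XE D r 0" if X: "tr X XE" "X \<subseteq> V" "XE \<subseteq> E" for X XE
    proof -
      have "deg XE v \<le> deg E v" for v
        using X(3) tr_finite_nb[OF t] by (intro card_mono) (auto simp: nb_def)
      then have "deg XE v \<le> 2" if "v \<in> X" "v \<in> D" for v using dD[of v] that X(2) by (meson le_trans subsetD)
      moreover have "u \<in> D \<longleftrightarrow> v \<notin> D" if "(u, v) \<in> XE" for u v using bip that X(3) by blast
      ultimately show ?thesis using X(1) unfolding star_branch_def by blast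
    qed
    have "star_branch A EA D r 0" "star_branch K EK D r 0"
      using p(2) q(3) unfolding V E by (auto intro!: sem[unfolded V E])
    then have IH: "tr (A - D) (center_adj A EA D)" "tr (K - D) (center_adj K EK D)"
      using less.hyps[of A EA] less.hyps[of K EK] cA cD split_card(2,3)[OF s] split_card(3)[OF s2] by auto
    have "center_adj V E D = center_adj A EA D \<union> center_adj K EK D \<union> {(c, c'), (c', c)}"
    proof (intro equalityI subsetI)
      fix z assume "z \<in> center_adj V E D"
      then obtain x y u where z: "z = (x, y)" "x \<in> V - D" "y \<in> V - D" "x \<noteq> y" "(x, u) \<in> E" "(u, y) \<in> E"
        unfolding center_adj_def by auto
      have xy: "x \<noteq> w" "y \<noteq> w" using z w by auto
      have uD: "u \<in> D" using bip[OF z(5)] z(2) by auto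
      then have u: "u \<noteq> c" "u \<noteq> c'" using cD by auto
      show "z \<in> center_adj A EA D \<union> center_adj K EK D \<union> {(c, c'), (c', c)}"
      proof (cases "u = w")
        case True
        have "x \<in> nb E w" "y \<in> nb E w" using z True tr_sym[OF t, of x w] unfolding nb_def by auto
        then show ?thesis using cc z by auto
      next
        case False
        then have "(x, u) \<in> EA \<union> EK" "(u, y) \<in> EA \<union> EK" using z u xy unfolding E by auto
        then show ?thesis using z sub disj(1) unfolding center_adj_def by blast
      qed
    next
      fix z assume "z \<in> center_adj A EA D \<union> center_adj K EK D \<union> {(c, c'), (c', c)}"
      then show "z \<in> center_adj V E D" using cA cD cc(2) unfolding center_adj_def V E by blast
    qed
    moreover have "V - D = (A - D) \<union> (K - D)" using V w by auto
    moreover have "tr ((A - D) \<union> (K - D)) (center_adj A EA D \<union> center_adj K EK D \<union> {(c, c'), (c', c)})"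
      using disj(1) cA cD by (intro tr_join[OF IH]) auto
    ultimately show ?thesis by simp
  next
    case False
    obtain c where c: "c \<in> V" "c \<notin> D" using less.prems by blast
    have nD: "nb E c \<subseteq> D" using bip c unfolding nb_def by blast
    have "deg E a \<le> 1" if a: "a \<in> nb E c" for a
    proof -
      have "a \<in> V" "a \<in> D" using a nD tr_in[OF t] unfolding nb_def by blast+
      then have "deg E a \<le> 2" "deg E a \<noteq> 2" using dD False by auto
      then show ?thesis by simp
    qed
    then have "V = insert c (nb E c)" by (rule tr_star[OF t c(1)])
    then have VD: "V - D = {c}" using c nD by blast
    moreover have "center_adj V E D = {}" unfolding center_adj_def VD by auto
    ultimately show ?thesis by (simp add: tr_single)
  qed
qed

section \<open>Enumeration of the center-tree as a path\<close>

definition path_order :: "'a set \<Rightarrow> ('a \<times> 'a) set \<Rightarrow> (nat \<Rightarrow> 'a) \<Rightarrow> bool" where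
  "path_order W R f \<longleftrightarrow> bij_betw f {..<card W} W \<and>
     (\<forall>i<card W. \<forall>j<card W. (f i, f j) \<in> R \<longleftrightarrow> (j = Suc i \<or> i = Suc j))"

lemma path_order_rev:
  assumes "path_order W R f"
  shows "path_order W R (\<lambda>i. f (card W - 1 - i))"
proof -
  let ?m = "card W" let ?r = "\<lambda>j. ?m - 1 - j"
  have "bij_betw ?r {..<?m} {..<?m}" by (rule bij_betw_byWitness[where f' = ?r]) auto
  then have "bij_betw (f \<circ> ?r) {..<?m} W" using assms bij_betw_trans unfolding path_order_def by blast
  moreover have "(f (?r i), f (?r j)) \<in> R \<longleftrightarrow> (j = Suc i \<or> i = Suc j)" if "i < ?m" "j < ?m" for i j
  proof -
    have "?r i < ?m" "?r j < ?m" using that by auto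
    then have "(f (?r i), f (?r j)) \<in> R \<longleftrightarrow> (?r j = Suc (?r i) \<or> ?r i = Suc (?r j))"
      using assms unfolding path_order_def by blast
    then show ?thesis using that by auto
  qed
  ultimately show ?thesis unfolding path_order_def comp_def by blast
qed

text \<open>Before the leaf \<open>b\<close> is attached, \<open>a\<close> has degree at most 1 and
  hence is an end of the enumeration. Reversed if necessary, the enumeration has \<open>a\<close>
  last, and \<open>b\<close> is appended.\<close>

lemma path_enum:
  assumes "tr V E" "\<And>v. v \<in> V \<Longrightarrow> deg E v \<le> 2"
  shows "\<exists>f. path_order V E f"
  using assms
proof (induction rule: tr_leaf_induct)
  case (single v)
  show ?case by (rule exI[of _ "\<lambda>_. v"]) (simp add: path_order_def bij_betw_def lessThan_Suc)
next
  case (leaf A EA a b)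
  let ?E = "EA \<union> {(a, b), (b, a)}" and ?k = "card A"
  have fin: "finite A" using tr_finite[OF leaf.hyps(1)] .
  have sub: "EA \<subseteq> A \<times> A" using tr_sub[OF leaf.hyps(1)] .
  have nbs: "nb ?E v = nb EA v" if "v \<in> A" "v \<noteq> a" for v using that leaf.hyps(3) unfolding nb_def by auto
  have nba: "nb ?E a = insert b (nb EA a)" "b \<notin> nb EA a" using leaf.hyps(2,3) sub unfolding nb_def by auto
  have da: "deg EA a \<le> 1" using leaf.prems[of a] leaf.hyps(2) nba tr_finite_nb[OF leaf.hyps(1)] by simp
  have "deg EA v \<le> 2" if "v \<in> A" for v
    using leaf.prems[of v] nbs[OF that] da that by (cases "v = a") auto
  then obtain f where po: "path_order A EA f" using leaf.IH by blast
  then have f: "bij_betw f {..<?k} A"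
    "\<And>i j. i < ?k \<Longrightarrow> j < ?k \<Longrightarrow> (f i, f j) \<in> EA \<longleftrightarrow> (j = Suc i \<or> i = Suc j)"
    unfolding path_order_def by blast+
  have inj: "f i = f j \<longleftrightarrow> i = j" if "i < ?k" "j < ?k" for i j
    using f(1) that unfolding bij_betw_def inj_on_def by auto
  have "a \<in> f ` {..<?k}" using f(1) leaf.hyps(2) unfolding bij_betw_def by simp
  then obtain i where i: "i < ?k" "f i = a" by blast
  have ends: "i = 0 \<or> Suc i = ?k"
  proof (rule ccontr)
    assume "\<not> ?thesis"
    then have r: "i > 0" "Suc i < ?k" using i by auto
    have "f (i - 1) \<in> nb EA a" "f (Suc i) \<in> nb EA a"
      using f(2)[of i "i - 1"] f(2)[of i "Suc i"] r i unfolding nb_def by auto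
    moreover have "f (i - 1) \<noteq> f (Suc i)" using inj[of "i - 1" "Suc i"] r by auto
    ultimately show False using da card_le_Suc0_iff_eq[OF tr_finite_nb[OF leaf.hyps(1), of a]] by auto
  qed
  obtain g where go: "path_order A EA g" and gl: "g (?k - 1) = a"
  proof (cases "Suc i = ?k")
    case True
    then show ?thesis using that[OF po] i by (metis diff_Suc_1)
  next
    case False
    then show ?thesis using that[OF path_order_rev[OF po]] i ends by simp
  qed
  have g: "bij_betw g {..<?k} A" "g (?k - 1) = a"
    "\<And>i j. i < ?k \<Longrightarrow> j < ?k \<Longrightarrow> (g i, g j) \<in> EA \<longleftrightarrow> (j = Suc i \<or> i = Suc j)"
    using go gl unfolding path_order_def by blast+
  have ginj: "g i = g j \<longleftrightarrow> i = j" if "i < ?k" "j < ?k" for i j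
    using g(1) that unfolding bij_betw_def inj_on_def by auto
  have gA: "g i \<in> A" if "i < ?k" for i using g(1) that unfolding bij_betw_def by auto
  have k0: "?k > 0" using leaf.hyps(2) fin by (auto simp: card_gt_0_iff)
  have kb: "card (insert b A) = Suc ?k" using fin leaf.hyps(3) by simp
  define h where "h = g(?k := b)"
  have "bij_betw h {..<Suc ?k} (insert b A)"
  proof -
    have "bij_betw h {..<?k} A" using g(1) by (rule bij_betw_cong[THEN iffD1, rotated]) (auto simp: h_def)
    then have "bij_betw h ({..<?k} \<union> {?k}) (A \<union> {h ?k})"
      using leaf.hyps(3) by (intro notIn_Un_bij_betw) (auto simp: h_def)
    then show ?thesis by (simp add: h_def lessThan_Suc)
  qed
  moreover have "(h i, h j) \<in> ?E \<longleftrightarrow> (j = Suc i \<or> i = Suc j)" if ij: "i < Suc ?k" "j < Suc ?k" for i j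
  proof -
    have last: "g i = a \<longleftrightarrow> Suc i = ?k" if "i < ?k" for i using ginj[of i "?k - 1"] g(2) that k0 by auto
    consider "i < ?k" "j < ?k" | "i = ?k" "j < ?k" | "i < ?k" "j = ?k" | "i = ?k" "j = ?k" using ij by linarith
    then show ?thesis
    proof cases
      case 1
      then have "h i = g i" "h j = g j" "g i \<noteq> b" "g j \<noteq> b" using gA leaf.hyps(3) by (auto simp: h_def)
      then show ?thesis using g(3)[OF 1] by auto
    next
      case 2
      then have h: "h i = b" "h j = g j" "g j \<in> A" using gA by (auto simp: h_def)
      have "(b, g j) \<notin> EA" "g j \<noteq> b" using sub leaf.hyps(3) h(3) by blast+
      then have "(h i, h j) \<in> ?E \<longleftrightarrow> g j = a" using h(1,2) by simp
      then show ?thesis using last[OF 2(2)] 2 by linarith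
    next
      case 3
      then have h: "h j = b" "h i = g i" "g i \<in> A" using gA by (auto simp: h_def)
      have "(g i, b) \<notin> EA" "g i \<noteq> b" using sub leaf.hyps(3) h(3) by blast+
      then have "(h i, h j) \<in> ?E \<longleftrightarrow> g i = a" using h(1,2) by simp
      then show ?thesis using last[OF 3(1)] 3 by linarith
    next
      case 4
      then have h: "h i = b" "h j = b" by (auto simp: h_def)
      have "(b, b) \<notin> EA" "a \<noteq> b" using sub leaf.hyps(2,3) by blast+
      then show ?thesis using 4 h by simp
    qed
  qed
  ultimately show ?case unfolding path_order_def kb by blast
qed

abbreviation center_path :: "'a set \<Rightarrow> ('a \<times> 'a) set \<Rightarrow> 'a set \<Rightarrow> (nat \<Rightarrow> 'a) \<Rightarrow> bool" where
  "center_path V E D f \<equiv> path_order (V - D) (center_adj V E D) f"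

lemma star_tree_star_branch: "star_tree V E D \<Longrightarrow> star_branch V E D r 0"
  unfolding star_tree_def star_branch_def by auto

lemma deg_center_adj_le:
  assumes st: "star_tree V E D" and c: "c \<in> V" "c \<notin> D"
  shows "deg (center_adj V E D) c \<le> card (inner_nb E c)"
proof -
  note s = staticD[OF st]
  have fin: "finite (inner_nb E c)" using tr_finite_nb[OF s(1)] unfolding inner_nb_def by auto
  have "nb (center_adj V E D) c \<subseteq> (\<Union>w\<in>inner_nb E c. nb E w - {c})"
  proof
    fix y assume "y \<in> nb (center_adj V E D) c"
    then obtain w where w: "y \<noteq> c" "(c, w) \<in> E" "(w, y) \<in> E" unfolding nb_def center_adj_def by auto
    have wD: "w \<in> D" using s(3)[OF w(2)] c by auto
    have "{c, y} \<subseteq> nb E w" using w tr_sym[OF s(1) w(2)] unfolding nb_def by auto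
    then have "card {c, y} \<le> deg E w" using tr_finite_nb[OF s(1)] by (intro card_mono)
    then have "deg E w = 2" using s(5)[OF wD] w(1) by auto
    then show "y \<in> (\<Union>w\<in>inner_nb E c. nb E w - {c})" using w unfolding inner_nb_def nb_def by auto
  qed
  then have "deg (center_adj V E D) c \<le> card (\<Union>w\<in>inner_nb E c. nb E w - {c})"
    using fin tr_finite_nb[OF s(1)] by (intro card_mono) auto
  also have "\<dots> \<le> (\<Sum>w\<in>inner_nb E c. card (nb E w - {c}))" using fin by (rule card_UN_le)
  also have "\<dots> = (\<Sum>w\<in>inner_nb E c. 1)"
  proof (rule sum.cong)
    fix w assume w: "w \<in> inner_nb E c"
    then have "c \<in> nb E w" using tr_sym[OF s(1), of c w] unfolding inner_nb_def nb_def by auto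
    then show "card (nb E w - {c}) = 1" using w unfolding inner_nb_def by simp
  qed simp
  finally show ?thesis by simp
qed

lemma light_ends_center_path:
  assumes tg: "light_ends V E D k l" and C: "V - D \<noteq> {}"
  shows "\<exists>f. center_path V E D f \<and>
    (\<forall>i<card (V - D). Suc (deg E (f i)) = k \<longrightarrow> i = 0 \<or> Suc i = card (V - D))"
proof -
  have st: "star_tree V E D" using tg unfolding light_ends_def by auto
  have t: "tr (V - D) (center_adj V E D)" using tr_center_adj[OF star_tree_star_branch[OF st] C] .
  have "deg (center_adj V E D) c \<le> 2" if "c \<in> V - D" for c
  proof -
    have "card (inner_nb E c) \<le> 2" using tg that unfolding light_ends_def by blast
    then show ?thesis using deg_center_adj_le[OF st, of c] that by auto
  qed
  then obtain f where f: "center_path V E D f" using path_enum[OF t] by blast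
  have "i = 0 \<or> Suc i = card (V - D)" if i: "i < card (V - D)" "Suc (deg E (f i)) = k" for i
  proof (rule ccontr)
    assume "\<not> ?thesis"
    then have r: "i > 0" "Suc i < card (V - D)" using i by auto
    have "f i \<in> V - D" using f i unfolding path_order_def bij_betw_def by auto
    then have "card (inner_nb E (f i)) \<le> 1" using tg i(2) unfolding light_ends_def by blast
    then have "deg (center_adj V E D) (f i) \<le> Suc 0" using deg_center_adj_le[OF st, of "f i"] \<open>f i \<in> V - D\<close> by auto
    moreover have "f (i - 1) \<in> nb (center_adj V E D) (f i)" "f (Suc i) \<in> nb (center_adj V E D) (f i)"
      using f r i unfolding path_order_def nb_def by auto
    ultimately have "f (i - 1) = f (Suc i)" using card_le_Suc0_iff_eq[OF tr_finite_nb[OF t, of "f i"]] by blast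
    moreover have "i - 1 < card (V - D)" "Suc i < card (V - D)" using r by auto
    ultimately have "i - 1 = Suc i" using f unfolding path_order_def bij_betw_def inj_on_def by blast
    then show False by simp
  qed
  then show ?thesis using f by blast
qed

text \<open>Centers are pairwise nonadjacent, so a stable set is any set \<open>Y\<close> of centers
  with any vertices of \<open>D\<close> that have no neighbour in \<open>Y\<close>.\<close>

lemma F_eq_sum:
  assumes st: "star_tree V E D"
  shows "F V E = (\<Sum>Y\<in>Pow (V - D). 2 ^ card (D - (\<Union>c\<in>Y. nb E c)))"
proof -
  note s = staticD[OF st]
  have fin: "finite V" "finite D" using tr_finite[OF s(1)] finite_subset[OF s(2)] by auto
  have "bij_betw (\<lambda>S. (S - D, S \<inter> D)) (stab V E) (SIGMA Y:Pow (V - D). Pow (D - (\<Union>c\<in>Y. nb E c)))"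
  proof (rule bij_betw_byWitness[where f' = "\<lambda>(Y, Z). Y \<union> Z"])
    show "\<forall>S\<in>stab V E. (\<lambda>(Y, Z). Y \<union> Z) (S - D, S \<inter> D) = S" by auto
    show "\<forall>p\<in>(SIGMA Y:Pow (V - D). Pow (D - (\<Union>c\<in>Y. nb E c))). (\<lambda>S. (S - D, S \<inter> D)) ((\<lambda>(Y, Z). Y \<union> Z) p) = p" by auto
    show "(\<lambda>S. (S - D, S \<inter> D)) ` stab V E \<subseteq> (SIGMA Y:Pow (V - D). Pow (D - (\<Union>c\<in>Y. nb E c)))"
      unfolding stab_def nb_def by auto
    show "(\<lambda>(Y, Z). Y \<union> Z) ` (SIGMA Y:Pow (V - D). Pow (D - (\<Union>c\<in>Y. nb E c))) \<subseteq> stab V E"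
    proof
      fix S assume "S \<in> (\<lambda>(Y, Z). Y \<union> Z) ` (SIGMA Y:Pow (V - D). Pow (D - (\<Union>c\<in>Y. nb E c)))"
      then obtain Y Z where S: "S = Y \<union> Z" and Y: "Y \<in> Pow (V - D)" and Z: "Z \<in> Pow (D - (\<Union>c\<in>Y. nb E c))" by auto
      have "(u, v) \<notin> E" if uv: "u \<in> Y \<union> Z" "v \<in> Y \<union> Z" for u v
      proof
        assume e: "(u, v) \<in> E"
        have uD: "u \<in> Z \<longleftrightarrow> u \<in> D" "v \<in> Z \<longleftrightarrow> v \<in> D" using uv Y Z by auto
        consider "u \<in> Y" "v \<in> Z" | "v \<in> Y" "u \<in> Z" using s(3)[OF e] uD uv by blast
        then show False
        proof cases
          case 1
          then show ?thesis using e Z unfolding nb_def by auto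
        next
          case 2
          then show ?thesis using tr_sym[OF s(1) e] Z unfolding nb_def by auto
        qed
      qed
      then show "S \<in> stab V E" using Y Z s(2) unfolding S stab_def by blast
    qed
  qed
  then have "card (stab V E) = card (SIGMA Y:Pow (V - D). Pow (D - (\<Union>c\<in>Y. nb E c)))" by (rule bij_betw_same_card)
  also have "\<dots> = (\<Sum>Y\<in>Pow (V - D). card (Pow (D - (\<Union>c\<in>Y. nb E c))))" using fin by (intro card_SigmaI) auto
  also have "\<dots> = (\<Sum>Y\<in>Pow (V - D). 2 ^ card (D - (\<Union>c\<in>Y. nb E c)))" using fin by (simp add: card_Pow)
  finally show ?thesis unfolding cnt_def by simp
qed

text \<open>Inclusion-exclusion: a vertex of \<open>D\<close> has at most two neighbours and is
  counted twice exactly if it lies between two consecutive centers with indices in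
  \<open>X\<close>.\<close>

lemma card_nb_union:
  assumes st: "star_tree V E D" and f: "center_path V E D f" and X: "X \<subseteq> {..<card (V - D)}"
  shows "card (\<Union>i\<in>X. nb E (f i)) + card {i. i \<in> X \<and> Suc i \<in> X} = (\<Sum>i\<in>X. deg E (f i))"
proof -
  note s = staticD[OF st]
  have fin: "finite D" "finite X" using tr_finite[OF s(1)] finite_subset[OF s(2)] finite_subset[OF X] by auto
  have fC: "f i \<in> V - D" if "i \<in> X" for i using f X that unfolding path_order_def bij_betw_def by auto
  have inj: "i = j" if "f i = f j" "i \<in> X" "j \<in> X" for i j
    using f that X unfolding path_order_def bij_betw_def inj_on_def by blast
  have nD: "nb E (f i) \<subseteq> D" if "i \<in> X" for i using s(3) fC[OF that] unfolding nb_def by blast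
  let ?N = "\<Union>i\<in>X. nb E (f i)"
  let ?P = "{w \<in> D. \<exists>i. i \<in> X \<and> Suc i \<in> X \<and> w \<in> nb E (f i) \<inter> nb E (f (Suc i))}"
  have adj: "(f i, f j) \<in> center_adj V E D \<longleftrightarrow> (j = Suc i \<or> i = Suc j)" if "i \<in> X" "j \<in> X" for i j
    using f that X unfolding path_order_def by blast
  have cP: "card {i. i \<in> X \<and> Suc i \<in> X} = card ?P"
  proof -
    have ex: "\<exists>w. w \<in> nb E (f i) \<inter> nb E (f (Suc i))" if "i \<in> X" "Suc i \<in> X" for i
    proof -
      have "(f i, f (Suc i)) \<in> center_adj V E D" using adj[OF that] by simp
      then obtain w where "(f i, w) \<in> E" "(w, f (Suc i)) \<in> E" unfolding center_adj_def by auto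
      then show ?thesis using tr_sym[OF s(1)] unfolding nb_def by blast
    qed
    define p where "p i = (SOME w. w \<in> nb E (f i) \<inter> nb E (f (Suc i)))" for i
    have p: "p i \<in> nb E (f i) \<inter> nb E (f (Suc i))" if "i \<in> X" "Suc i \<in> X" for i
      unfolding p_def using someI_ex[OF ex[OF that]] .
    have uniq: "w = p i" if "i \<in> X" "Suc i \<in> X" "w \<in> nb E (f i) \<inter> nb E (f (Suc i))" for i w
    proof (rule tr_common_nb_unique[OF s(1)])
      show "f i \<noteq> f (Suc i)" using inj[of i "Suc i"] that by auto
      show "(f i, w) \<in> E" "(f i, p i) \<in> E" using that p[OF that(1,2)] unfolding nb_def by auto
      show "(w, f (Suc i)) \<in> E" "(p i, f (Suc i)) \<in> E"
        using that p[OF that(1,2)] tr_sym[OF s(1)] unfolding nb_def by blast+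
    qed
    have "bij_betw p {i. i \<in> X \<and> Suc i \<in> X} ?P"
    proof (rule bij_betw_imageI)
      show "inj_on p {i. i \<in> X \<and> Suc i \<in> X}"
      \<comment> \<open>A vertex serving two consecutive pairs would have at least three
        neighbours.\<close>
      proof (rule inj_onI, clarify, rule ccontr)
        fix i j assume ij: "i \<in> X" "Suc i \<in> X" "j \<in> X" "Suc j \<in> X" "p i = p j" "i \<noteq> j"
        let ?S = "{f i, f (Suc i), f j, f (Suc j)}"
        have "?S \<subseteq> nb E (p i)"
          using p[of i] p[of j] ij tr_sym[OF s(1)] unfolding nb_def by auto
        then have "card ?S \<le> deg E (p i)" using tr_finite_nb[OF s(1)] by (intro card_mono)
        also have "\<dots> \<le> 2" using s(5) p[of i] nD[of i] ij by blast
        finally have c2: "card ?S \<le> 2" .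
        have "card (f ` {i, Suc i, j, Suc j}) = card {i, Suc i, j, Suc j}"
          using inj ij by (intro card_image inj_onI) blast
        then have "card {i, Suc i, j, Suc j} \<le> 2" using c2 by simp
        then show False using ij(6) by (auto simp: card_insert_if split: if_splits)
      qed
      show "p ` {i. i \<in> X \<and> Suc i \<in> X} = ?P"
        using p uniq nD by blast
    qed
    then show ?thesis by (rule bij_betw_same_card)
  qed
  have pt: "card {i \<in> X. w \<in> nb E (f i)} = of_bool (w \<in> ?N) + of_bool (w \<in> ?P)" if w: "w \<in> D" for w
  proof -
    let ?I = "{i \<in> X. w \<in> nb E (f i)}"
    have finI: "finite ?I" using fin by simp
    have "f ` ?I \<subseteq> nb E w" using tr_sym[OF s(1)] unfolding nb_def by blast
    then have "card (f ` ?I) \<le> deg E w" using tr_finite_nb[OF s(1)] by (intro card_mono)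
    moreover have "card (f ` ?I) = card ?I" using inj by (intro card_image inj_onI) auto
    ultimately have le: "card ?I \<le> 2" using s(5)[OF w] by linarith
    have PI: "w \<in> ?P \<Longrightarrow> card ?I \<ge> 2"
    proof -
      assume "w \<in> ?P"
      then obtain i where "{i, Suc i} \<subseteq> ?I" by auto
      from card_mono[OF finI this] show ?thesis by simp
    qed
    consider "card ?I = 0" | "card ?I = 1" | "card ?I = 2" using le by linarith
    then show ?thesis
    proof cases
      case 1
      then have "?I = {}" using finI by simp
      then have "w \<notin> ?N" "w \<notin> ?P" by auto
      then show ?thesis using 1 by simp
    next
      case 2
      then obtain i where "?I = {i}" by (auto simp: card_1_singleton_iff)
      then have "w \<in> ?N" by auto
      moreover have "w \<notin> ?P" using PI 2 by auto
      ultimately show ?thesis using 2 by simp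
    next
      case 3
      then obtain i j where ij: "?I = {i, j}" "i \<noteq> j" by (auto simp: card_2_iff)
      then have ij': "i \<in> X" "j \<in> X" "w \<in> nb E (f i)" "w \<in> nb E (f j)" by blast+
      have "(f i, f j) \<in> center_adj V E D"
        using ij' ij(2) inj[of i j] fC tr_sym[OF s(1)] unfolding center_adj_def nb_def by blast
      then have "w \<in> ?P" using adj ij' w by blast
      moreover have "w \<in> ?N" using ij' by blast
      ultimately show ?thesis using 3 by simp
    qed
  qed
  have "(\<Sum>i\<in>X. deg E (f i)) = (\<Sum>i\<in>X. \<Sum>w\<in>D. of_bool (w \<in> nb E (f i)))"
  proof (rule sum.cong)
    fix i assume "i \<in> X"
    then have "nb E (f i) = D \<inter> {w. w \<in> nb E (f i)}" using nD by auto
    then show "deg E (f i) = (\<Sum>w\<in>D. of_bool (w \<in> nb E (f i)))" using fin by (simp add: sum_of_bool_eq)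
  qed simp
  also have "\<dots> = (\<Sum>w\<in>D. \<Sum>i\<in>X. of_bool (w \<in> nb E (f i)))" by (rule sum.swap)
  also have "\<dots> = (\<Sum>w\<in>D. of_bool (w \<in> ?N) + of_bool (w \<in> ?P))"
  proof (rule sum.cong)
    fix w assume "w \<in> D"
    have "(\<Sum>i\<in>X. of_bool (w \<in> nb E (f i)) :: nat) = card (X \<inter> {i. w \<in> nb E (f i)})" using fin by (simp add: sum_of_bool_eq)
    also have "X \<inter> {i. w \<in> nb E (f i)} = {i \<in> X. w \<in> nb E (f i)}" by auto
    finally show "(\<Sum>i\<in>X. of_bool (w \<in> nb E (f i)) :: nat) = of_bool (w \<in> ?N) + of_bool (w \<in> ?P)"
      using pt[OF \<open>w \<in> D\<close>] by simp
  qed simp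
  also have "\<dots> = card (D \<inter> {w. w \<in> ?N}) + card (D \<inter> {w. w \<in> ?P})"
    unfolding sum.distrib using fin by (simp only: sum_of_bool_eq of_nat_id)
  also have "D \<inter> {w. w \<in> ?N} = ?N" using nD by blast
  also have "D \<inter> {w. w \<in> ?P} = ?P" by blast
  finally show ?thesis using cP by simp
qed

text \<open>Only the sizes of \<open>D\<close> and \<open>V - D\<close> and the degrees along the
  path occur on the right. By \<open>card_nb_union\<close> the subtraction does not truncate, as the
  union of neighbourhoods lies in \<open>D\<close>.\<close>

lemma F_formula:
  assumes st: "star_tree V E D" and f: "center_path V E D f"
  shows "F V E = (\<Sum>X\<in>Pow {..<card (V - D)}.
    2 ^ (card D + card {i. i \<in> X \<and> Suc i \<in> X} - (\<Sum>i\<in>X. deg E (f i))))"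
proof -
  note s = staticD[OF st]
  have bij: "bij_betw f {..<card (V - D)} (V - D)" using f unfolding path_order_def by auto
  have "F V E = (\<Sum>Y\<in>Pow (V - D). 2 ^ card (D - (\<Union>c\<in>Y. nb E c)))" using F_eq_sum[OF st] .
  also have "\<dots> = (\<Sum>X\<in>Pow {..<card (V - D)}. 2 ^ card (D - (\<Union>c\<in>f ` X. nb E c)))"
    by (rule sum.reindex_bij_betw[OF bij_betw_Pow[OF bij], symmetric])
  also have "\<dots> = (\<Sum>X\<in>Pow {..<card (V - D)}.
    2 ^ (card D + card {i. i \<in> X \<and> Suc i \<in> X} - (\<Sum>i\<in>X. deg E (f i))))"
  proof (rule sum.cong)
    fix X assume "X \<in> Pow {..<card (V - D)}"
    then have X: "X \<subseteq> {..<card (V - D)}" by simp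
    have finX: "finite X" using finite_subset[OF X] by simp
    have "(\<Union>i\<in>X. nb E (f i)) \<subseteq> D"
      using X bij s(3) unfolding bij_betw_def nb_def by fastforce
    moreover have "finite (\<Union>i\<in>X. nb E (f i))" using finX tr_finite_nb[OF s(1)] by blast
    ultimately have "card (D - (\<Union>i\<in>X. nb E (f i))) = card D - card (\<Union>i\<in>X. nb E (f i))"
      by (simp add: card_Diff_subset)
    then show "(2 :: nat) ^ card (D - (\<Union>c\<in>f ` X. nb E c)) =
      2 ^ (card D + card {i. i \<in> X \<and> Suc i \<in> X} - (\<Sum>i\<in>X. deg E (f i)))"
      using card_nb_union[OF st f X] by simp
  qed simp
  finally show ?thesis .
qed

definition canonical :: "'a set \<Rightarrow> ('a \<times> 'a) set \<Rightarrow> 'a set \<Rightarrow> (nat \<Rightarrow> 'a) \<Rightarrow> nat \<Rightarrow> nat \<Rightarrow> bool" where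
  "canonical V E D f k l \<longleftrightarrow> star_tree V E D \<and> center_path V E D f \<and>
     (\<forall>c\<in>V - D. deg E c = k \<or> Suc (deg E c) = k) \<and> card {c \<in> V - D. Suc (deg E c) = k} = l \<and>
     (\<forall>i<card (V - D). Suc (deg E (f i)) = k \<longrightarrow> i = 0 \<or> Suc i = card (V - D))"

text \<open>At most two light centers, all at ends, have positions determined by \<open>l\<close> up
  to reversal. For \<open>l = 1\<close> the path is reversed, if necessary, to put the light center
  first.\<close>

lemma canonical_degrees:
  assumes canonical: "canonical V E D f k l" and l: "l < card (V - D)" "l \<le> 2"
  shows "\<exists>g. center_path V E D g \<and> (\<forall>i<card (V - D).
    deg E (g i) = (if i = 0 \<and> l \<ge> 1 \<or> Suc i = card (V - D) \<and> l = 2 then k - 1 else k))"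
proof -
  let ?m = "card (V - D)"
  have f: "center_path V E D f" and bij: "bij_betw f {..<?m} (V - D)" using canonical unfolding canonical_def path_order_def by auto
  let ?L = "{i \<in> {..<?m}. Suc (deg E (f i)) = k}"
  have val: "deg E (f i) = (if i \<in> ?L then k - 1 else k)" if "i < ?m" for i
  proof -
    have "f i \<in> V - D" using bij that unfolding bij_betw_def by auto
    then have "deg E (f i) = k \<or> Suc (deg E (f i)) = k" using canonical unfolding canonical_def by blast
    then show ?thesis using that by auto
  qed
  have "f ` ?L = {c \<in> V - D. Suc (deg E c) = k}" using bij unfolding bij_betw_def by auto
  moreover have "inj_on f ?L" using bij unfolding bij_betw_def by (auto intro: inj_on_subset)
  ultimately have cL: "card ?L = l" using canonical card_image[of f ?L] unfolding canonical_def by simp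
  have L: "?L \<subseteq> {0, ?m - 1}" using canonical unfolding canonical_def by auto
  have m: "?m > 0" using l by simp
  consider "l = 0" | "l = 1" "0 \<in> ?L" | "l = 1" "0 \<notin> ?L" | "l = 2" using l by linarith
  then show ?thesis
  proof cases
    case 1
    then have "?L = {}" using cL by simp
    then have "\<forall>i<?m. deg E (f i) = (if i = 0 \<and> l \<ge> 1 \<or> Suc i = ?m \<and> l = 2 then k - 1 else k)"
      using 1 val by auto
    then show ?thesis using f by blast
  next
    case 2
    then have "?L = {0}" using cL by (metis card_1_singletonE singletonD)
    then have "\<forall>i<?m. deg E (f i) = (if i = 0 \<and> l \<ge> 1 \<or> Suc i = ?m \<and> l = 2 then k - 1 else k)"
      using 2 val by simp
    then show ?thesis using f by blast
  next
    case 3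
    obtain j where j: "?L = {j}" using cL 3 by (metis card_1_singletonE)
    then have "j = ?m - 1" using L 3 by auto
    then have jL: "?L = {?m - 1}" using j by simp
    have "deg E (f (?m - 1 - i)) = (if i = 0 \<and> l \<ge> 1 \<or> Suc i = ?m \<and> l = 2 then k - 1 else k)" if "i < ?m" for i
    proof -
      have "?m - 1 - i < ?m" using that by simp
      moreover have "?m - 1 - i = ?m - 1 \<longleftrightarrow> i = 0" using that by auto
      ultimately show ?thesis using val[of "?m - 1 - i"] 3(1) unfolding jL by simp
    qed
    then show ?thesis using path_order_rev[OF f] by blast
  next
    case 4
    have "card {0, ?m - 1} = 2" using l 4 by auto
    then have LL: "?L = {0, ?m - 1}" using L cL 4 by (intro card_subset_eq) auto
    have "\<forall>i<?m. deg E (f i) = (if i = 0 \<and> l \<ge> 1 \<or> Suc i = ?m \<and> l = 2 then k - 1 else k)"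
      using 4 m val unfolding LL by auto
    then show ?thesis using f by blast
  qed
qed

lemma canonical_F_eq:
  assumes 1: "canonical V E D f k l" and 2: "canonical V' E' D' f' k l"
    and eq: "card (V - D) = card (V' - D')" "card D = card D'" and l: "l < card (V - D)" "l \<le> 2"
  shows "F V E = F V' E'"
proof -
  obtain g where g: "center_path V E D g" "\<forall>i<card (V - D).
    deg E (g i) = (if i = 0 \<and> l \<ge> 1 \<or> Suc i = card (V - D) \<and> l = 2 then k - 1 else k)"
    using canonical_degrees[OF 1 l] by blast
  obtain g' where g': "center_path V' E' D' g'" "\<forall>i<card (V' - D').
    deg E' (g' i) = (if i = 0 \<and> l \<ge> 1 \<or> Suc i = card (V' - D') \<and> l = 2 then k - 1 else k)"
    using canonical_degrees[OF 2] l eq by auto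
  have st: "star_tree V E D" "star_tree V' E' D'" using 1 2 unfolding canonical_def by auto
  have "(\<Sum>i\<in>X. deg E (g i)) = (\<Sum>i\<in>X. deg E' (g' i))" if "X \<in> Pow {..<card (V - D)}" for X
    using that g(2) g'(2) eq(1) by (intro sum.cong) auto
  then show ?thesis
    unfolding F_formula[OF st(1) g(1)] F_formula[OF st(2) g'(1)] eq(1)[symmetric] eq(2)[symmetric]
    by (intro sum.cong) auto
qed

lemma optimal_canonical:
  assumes opt: "optimal V E a" and n: "card V < 2 * a" "3 \<le> card V"
    and k: "card V - 1 + l = (card V - a) * k" "l < card V - a" "l \<le> 2"
  shows "\<exists>D f. canonical V E D f k l \<and> card D = a"
proof -
  obtain D where D: "light_ends V E D k l" "card D = a" using optimal_light_ends[OF assms] by blast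
  then have st: "star_tree V E D" unfolding light_ends_def by auto
  have "card (V - D) > 0" using star_tree_sums(3)[OF st] D k by simp
  then have "V - D \<noteq> {}" by (metis card.empty less_irrefl)
  then show ?thesis using light_ends_center_path[OF D(1)] D unfolding canonical_def light_ends_def by blast
qed

section \<open>Graphs as records\<close>

lemma awalk_iff:
  "pre_digraph.awalk (with_proj G) u p v \<longleftrightarrow> u \<in> pverts G \<and> set p \<subseteq> parcs G \<and> pcas u p v"
  unfolding pre_digraph.awalk_def by (simp add: cas_with_proj_eq)

lemma cycle_iff:
  "pre_digraph.cycle (with_proj G) p \<longleftrightarrow>
    (\<exists>u. pre_digraph.awalk (with_proj G) u p u \<and> distinct (tl (pawalk_verts u p)) \<and> p \<noteq> [])"
  unfolding pre_digraph.cycle_def by (simp add: awalk_verts_with_proj_eq)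

lemma fst_in_pawalk_verts: "pcas c q d \<Longrightarrow> (a, b) \<in> set q \<Longrightarrow> a \<in> set (pawalk_verts c q)"
  by (induction q arbitrary: c) auto

lemma last_in_pawalk_verts: "pcas c q d \<Longrightarrow> d \<in> set (pawalk_verts c q)"
  by (induction q arbitrary: c) auto

lemma pcas_append: "pcas u (p @ q) w \<longleftrightarrow> (\<exists>v. pcas u p v \<and> pcas v q w)"
  by (induction p arbitrary: u) auto

lemma pawalk_verts_snoc: "pcas u p a \<Longrightarrow> pawalk_verts u (p @ [(a, b)]) = pawalk_verts u p @ [b]"
  by (induction p arbitrary: u) auto

lemma crossing_arc:
  assumes s: "split V E x y A EA B EB"
  shows "pcas u q v \<Longrightarrow> set q \<subseteq> E \<Longrightarrow> u \<in> B \<Longrightarrow> v \<in> A \<Longrightarrow> (y, x) \<in> set q"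
proof (induction q arbitrary: u)
  case Nil
  then show ?case using split_parts(4)[OF s] by auto
next
  case (Cons e q)
  note p = split_parts[OF s]
  obtain z where e: "e = (u, z)" "(u, z) \<in> E" "pcas z q v" using Cons.prems by (cases e) auto
  show ?case
  proof (cases "z \<in> B")
    case True
    then show ?thesis using Cons.IH[OF e(3)] Cons.prems by auto
  next
    case False
    have "(u, z) \<notin> EA" "(u, z) \<notin> EB" "(u, z) \<noteq> (x, y)"
      using tr_in[OF p(2)] tr_in[OF p(3)] p(4-6) Cons.prems(3) False by blast+
    then have "e = (y, x)" using e(1,2) unfolding p(8) by blast
    then show ?thesis by simp
  qed
qed

text \<open>When the first edge of the cycle, from \<open>u\<close> to \<open>v\<close>, is cut, the
  rest must return by the arc \<open>(v, u)\<close>. It starts at \<open>v\<close> and never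
  revisits it, so this arc comes at once. By the length, more arcs follow, and the walk meets
  \<open>u\<close> again at its end.\<close>

lemma tr_no_cycle:
  assumes t: "tr V E" and p: "set p \<subseteq> E" "pcas u p u" "distinct (tl (pawalk_verts u p))" "length p \<ge> 3"
  shows False
proof -
  obtain v q where q: "p = (u, v) # q" using p(2,4) by (cases p) auto
  have uv: "(u, v) \<in> E" and q': "set q \<subseteq> E" "pcas v q u" "distinct (pawalk_verts v q)" "length q \<ge> 2"
    using p q by auto
  obtain A EA B EB where s: "split V E u v A EA B EB" using tr_split[OF t uv] by blast
  have vu: "(v, u) \<in> set q" using crossing_arc[OF s q'(2,1)] split_parts(5,6)[OF s] by blast
  obtain e es where e: "q = e # es" using q'(4) by (cases q) auto
  have e': "fst e = v" "pcas (snd e) es u" "v \<notin> set (pawalk_verts (snd e) es)" "distinct (pawalk_verts (snd e) es)"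
    using q' e by auto
  have "(v, u) \<notin> set es" using fst_in_pawalk_verts[OF e'(2)] e'(3) by blast
  then have eu: "snd e = u" using vu e by auto
  obtain g gs where g: "es = g # gs" using q'(4) e by (cases es) auto
  have "pcas (snd g) gs u" "u \<notin> set (pawalk_verts (snd g) gs)" using e' eu g by auto
  then show False using last_in_pawalk_verts by metis
qed

lemma tr_path:
  assumes "tr V E" "x \<in> V" "y \<in> V"
  shows "\<exists>p. pcas x p y \<and> set p \<subseteq> E \<and> distinct (pawalk_verts x p) \<and> set (pawalk_verts x p) \<subseteq> V"
  using assms
proof (induction arbitrary: x y rule: tr_leaf_induct)
  case (single v)
  then show ?case by (intro exI[of _ "[]"]) auto
next
  case (leaf A EA a b)
  consider "x \<in> A" "y \<in> A" | "x \<in> A" "y = b" | "x = b" "y \<in> A" | "x = b" "y = b" using leaf.prems by blast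
  then show ?case
  proof cases
    case 1
    then show ?thesis using leaf.IH[of x y] by blast
  next
    case 2
    obtain p where p: "pcas x p a" "set p \<subseteq> EA" "distinct (pawalk_verts x p)" "set (pawalk_verts x p) \<subseteq> A"
      using leaf.IH[OF 2(1) leaf.hyps(2)] by blast
    show ?thesis
      using p 2 leaf.hyps(3) pawalk_verts_snoc[OF p(1), of b]
      by (intro exI[of _ "p @ [(a, b)]"]) (auto simp: pcas_append)
  next
    case 3
    obtain p where p: "pcas a p y" "set p \<subseteq> EA" "distinct (pawalk_verts a p)" "set (pawalk_verts a p) \<subseteq> A"
      using leaf.IH[OF leaf.hyps(2) 3(2)] by blast
    show ?thesis using p 3 leaf.hyps(3) by (intro exI[of _ "(b, a) # p"]) auto
  next
    case 4
    then show ?thesis by (intro exI[of _ "[]"]) auto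
  qed
qed

lemma connected_iff:
  assumes "pair_graph G"
  shows "Digraph_Component.connected (with_proj G) \<longleftrightarrow>
    pverts G \<noteq> {} \<and> (\<forall>u\<in>pverts G. \<forall>v\<in>pverts G. (u, v) \<in> rtrancl_on (pverts G) (parcs G))"
proof -
  interpret pair_graph G by fact
  have "parcs (mk_symmetric (with_proj G)) = parcs G"
    using adj_mk_symmetric_eq pair_sym_arcs by simp
  then show ?thesis unfolding Digraph_Component.connected_def strongly_connected_def reachable_def by simp
qed

lemma tr_graph_tree:
  assumes t: "tr (pverts G) (parcs G)"
  shows "graph_tree G"
proof -
  have pg: "pair_graph G"
  proof
    show "e \<in> parcs G \<Longrightarrow> fst e \<in> pverts G" "e \<in> parcs G \<Longrightarrow> snd e \<in> pverts G" for e
      using tr_in[OF t, of "fst e" "snd e"] by auto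
    show "finite (pverts G)" "finite (parcs G)" using tr_finite[OF t] tr_finite_arcs[OF t] by auto
    show "e \<in> parcs G \<Longrightarrow> fst e \<noteq> snd e" for e using tr_irrefl[OF t, of "fst e"] by (cases e) auto
    show "symmetric (with_proj G)" using tr_sym[OF t] by (auto simp: symmetric_def sym_def)
  qed
  have "(u, v) \<in> rtrancl_on (pverts G) (parcs G)" if u: "u \<in> pverts G" and v: "v \<in> pverts G" for u v
  proof -
    have "{v \<in> pverts G. (u, v) \<in> rtrancl_on (pverts G) (parcs G)} = pverts G"
      using tr_in[OF t] u by (intro tr_conn[OF t]) (auto intro: rtrancl_on_into_rtrancl_on)
    then show ?thesis using v by blast
  qed
  then have "Digraph_Component.connected (with_proj G)" using connected_iff[OF pg] tr_nonempty[OF t] by blast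
  moreover have "\<not> (\<exists>p. pre_digraph.cycle (with_proj G) p \<and> length p \<ge> 3)"
    unfolding cycle_iff awalk_iff using tr_no_cycle[OF t] by blast
  ultimately show ?thesis using pg unfolding graph_tree_def by blast
qed

text \<open>A largest vertex set \<open>A\<close> inducing a \<open>tr\<close> is everything: by
  connectedness an arc leaves it, and its end \<open>b\<close> has only one neighbour in
  \<open>A\<close>, since two of them together with a path in \<open>A\<close> would give a cycle of
  length at least 3. So \<open>b\<close> could be joined to \<open>A\<close>.\<close>

lemma graph_tree_tr:
  assumes g: "graph_tree G"
  shows "tr (pverts G) (parcs G)"
proof -
  let ?V = "pverts G" and ?E = "parcs G"
  have pg: "pair_graph G" and nc: "\<And>p. pre_digraph.cycle (with_proj G) p \<Longrightarrow> length p < 3"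
    using g unfolding graph_tree_def by auto
  interpret pair_graph G by (rule pg)
  have con: "?V \<noteq> {}" "\<And>u v. u \<in> ?V \<Longrightarrow> v \<in> ?V \<Longrightarrow> (u, v) \<in> rtrancl_on ?V ?E"
    using g connected_iff[OF pg] unfolding graph_tree_def by auto
  have sym: "(v, u) \<in> ?E" if "(u, v) \<in> ?E" for u v
    using arcs_symmetric that by blast
  have irr: "(v, v) \<notin> ?E" for v using pair_no_loops[of "(v, v)"] by auto
  let ?P = "\<lambda>A. A \<subseteq> ?V \<and> tr A (?E \<inter> A \<times> A)"
  obtain r where r: "r \<in> ?V" using con by blast
  have P0: "?P {r}"
  proof -
    have "?E \<inter> {r} \<times> {r} = {}" using irr by auto
    then show ?thesis using r by (simp add: tr_single)
  qed
  have bd: "\<forall>A. ?P A \<longrightarrow> card A < Suc (card ?V)"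
    using pair_finite_verts by (auto intro!: card_mono simp: less_Suc_eq_le)
  from ex_has_greatest_nat[of ?P "{r}" card "Suc (card ?V)", OF P0 bd]
  obtain A where A: "A \<subseteq> ?V" "tr A (?E \<inter> A \<times> A)" and max: "\<And>B. ?P B \<Longrightarrow> card B \<le> card A" by blast
  have "A = ?V"
  proof (rule ccontr)
    assume "A \<noteq> ?V"
    then obtain v where v: "v \<in> ?V" "v \<notin> A" using A by auto
    obtain u where u: "u \<in> A" using tr_nonempty[OF A(2)] by auto
    have "\<exists>a b. (a, b) \<in> ?E \<and> a \<in> A \<and> b \<notin> A"
    proof (rule ccontr)
      assume h: "\<not> ?thesis"
      have "(u, v) \<in> rtrancl_on ?V ?E" using con u v A by blast
      then have "v \<in> A"
        by (induction rule: rtrancl_on_induct) (use u h in auto)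
      then show False using v by simp
    qed
    then obtain a b where ab: "(a, b) \<in> ?E" "a \<in> A" "b \<notin> A" by blast
    have only: "a' = a" if a': "a' \<in> A" "(a', b) \<in> ?E" for a'
    proof (rule ccontr)
      assume ne: "a' \<noteq> a"
      obtain p where p: "pcas a' p a" "set p \<subseteq> ?E \<inter> A \<times> A" "distinct (pawalk_verts a' p)" "set (pawalk_verts a' p) \<subseteq> A"
        using tr_path[OF A(2) a'(1) ab(2)] by blast
      let ?c = "(b, a') # p @ [(a, b)]"
      have "p \<noteq> []" using p(1) ne by auto
      then have len: "length ?c \<ge> 3" by (cases p) auto
      have "b \<in> ?V" using in_arcsD2[OF ab(1)] .
      moreover have "pcas a' (p @ [(a, b)]) b"
        unfolding pcas_append using p(1) by (intro exI[of _ a]) simp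
      then have "pcas b ?c b" by simp
      moreover have "set ?c \<subseteq> ?E" using p(2) sym[OF a'(2)] ab(1) by auto
      ultimately have "pre_digraph.awalk (with_proj G) b ?c b" unfolding awalk_iff by blast
      moreover have "distinct (tl (pawalk_verts b ?c))"
        using p ab(3) pawalk_verts_snoc[OF p(1), of b] by auto
      ultimately have "pre_digraph.cycle (with_proj G) ?c" unfolding cycle_iff by blast
      then show False using nc len by fastforce
    qed
    have "tr (A \<union> {b}) ((?E \<inter> A \<times> A) \<union> {} \<union> {(a, b), (b, a)})"
      using A(2) ab by (intro tr_join) (auto intro: tr_single)
    moreover have "(?E \<inter> A \<times> A) \<union> {} \<union> {(a, b), (b, a)} = ?E \<inter> (A \<union> {b}) \<times> (A \<union> {b})"
      using ab sym[OF ab(1)] irr[of b] only sym by blast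
    ultimately have "?P (A \<union> {b})" using A(1) in_arcsD2[OF ab(1)] by simp
    then have "card (A \<union> {b}) \<le> card A" using max by blast
    then show False using ab(3) finite_subset[OF A(1) pair_finite_verts] by simp
  qed
  moreover have "?E \<inter> ?V \<times> ?V = ?E" using in_arcsD1 in_arcsD2 by auto
  ultimately show ?thesis using A(2) by simp
qed

lemma graph_tree_iff: "graph_tree G \<longleftrightarrow> tr (pverts G) (parcs G)"
  using graph_tree_tr tr_graph_tree by blast

lemma degree_eq: "degree G v = deg (parcs G) v"
proof -
  have "out_arcs (with_proj G) v = Pair v ` nb (parcs G) v"
    unfolding out_arcs_def nb_def by auto
  then show ?thesis unfolding degree_def out_degree_def by (simp add: card_image inj_on_def)
qed

lemma leaf_iff: "leaf G v \<longleftrightarrow> v \<in> pverts G \<and> deg (parcs G) v \<le> 1"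
  unfolding leaf_def degree_eq ..

lemma stable_set_iff: "stable_set G S \<longleftrightarrow> S \<in> stab (pverts G) (parcs G)"
  unfolding stable_set_def stab_def by auto

lemma num_stable_sets_eq: "num_stable_sets G = F (pverts G) (parcs G)"
  unfolding num_stable_sets_def cnt_def stable_set_iff by simp

section \<open>Distances, centers and the stability number of a tree of stars\<close>

lemma distance_walk:
  assumes t: "tr (pverts G) (parcs G)" and "u \<in> pverts G" "v \<in> pverts G"
  obtains p where "pcas u p v" "set p \<subseteq> parcs G" "length p = distance G u v"
proof -
  obtain p where "pcas u p v" "set p \<subseteq> parcs G" using tr_path[OF assms] by blast
  then have "\<exists>d p. pre_digraph.awalk (with_proj G) u p v \<and> length p = d" using assms(2) unfolding awalk_iff by blast
  then have "\<exists>p. pre_digraph.awalk (with_proj G) u p v \<and> length p = distance G u v"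
    unfolding distance_def by (rule LeastI_ex)
  then show ?thesis using that unfolding awalk_iff by blast
qed

lemma distance_le:
  assumes "u \<in> pverts G" "pcas u p v" "set p \<subseteq> parcs G"
  shows "distance G u v \<le> length p"
  unfolding distance_def using assms by (intro Least_le) (auto simp: awalk_iff)

lemma star_tree_walk_parity:
  assumes st: "star_tree V E D"
  shows "pcas u p v \<Longrightarrow> set p \<subseteq> E \<Longrightarrow> even (length p) \<longleftrightarrow> (u \<in> D \<longleftrightarrow> v \<in> D)"
proof (induction p arbitrary: u)
  case (Cons e p)
  obtain z where e: "e = (u, z)" "(u, z) \<in> E" "pcas z p v" using Cons.prems by (cases e) auto
  then show ?case using Cons.IH[OF e(3)] staticD(3)[OF st e(2)] Cons.prems by auto
qed auto

text \<open>Walks alternate between \<open>D\<close> and its complement and all leaves lie in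
  \<open>D\<close>, so distances to leaves are odd exactly from outside \<open>D\<close>.\<close>

lemma star_tree_center:
  assumes st: "star_tree (pverts T) (parcs T) D"
  shows "center T v \<longleftrightarrow> v \<in> pverts T - D"
proof -
  note s = staticD[OF st]
  have par: "even (distance T u v) \<longleftrightarrow> (u \<in> D \<longleftrightarrow> v \<in> D)" if uv: "u \<in> pverts T" "v \<in> pverts T" for u v
  proof -
    obtain p where "pcas u p v" "set p \<subseteq> parcs T" "length p = distance T u v"
      using distance_walk[OF s(1) uv] by blast
    then show ?thesis using star_tree_walk_parity[OF st] by metis
  qed
  have lD: "u \<in> D" if "leaf T u" for u using that st unfolding leaf_iff star_tree_def by blast
  \<comment> \<open>Without a leaf, all vertices would be centers vacuously.\<close>
  have ex: "\<exists>u. leaf T u"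
  proof (rule ccontr)
    assume h: "\<not> ?thesis"
    obtain r where r: "r \<in> pverts T" using tr_nonempty[OF s(1)] by blast
    show False
    proof (cases "pverts T = {r}")
      case True
      then have "parcs T = {}" using tr_singleton[of r "parcs T"] s(1) by simp
      then have "leaf T r" using r unfolding leaf_iff nb_def by simp
      then show False using h by blast
    next
      case False
      then obtain l x A EA where sp: "split (pverts T) (parcs T) x l A EA {l} {}" using tr_leaf_split[OF s(1) r] by blast
      have "nb (parcs T) l = {x}" using split_nb(4)[OF sp] by (simp add: nb_def)
      then have "leaf T l" using split_parts(7)[OF sp] unfolding leaf_iff by simp
      then show False using h by blast
    qed
  qed
  show ?thesis
  proof
    assume c: "center T v"
    obtain u where u: "leaf T u" using ex by blast
    have "u \<in> pverts T" using u unfolding leaf_iff by simp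
    then show "v \<in> pverts T - D" using c u par[of v u] lD[OF u] unfolding center_def by auto
  next
    assume "v \<in> pverts T - D"
    then show "center T v" using par lD unfolding center_def leaf_iff by auto
  qed
qed

lemma star_tree_distance_2:
  assumes st: "star_tree (pverts T) (parcs T) D" and c: "c \<in> pverts T - D" "c' \<in> pverts T - D"
  shows "distance T c c' = 2 \<longleftrightarrow> (c, c') \<in> center_adj (pverts T) (parcs T) D"
proof
  note s = staticD[OF st]
  assume d: "distance T c c' = 2"
  obtain p where p: "pcas c p c'" "set p \<subseteq> parcs T" "length p = 2"
    using distance_walk[OF s(1), of c c'] c d by auto
  then obtain e1 e2 where "p = [e1, e2]" by (auto simp: numeral_2_eq_2 length_Suc_conv)
  then obtain w where w: "(c, w) \<in> parcs T" "(w, c') \<in> parcs T" using p by (cases e1; cases e2) auto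
  have "c \<noteq> c'"
  proof
    assume "c = c'"
    then have "distance T c c' \<le> length ([] :: ('a \<times> 'a) list)"
      using c distance_le[of c T "[]" c'] by simp
    then show False using d by simp
  qed
  then show "(c, c') \<in> center_adj (pverts T) (parcs T) D" using c w unfolding center_adj_def by auto
next
  note s = staticD[OF st]
  assume "(c, c') \<in> center_adj (pverts T) (parcs T) D"
  then obtain w where w: "(c, w) \<in> parcs T" "(w, c') \<in> parcs T" "c \<noteq> c'" unfolding center_adj_def by auto
  have "distance T c c' \<le> length [(c, w), (w, c')]" using w c by (intro distance_le) auto
  then have "distance T c c' \<le> 2" by simp
  moreover obtain p where p: "pcas c p c'" "set p \<subseteq> parcs T" "length p = distance T c c'"
    using distance_walk[OF s(1), of c c'] c by auto
  have "even (distance T c c')" using star_tree_walk_parity[OF st p(1,2)] p(3) c by auto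
  moreover have "distance T c c' \<noteq> 0"
  proof
    assume "distance T c c' = 0"
    then have "p = []" using p by simp
    then show False using p(1) w(3) by simp
  qed
  ultimately show "distance T c c' = 2" by (auto simp: le_Suc_eq numeral_2_eq_2)
qed

lemma star_tree_center_tree:
  assumes st: "star_tree (pverts T) (parcs T) D"
  shows "center_tree T = \<lparr>pverts = pverts T - D, parcs = center_adj (pverts T) (parcs T) D\<rparr>"
proof -
  have "{v. center T v} = pverts T - D" using star_tree_center[OF st] by auto
  moreover have "{(u, v). center T u \<and> center T v \<and> distance T u v = 2} = center_adj (pverts T) (parcs T) D"
    using star_tree_center[OF st] star_tree_distance_2[OF st] unfolding center_adj_def by fastforce
  ultimately show ?thesis unfolding center_tree_def by simp
qed

text \<open>The centers \<open>Y\<close> in \<open>X\<close> have at least two edges each, all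
  leading to \<open>N\<close>. In the forest induced on \<open>Y\<close> and \<open>N\<close> this
  forces \<open>card Y \<le> card N\<close>, so replacing \<open>Y\<close> by \<open>N\<close>,
  which \<open>X\<close> misses, does not decrease the size and ends inside
  \<open>D\<close>.\<close>

lemma star_tree_stable_le:
  assumes st: "star_tree V E D" and X: "X \<in> stab V E"
  shows "card X \<le> card D"
proof -
  note s = staticD[OF st]
  have fin: "finite V" "finite D" "finite X" using tr_finite[OF s(1)] s(2) X finite_subset unfolding stab_def by blast+
  define Y where "Y = X - D"
  define N where "N = (\<Union>c\<in>Y. nb E c)"
  have YV: "Y \<subseteq> V - D" "finite Y" using X fin unfolding Y_def stab_def by auto
  have N: "N \<subseteq> D" using s(3) YV unfolding N_def nb_def by blast
  have NX: "N \<inter> X = {}" using X unfolding N_def Y_def nb_def stab_def by blast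
  have le: "card Y \<le> card N"
  proof (cases "Y = {}")
    case False
    let ?W = "Y \<union> N"
    have "card (E \<inter> ?W \<times> ?W) + 2 \<le> 2 * card ?W"
      using tr_inner_arcs[OF s(1), of ?W] YV N s(2) False by auto
    moreover have "card ?W = card Y + card N"
      using YV N finite_subset[OF N fin(2)] by (intro card_Un_disjoint) auto
    moreover have "4 * card Y \<le> card (E \<inter> ?W \<times> ?W)"
    proof -
      let ?S = "E \<inter> Y \<times> UNIV"
      have "2 * card Y = (\<Sum>c\<in>Y. 2)" by simp
      also have "\<dots> \<le> (\<Sum>c\<in>Y. deg E c)" using s(4) YV by (intro sum_mono) auto
      also have "\<dots> = card ?S" using YV by (intro sum_deg[OF s(1)]) auto
      finally have 1: "2 * card Y \<le> card ?S" .
      have finE: "finite E" using tr_finite_arcs[OF s(1)] .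
      have "?S \<inter> ?S\<inverse> = {}" using s(3) YV by blast
      then have "card (?S \<union> ?S\<inverse>) = card ?S + card (?S\<inverse>)" using finE by (intro card_Un_disjoint) auto
      moreover have "card (?S\<inverse>) = card ?S" by (rule card_inverse)
      moreover have "?S \<union> ?S\<inverse> \<subseteq> E \<inter> ?W \<times> ?W" using tr_sym[OF s(1)] unfolding N_def nb_def by blast
      then have "card (?S \<union> ?S\<inverse>) \<le> card (E \<inter> ?W \<times> ?W)" using finE by (intro card_mono) auto
      ultimately show ?thesis using 1 by linarith
    qed
    ultimately show ?thesis by linarith
  qed simp
  have "X = Y \<union> (X \<inter> D)" unfolding Y_def by auto
  then have "card X \<le> card Y + card (X \<inter> D)" by (metis card_Un_le)
  also have "\<dots> \<le> card N + card (D - N)" by (rule add_mono[OF le]) (use NX fin in \<open>auto intro!: card_mono\<close>)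
  also have "\<dots> = card D" using N fin by (simp add: card_Diff_subset finite_subset card_mono)
  finally show ?thesis .
qed

lemma star_tree_stability_number:
  assumes st: "star_tree (pverts G) (parcs G) D"
  shows "stability_number G = card D"
proof -
  note s = staticD[OF st]
  have "finite (stab (pverts G) (parcs G))" using finite_stab tr_finite[OF s(1)] by blast
  then show ?thesis unfolding stability_number_def stable_set_iff
    using star_tree_stable_le[OF st] s(6) by (intro Max_eqI) auto
qed

text \<open>The k-fold join of the inductive definition as a sequence of binary joins;
  \<open>j\<close> counts those already made.\<close>

lemma star_join_tr:
  fixes k j :: nat
  assumes "\<And>i. i < k \<Longrightarrow> tr (V i) (E i)" "\<And>i. i < k \<Longrightarrow> v i \<in> V i"
    "\<And>i j. i < k \<Longrightarrow> j < k \<Longrightarrow> i \<noteq> j \<Longrightarrow> V i \<inter> V j = {}" "\<And>i. i < k \<Longrightarrow> w \<notin> V i"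
  shows "j \<le> k \<Longrightarrow> tr (insert w (\<Union>i<j. V i)) (\<Union>i<j. E i \<union> {(w, v i), (v i, w)})"
proof (induction j)
  case 0
  then show ?case by (simp add: tr_single)
next
  case (Suc j)
  have "tr (insert w (\<Union>i<j. V i) \<union> V j) ((\<Union>i<j. E i \<union> {(w, v i), (v i, w)}) \<union> E j \<union> {(w, v j), (v j, w)})"
  proof (rule tr_join)
    show "tr (insert w (\<Union>i<j. V i)) (\<Union>i<j. E i \<union> {(w, v i), (v i, w)})" using Suc by simp
    show "tr (V j) (E j)" "v j \<in> V j" using assms Suc.prems by auto
    have "V i \<inter> V j = {}" if "i < j" for i using assms(3)[of i j] Suc.prems that by simp
    moreover have "w \<notin> V j" using assms(4)[of j] Suc.prems by simp
    ultimately show "insert w (\<Union>i<j. V i) \<inter> V j = {}" by blast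
  qed simp
  moreover have "insert w (\<Union>i<j. V i) \<union> V j = insert w (\<Union>i<Suc j. V i)" by (auto simp: lessThan_Suc)
  moreover have "(\<Union>i<j. E i \<union> {(w, v i), (v i, w)}) \<union> E j \<union> {(w, v j), (v j, w)} = (\<Union>i<Suc j. E i \<union> {(w, v i), (v i, w)})"
    by (auto simp: lessThan_Suc)
  ultimately show ?case by simp
qed

text \<open>The union of the sets \<open>D i\<close> serves as \<open>D\<close>: the new vertex
  \<open>w\<close> is a center of degree \<open>k\<close>, which is at least 2, and each
  \<open>v i\<close>, being a leaf, is in \<open>D i\<close> and reaches degree at most 2.\<close>

lemma tree_of_stars_star_tree: "tree_of_stars T \<Longrightarrow> \<exists>D. star_tree (pverts T) (parcs T) D"
proof (induction rule: tree_of_stars.induct)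
  case (single v)
  show ?case by (rule exI[of _ "{v}"]) (auto simp: star_tree_def tr_single nb_def)
next
  case (join k T v w)
  have "\<forall>i\<in>{..<k}. \<exists>D. star_tree (pverts (T i)) (parcs (T i)) D" using join.IH by simp
  then obtain D where D: "\<And>i. i < k \<Longrightarrow> star_tree (pverts (T i)) (parcs (T i)) (D i)"
    by (metis lessThan_iff)
  have t: "tr (pverts (T i)) (parcs (T i))" if "i < k" for i using staticD(1)[OF D[OF that]] .
  have DV: "D i \<subseteq> pverts (T i)" if "i < k" for i using staticD(2)[OF D[OF that]] .
  have vD: "v i \<in> D i" "v i \<in> pverts (T i)" if "i < k" for i
    using join.hyps(3)[OF that] D[OF that] unfolding leaf_iff star_tree_def by auto
  let ?V = "insert w (\<Union>i<k. pverts (T i))" and ?E = "\<Union>i<k. parcs (T i) \<union> {(w, v i), (v i, w)}" and ?D = "\<Union>i<k. D i"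
  have disj: "i = j" if "u \<in> pverts (T i)" "u \<in> pverts (T j)" "i < k" "j < k" for i j u
    using join.hyps(4)[OF that(3,4)] that(1,2) by blast
  have wV: "w \<notin> pverts (T i)" if "i < k" for i using join.hyps(5)[OF that] .
  have inD: "u \<in> ?D \<longleftrightarrow> u \<in> D i" if "u \<in> pverts (T i)" "i < k" for u i
    using disj[OF that(1) _ that(2)] DV that by blast
  have wD: "w \<notin> ?D" using wV DV by blast
  have tr: "tr ?V ?E" using star_join_tr[of k "\<lambda>i. pverts (T i)" "\<lambda>i. parcs (T i)" v w k] t vD wV join.hyps(4) by simp
  have bip: "x \<in> ?D \<longleftrightarrow> y \<notin> ?D" if "(x, y) \<in> ?E" for x y
  proof -
    from that obtain i where i: "i < k" "(x, y) \<in> parcs (T i) \<or> (x, y) = (w, v i) \<or> (x, y) = (v i, w)" by blast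
    have "v i \<in> ?D" using vD i(1) by blast
    moreover have ?thesis if xy: "(x, y) \<in> parcs (T i)"
      using staticD(3)[OF D[OF i(1)] xy] tr_in[OF t[OF i(1)] xy] inD i(1) by blast
    ultimately show ?thesis using i(2) wD by blast
  qed
  have nb1: "nb ?E u = nb (parcs (T i)) u" if u: "u \<in> pverts (T i)" "i < k" "u \<noteq> v i" for u i
  proof -
    have "u \<noteq> w" using wV u by auto
    moreover have "u \<noteq> v j" if "j < k" for j using disj[OF u(1) _ u(2) that] vD(2)[OF that] u(3) by blast
    moreover have "j = i" if "(u, z) \<in> parcs (T j)" "j < k" for j z
      using disj[OF u(1) _ u(2) that(2)] tr_in[OF t[OF that(2)] that(1)] by blast
    ultimately show ?thesis using u(2) unfolding nb_def by blast
  qed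
  have nb2: "nb ?E (v i) = insert w (nb (parcs (T i)) (v i))" if i: "i < k" for i
  proof -
    have "v i \<noteq> w" using wV[OF i] vD[OF i] by auto
    moreover have "v i = v j \<Longrightarrow> i = j" if "j < k" for j using disj[OF vD(2)[OF i] _ i that] vD(2)[OF that] by simp
    moreover have "j = i" if "(v i, z) \<in> parcs (T j)" "j < k" for j z
      using disj[OF vD(2)[OF i] _ i that(2)] tr_in[OF t[OF that(2)] that(1)] by blast
    ultimately show ?thesis using i unfolding nb_def by blast
  qed
  have "nb ?E w = v ` {..<k}"
  proof -
    have "(w, z) \<notin> parcs (T j)" if "j < k" for j z using tr_in[OF t[OF that]] wV[OF that] by blast
    moreover have "w \<noteq> v j" if "j < k" for j using wV[OF that] vD[OF that] by auto
    ultimately show ?thesis unfolding nb_def by blast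
  qed
  moreover have "inj_on v {..<k}" using disj vD by (intro inj_onI) (metis lessThan_iff)
  ultimately have dw: "deg ?E w = k" by (simp add: card_image)
  have leaves: "u \<in> ?D" if u: "u \<in> ?V" "deg ?E u \<le> 1" for u
  proof -
    have "u \<noteq> w" using dw u(2) join.hyps(1) by auto
    then obtain i where i: "i < k" "u \<in> pverts (T i)" using u by blast
    show ?thesis
    proof (cases "u = v i")
      case True
      then show ?thesis using vD i by blast
    next
      case False
      then have "deg (parcs (T i)) u \<le> 1" using nb1[OF i(2,1)] u(2) by simp
      then have "u \<in> D i" using D[OF i(1)] i(2) unfolding star_tree_def by blast
      then show ?thesis using i by blast
    qed
  qed
  have small: "deg ?E u \<le> 2" if u: "u \<in> ?D" for u
  proof -
    obtain i where i: "i < k" "u \<in> D i" using u by blast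
    then have uV: "u \<in> pverts (T i)" using DV by blast
    show ?thesis
    proof (cases "u = v i")
      case True
      have "deg (parcs (T i)) (v i) \<le> 1" using join.hyps(3)[OF i(1)] unfolding leaf_iff by simp
      then show ?thesis using nb2[OF i(1)] True by (simp add: card_insert_if tr_finite_nb[OF t[OF i(1)]])
    next
      case False
      then show ?thesis using nb1[OF uV i(1)] staticD(5)[OF D[OF i(1)] i(2)] by simp
    qed
  qed
  have "star_tree ?V ?E ?D"
    unfolding star_tree_def
  proof (intro conjI allI impI ballI)
    show "tr ?V ?E" by (rule tr)
    show "?D \<subseteq> ?V" using DV by blast
    show "(x \<in> ?D) = (y \<notin> ?D)" if "(x, y) \<in> ?E" for x y using bip[OF that] .
    show "u \<in> ?D" if "u \<in> ?V" "deg ?E u \<le> 1" for u using leaves[OF that] .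
    show "deg ?E u \<le> 2" if "u \<in> ?D" for u using small[OF that] .
  qed
  then show ?case by auto
qed

section \<open>The characterization\<close>

text \<open>The numbers of inner neighbours average less than 2, so some center \<open>c\<close> has
  at most one. Let \<open>w\<close> be this neighbour or, lacking it, any neighbour. Removing
  \<open>c\<close> and its other neighbours, all of them leaves, gives a smaller tree of stars with
  \<open>w\<close> as a leaf, and a join at \<open>c\<close> with single vertices restores the
  tree.\<close>

lemma star_tree_tree_of_stars: "star_tree V E D \<Longrightarrow> tree_of_stars \<lparr>pverts = V, parcs = E\<rparr>"
proof (induction "card V" arbitrary: V E D rule: less_induct)
  case less
  note st = less.prems
  note s = staticD[OF st]
  have fin: "finite V" using tr_finite[OF s(1)] .
  have fi: "finite (inner_nb E c)" for c using tr_finite_nb[OF s(1)] unfolding inner_nb_def by auto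
  show ?case
  proof (cases "card V \<ge> 2")
    case False
    moreover have "card V > 0" using fin tr_nonempty[OF s(1)] by (simp add: card_gt_0_iff)
    ultimately have "card V = 1" by linarith
    then obtain r where r: "V = {r}" by (rule card_1_singletonE)
    then have "E = {}" using tr_singleton[of r E] s(1) by simp
    then show ?thesis using r tree_of_stars.single by simp
  next
    case True
    have "\<exists>c\<in>V - D. card (inner_nb E c) \<le> 1"
    proof (rule ccontr)
      assume neg: "\<not> ?thesis"
      have "2 \<le> card (inner_nb E c)" if "c \<in> V - D" for c
      proof -
        have "\<not> card (inner_nb E c) \<le> 1" using neg that by blast
        then show ?thesis by simp
      qed
      then have "(\<Sum>c\<in>V - D. 2) \<le> (\<Sum>c\<in>V - D. card (inner_nb E c))" by (intro sum_mono)
      then show False using sum_inner_nb[OF st True] by simp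
    qed
    then obtain c where c: "c \<in> V" "c \<notin> D" "card (inner_nb E c) \<le> 1" by blast
    have dc: "deg E c \<ge> 2" using s(4)[OF c(1,2)] .
    obtain w where w: "w \<in> nb E c" "inner_nb E c \<subseteq> {w}"
    proof (cases "inner_nb E c = {}")
      case True
      have "nb E c \<noteq> {}" using dc by auto
      then show ?thesis using that True by blast
    next
      case False
      then obtain w where "w \<in> inner_nb E c" by blast
      moreover from this have "inner_nb E c \<subseteq> {w}"
        using c(3) card_le_Suc0_iff_eq[OF fi, of c] by auto
      ultimately show ?thesis using that unfolding inner_nb_def by blast
    qed
    have wE: "(w, c) \<in> E" using w(1) tr_sym[OF s(1)] unfolding nb_def by auto
    have wD: "w \<in> D" using s(3)[OF wE] c by auto
    obtain A EA B EB where sp: "split V E w c A EA B EB" using tr_split[OF s(1) wE] by blast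
    note p = split_parts[OF sp]
    define L where "L = nb E c - {w}"
    have finL: "finite L" "card L \<ge> 1" using w(1) dc tr_finite_nb[OF s(1)] unfolding L_def by auto
    have nbL: "nb EB c = L" using split_nb(4,5)[OF sp] unfolding L_def by auto
    have leafL: "nb EB l = {c}" if l: "l \<in> L" for l
    proof -
      have cl: "(c, l) \<in> EB" "(l, c) \<in> EB" using l tr_sym[OF p(3), of c l] unfolding nbL[symmetric] nb_def by auto
      have lB: "l \<in> B" "l \<noteq> c" using tr_in[OF p(3) cl(1)] cl tr_irrefl[OF p(3), of c] by auto
      have E: "(c, l) \<in> E" using cl p(8) by blast
      have "l \<in> D" using s(3)[OF E] c by auto
      then have "deg E l \<le> 2" "deg E l \<noteq> 2" using s(5) w(2) l unfolding L_def inner_nb_def by auto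
      moreover have "nb E l = nb EB l" using split_nb(6)[OF sp lB] .
      ultimately have "card (nb EB l) \<le> Suc 0" by simp
      moreover have "c \<in> nb EB l" using cl unfolding nb_def by simp
      ultimately show ?thesis using card_le_Suc0_iff_eq[OF tr_finite_nb[OF p(3), of l]] by blast
    qed
    have B: "insert c L = B" using tr_star[OF p(3,6)] leafL unfolding nbL by simp
    have EB: "EB = (\<Union>l\<in>L. {(c, l), (l, c)})"
    proof
      show "EB \<subseteq> (\<Union>l\<in>L. {(c, l), (l, c)})"
      proof
        fix e assume e: "e \<in> EB"
        obtain a b where ab: "e = (a, b)" by (cases e)
        then have "a \<in> insert c L" using tr_in[OF p(3), of a b] e B by simp
        moreover have "b \<in> nb EB a" using e ab unfolding nb_def by simp
        ultimately show "e \<in> (\<Union>l\<in>L. {(c, l), (l, c)})" using nbL leafL[of a] ab by auto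
      qed
      show "(\<Union>l\<in>L. {(c, l), (l, c)}) \<subseteq> EB"
        using tr_sym[OF p(3)] unfolding nbL[symmetric] nb_def by blast
    qed
    have cL: "c \<notin> L" using nbL tr_irrefl[OF p(3), of c] unfolding nb_def by auto
    have "star_tree A EA (D \<inter> A)"
      unfolding star_tree_def
    proof (intro conjI allI impI ballI)
      show "tr A EA" "D \<inter> A \<subseteq> A" using p(2) by auto
      show "(x \<in> D \<inter> A) = (y \<notin> D \<inter> A)" if xy: "(x, y) \<in> EA" for x y
      proof -
        have "(x, y) \<in> E" using xy p(8) by blast
        then show ?thesis using s(3)[of x y] tr_in[OF p(2) xy] by auto
      qed
      show "v \<in> D \<inter> A" if v: "v \<in> A" "deg EA v \<le> 1" for v
      proof (cases "v = w")
        case False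
        then have "deg E v \<le> 1" using split_deg(2)[OF sp v(1)] v(2) by simp
        then show ?thesis using v(1) st p(7) unfolding star_tree_def by blast
      qed (use v wD in auto)
      show "deg EA v \<le> 2" if "v \<in> D \<inter> A" for v
        using that split_deg(1)[OF sp] split_deg(2)[OF sp, of v] s(5)[of v] by (cases "v = w") auto
    qed
    then have TA: "tree_of_stars \<lparr>pverts = A, parcs = EA\<rparr>" using less.hyps split_card(2)[OF sp] by blast
    have lw: "leaf \<lparr>pverts = A, parcs = EA\<rparr> w"
      using split_deg(1)[OF sp] s(5)[OF wD] p(5) unfolding leaf_iff by simp
    obtain g where g: "bij_betw g {..<card L} L"
      using ex_bij_betw_nat_finite[OF finL(1)] unfolding lessThan_atLeast0 by blast
    \<comment> \<open>Index 0 stands for the remaining tree, the successors for the leaves at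
      \<open>c\<close>.\<close>
    define v where "v i = (case i of 0 \<Rightarrow> w | Suc j \<Rightarrow> g j)" for i
    define T where "T i = (case i of 0 \<Rightarrow> \<lparr>pverts = A, parcs = EA\<rparr> | Suc j \<Rightarrow> \<lparr>pverts = {g j}, parcs = {}\<rparr>)" for i
    have gL: "g ` {..<card L} = L" "g j \<in> L" "g i = g j \<longleftrightarrow> i = j" if "i < card L" "j < card L" for i j
      using g that unfolding bij_betw_def inj_on_def by auto
    have gim: "g ` {..<card L} = L" using g unfolding bij_betw_def by auto
    have LA: "l \<notin> A" if "l \<in> L" for l using that B p(4) by blast
    have "tree_of_stars \<lparr>pverts = insert c (\<Union>i<Suc (card L). pverts (T i)),
          parcs = (\<Union>i<Suc (card L). parcs (T i) \<union> {(c, v i), (v i, c)})\<rparr>"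
    proof (rule tree_of_stars.join)
      show "2 \<le> Suc (card L)" using finL by simp
      show "tree_of_stars (T i)" if "i < Suc (card L)" for i
        using TA tree_of_stars.single unfolding T_def by (cases i) auto
      show "leaf (T i) (v i)" if "i < Suc (card L)" for i
        using lw unfolding T_def v_def by (cases i) (auto simp: leaf_iff nb_def)
      show "pverts (T i) \<inter> pverts (T j) = {}" if "i < Suc (card L)" "j < Suc (card L)" "i \<noteq> j" for i j
        using that LA gL(2) gL(3) unfolding T_def by (cases i; cases j) auto
      show "c \<notin> pverts (T i)" if "i < Suc (card L)" for i
        using that p(4,6) cL gL(2) unfolding T_def by (cases i) auto
    qed
    moreover have "insert c (\<Union>i<Suc (card L). pverts (T i)) = V"
    proof -
      have "(\<Union>i<Suc (card L). pverts (T i)) = A \<union> g ` {..<card L}"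
        unfolding lessThan_Suc_eq_insert_0 T_def by auto
      then show ?thesis unfolding gim p(7) B[symmetric] by auto
    qed
    moreover have "(\<Union>i<Suc (card L). parcs (T i) \<union> {(c, v i), (v i, c)}) = E"
    proof -
      have "(\<Union>i<Suc (card L). parcs (T i) \<union> {(c, v i), (v i, c)}) =
          EA \<union> {(c, w), (w, c)} \<union> (\<Union>l\<in>g ` {..<card L}. {(c, l), (l, c)})"
        unfolding lessThan_Suc_eq_insert_0 T_def v_def by auto
      then show ?thesis unfolding gim p(8) EB by auto
    qed
    ultimately show ?thesis by simp
  qed
qed

section \<open>Isomorphisms between the center-tree and a path; light centers\<close>

lemma iso_center_path:
  assumes st: "star_tree (pverts T) (parcs T) D" and iso: "graph_isomorphism hom (center_tree T) (path_graph k)"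
  shows "k = card (pverts T - D)" "bij_betw (iso_verts hom) (pverts T - D) {..<k}"
    "center_path (pverts T) (parcs T) D (the_inv_into (pverts T - D) (iso_verts hom))"
proof -
  let ?C = "pverts T - D" and ?A = "center_adj (pverts T) (parcs T) D" and ?h = "iso_verts hom"
  let ?f = "the_inv_into ?C ?h"
  have ct: "pverts (center_tree T) = ?C" "parcs (center_tree T) = ?A" using star_tree_center_tree[OF st] by auto
  have d: "pre_digraph.digraph_isomorphism (with_proj (center_tree T)) hom"
    and eq: "with_proj (path_graph k) = app_iso hom (with_proj (center_tree T))"
    using iso unfolding graph_isomorphism_def by auto
  have inj: "inj_on ?h ?C"
    using d unfolding pre_digraph.digraph_isomorphism_def by (simp add: ct)
  have ends: "?h (fst e) = iso_tail hom (iso_arcs hom e)" "?h (snd e) = iso_head hom (iso_arcs hom e)" if "e \<in> ?A" for e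
    using d that unfolding pre_digraph.digraph_isomorphism_def by (auto simp: ct)
  have "verts (with_proj (path_graph k)) = ?h ` ?C" "arcs (with_proj (path_graph k)) = iso_arcs hom ` ?A"
    "tail (with_proj (path_graph k)) = iso_tail hom" "head (with_proj (path_graph k)) = iso_head hom"
    unfolding eq by (simp_all add: ct)
  then have im: "?h ` ?C = {..<k}" and arcs: "parcs (path_graph k) = iso_arcs hom ` ?A"
    and th: "fst = iso_tail hom" "snd = iso_head hom" by (auto simp: path_graph_def)
  have arc: "iso_arcs hom (u, v) = (?h u, ?h v)" if "(u, v) \<in> ?A" for u v
    using ends[OF that] unfolding th[symmetric] by (simp add: prod_eq_iff)
  show bij: "bij_betw ?h ?C {..<k}" using inj im unfolding bij_betw_def by blast
  then show k: "k = card ?C" using bij_betw_same_card by fastforce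
  have fb: "bij_betw ?f {..<k} ?C" using bij_betw_the_inv_into[OF bij] .
  have hf: "?h (?f i) = i" "?f i \<in> ?C" if "i < k" for i
    using f_the_inv_into_f_bij_betw[OF bij] fb that unfolding bij_betw_def by auto
  have fh: "?f (?h c) = c" if "c \<in> ?C" for c using the_inv_into_f_f[OF inj that] .
  have "(?f i, ?f j) \<in> ?A \<longleftrightarrow> (j = Suc i \<or> i = Suc j)" if ij: "i < k" "j < k" for i j
  proof -
    have "(?f i, ?f j) \<in> ?A \<longleftrightarrow> (i, j) \<in> parcs (path_graph k)"
    proof
      assume a: "(?f i, ?f j) \<in> ?A"
      then have "iso_arcs hom (?f i, ?f j) \<in> parcs (path_graph k)" unfolding arcs by (rule imageI)
      moreover have "iso_arcs hom (?f i, ?f j) = (i, j)" using arc[OF a] hf ij by simp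
      ultimately show "(i, j) \<in> parcs (path_graph k)" by simp
    next
      assume "(i, j) \<in> parcs (path_graph k)"
      then obtain u v where uv: "(u, v) \<in> ?A" "(i, j) = iso_arcs hom (u, v)" unfolding arcs by auto
      then have "i = ?h u" "j = ?h v" "u \<in> ?C" "v \<in> ?C" using arc unfolding center_adj_def by auto
      then show "(?f i, ?f j) \<in> ?A" using fh uv by simp
    qed
    then show ?thesis using ij unfolding path_graph_def by auto
  qed
  then show "center_path (pverts T) (parcs T) D ?f" using fb unfolding path_order_def k by blast
qed

lemma center_path_iso:
  assumes st: "star_tree (pverts T) (parcs T) D" and f: "center_path (pverts T) (parcs T) D f"
  shows "\<exists>hom. graph_isomorphism hom (center_tree T) (path_graph (card (pverts T - D))) \<and>
    (\<forall>i<card (pverts T - D). iso_verts hom (f i) = i)"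
proof -
  let ?C = "pverts T - D" and ?A = "center_adj (pverts T) (parcs T) D" and ?k = "card (pverts T - D)"
  have bij: "bij_betw f {..<?k} ?C" using f unfolding path_order_def by blast
  then have inj: "inj_on f {..<?k}" unfolding bij_betw_def by blast
  let ?h = "the_inv_into {..<?k} f"
  let ?hom = "\<lparr>iso_verts = ?h, iso_arcs = (\<lambda>(u, v). (?h u, ?h v)), iso_head = snd, iso_tail = fst\<rparr>"
  have hb: "bij_betw ?h ?C {..<?k}" using bij_betw_the_inv_into[OF bij] .
  have hf: "?h (f i) = i" if "i < ?k" for i using the_inv_into_f_f[OF inj] that by simp
  have fh: "f (?h c) = c" "?h c < ?k" if "c \<in> ?C" for c
    using f_the_inv_into_f_bij_betw[OF bij] hb that unfolding bij_betw_def by auto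
  have ct: "pverts (center_tree T) = ?C" "parcs (center_tree T) = ?A" using star_tree_center_tree[OF st] by auto
  have AC: "?A \<subseteq> ?C \<times> ?C" unfolding center_adj_def by auto
  have fst_snd: "fst e \<in> ?C" "snd e \<in> ?C" if "e \<in> ?A" for e using AC that by auto
  have hinj: "inj_on ?h ?C" using hb unfolding bij_betw_def by blast
  have "wf_digraph (with_proj (center_tree T))"
    by unfold_locales (auto simp: ct dest: fst_snd)
  moreover have "inj_on (\<lambda>(u, v). (?h u, ?h v)) ?A"
  proof (rule inj_onI)
    fix a b assume ab: "a \<in> ?A" "b \<in> ?A" "(case a of (u, v) \<Rightarrow> (?h u, ?h v)) = (case b of (u, v) \<Rightarrow> (?h u, ?h v))"
    then have "?h (fst a) = ?h (fst b)" "?h (snd a) = ?h (snd b)" by (auto simp: case_prod_beta)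
    then show "a = b" using inj_onD[OF hinj] fst_snd ab(1,2) by (simp add: prod_eq_iff)
  qed
  ultimately have "pre_digraph.digraph_isomorphism (with_proj (center_tree T)) ?hom"
    unfolding pre_digraph.digraph_isomorphism_def using hinj by (auto simp: ct)
  moreover have "with_proj (path_graph ?k) = app_iso ?hom (with_proj (center_tree T))"
  proof (rule pre_digraph.equality)
    show "verts (with_proj (path_graph ?k)) = verts (app_iso ?hom (with_proj (center_tree T)))"
      using hb unfolding bij_betw_def by (simp add: ct path_graph_def)
    show "arcs (with_proj (path_graph ?k)) = arcs (app_iso ?hom (with_proj (center_tree T)))"
    proof -
      have adj: "(f i, f j) \<in> ?A \<longleftrightarrow> (j = Suc i \<or> i = Suc j)" if "i < ?k" "j < ?k" for i j
        using f that unfolding path_order_def by blast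
      have "parcs (path_graph ?k) = (\<lambda>(u, v). (?h u, ?h v)) ` ?A"
      proof (intro equalityI subsetI)
        fix e assume "e \<in> parcs (path_graph ?k)"
        then obtain i j where e: "e = (i, j)" "i < ?k" "j < ?k" "j = Suc i \<or> i = Suc j" unfolding path_graph_def by auto
        then have "(f i, f j) \<in> ?A" using adj by blast
        moreover have "e = (\<lambda>(u, v). (?h u, ?h v)) (f i, f j)" using e hf by simp
        ultimately show "e \<in> (\<lambda>(u, v). (?h u, ?h v)) ` ?A" by (rule rev_image_eqI)
      next
        fix e assume "e \<in> (\<lambda>(u, v). (?h u, ?h v)) ` ?A"
        then obtain u v where uv: "(u, v) \<in> ?A" "e = (?h u, ?h v)" by auto
        then have C: "u \<in> ?C" "v \<in> ?C" using AC by auto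
        then have "?h v = Suc (?h u) \<or> ?h u = Suc (?h v)" using adj[of "?h u" "?h v"] fh uv by simp
        then show "e \<in> parcs (path_graph ?k)" using fh C uv unfolding path_graph_def by simp
      qed
      then show ?thesis by (simp add: ct)
    qed
  qed simp_all
  ultimately have "graph_isomorphism ?hom (center_tree T) (path_graph ?k)" unfolding graph_isomorphism_def by blast
  then show ?thesis using hf by (intro exI[of _ ?hom]) simp
qed

text \<open>\<open>n - 1\<close> is the sum of the degrees of the \<open>n - a\<close> centers. The
  equation brings it into the form used by \<open>balanced_values\<close>, with the quotient rounded
  up as \<open>k\<close>, the heavy degree.\<close>

lemma light_count_eq:
  assumes "a < n"
  shows "\<exists>k. n - 1 + light_count n a = (n - a) * k" "light_count n a < n - a"
proof -
  let ?m = "n - a" let ?r = "(n - 1) mod ?m" let ?q = "(n - 1) div ?m"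
  have e: "n - 1 = ?m * ?q + ?r" by simp
  have m: "?m > 0" using assms by simp
  then have r: "?r < ?m" by simp
  have "(\<exists>k. n - 1 + light_count n a = ?m * k) \<and> light_count n a < ?m"
  proof (cases "?r = 0")
    case True
    then have "light_count n a = 0" unfolding light_count_def heavy_count_def by simp
    then show ?thesis using True e m by (metis add.right_neutral)
  next
    case False
    then have l: "light_count n a = ?m - ?r" unfolding light_count_def heavy_count_def by simp
    have "n - 1 + (?m - ?r) = ?m * ?q + ?m" using e r by linarith
    also have "\<dots> = ?m * Suc ?q" by simp
    finally have "n - 1 + light_count n a = ?m * Suc ?q" unfolding l .
    moreover have "light_count n a < ?m" unfolding l using False m by (intro diff_less) auto
    ultimately show ?thesis by blast
  qed
  then show "\<exists>k. n - 1 + light_count n a = ?m * k" "light_count n a < ?m" by blast+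
qed

lemma light_center_iff:
  assumes st: "star_tree (pverts T) (parcs T) D" and n: "card (pverts T) = n" "stability_number T = a" "a < n"
    and k: "n - 1 + l = (n - a) * k" "l < n - a"
  shows "light_center T v \<longleftrightarrow> v \<in> pverts T - D \<and> Suc (deg (parcs T) v) = k"
proof -
  have m: "real n - real a > 0" using n(3) by simp
  have "real (n - 1 + l) = real ((n - a) * k)" using k(1) by simp
  then have "real n - 1 + real l = (real n - real a) * real k" using n(3) by (simp add: of_nat_diff)
  then have e: "real n - 1 = (real n - real a) * real k - real l" by simp
  have "(real n - 1) / (real n - real a) = real k - real l / (real n - real a)"
    unfolding e using m by (simp add: field_simps)
  moreover have "l + a < n" using k(2) by simp
  then have "real l < real n - real a" by linarith
  then have "real l / (real n - real a) < 1" using m by simp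
  moreover have "0 \<le> real l / (real n - real a)" using m by simp
  ultimately have "\<lceil>(real n - 1) / (real n - real a)\<rceil> = int k" by (intro ceiling_unique) auto
  then show ?thesis unfolding light_center_def star_tree_center[OF st] degree_eq n by auto
qed

lemma tr_no_full_stable:
  assumes "tr V E" "card V \<ge> 2" "S \<in> stab V E"
  shows "card S < card V"
proof -
  obtain v where v: "v \<in> V" using tr_nonempty[OF assms(1)] by blast
  have "nb E v \<noteq> {}" using tr_deg_pos[OF assms(1) v assms(2)] by auto
  then obtain u where "(v, u) \<in> E" unfolding nb_def by blast
  then have "S \<subset> V" using assms(3) tr_in[OF assms(1)] unfolding stab_def by blast
  then show ?thesis using tr_finite[OF assms(1)] by (intro psubset_card_mono)
qed

lemma stability_number_stab:
  assumes "tr (pverts G) (parcs G)"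
  shows "\<exists>S\<in>stab (pverts G) (parcs G). card S = stability_number G"
    "S \<in> stab (pverts G) (parcs G) \<Longrightarrow> card S \<le> stability_number G"
proof -
  have fin: "finite (stab (pverts G) (parcs G))" using finite_stab tr_finite[OF assms] by blast
  have eq: "stability_number G = Max (card ` stab (pverts G) (parcs G))"
    unfolding stability_number_def stable_set_iff by simp
  have "stab (pverts G) (parcs G) \<noteq> {}" using empty_stab by blast
  then have "stability_number G \<in> card ` stab (pverts G) (parcs G)"
    unfolding eq using fin by (intro Max_in) auto
  then show "\<exists>S\<in>stab (pverts G) (parcs G). card S = stability_number G" by auto
  show "S \<in> stab (pverts G) (parcs G) \<Longrightarrow> card S \<le> stability_number G"
    unfolding eq using fin by (intro Max_ge) auto
qed

lemma ex_optimal: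
  assumes "tr (V :: 'a set) E" "has_stable V E a"
  shows "\<exists>V' E'. optimal (V' :: 'a set) E' a \<and> card V' = card V"
proof -
  let ?Q = "\<lambda>p :: 'a set \<times> ('a \<times> 'a) set. tr (fst p) (snd p) \<and> card (fst p) = card V \<and> has_stable (fst p) (snd p) a"
  have "?Q (V, E)" using assms by simp
  from ex_has_least_nat[of ?Q, OF this, of "\<lambda>p. F (fst p) (snd p)"]
  obtain p where p: "?Q p" and min: "\<And>q. ?Q q \<Longrightarrow> F (fst p) (snd p) \<le> F (fst q) (snd q)" by blast
  have "F (fst p) (snd p) \<le> F V' E'"
    if "tr V' E'" "card V' = card (fst p)" "has_stable V' E' a" for V' :: "'a set" and E'
    using min[of "(V', E')"] that p by simp
  then have "optimal (fst p) (snd p) a" using p unfolding optimal_def by blast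
  then show ?thesis using p by blast
qed

text \<open>With fewer than 3 vertices, \<alpha> > n/2 leaves only this tree. It has no center, and
  its center-tree is the path without vertices.\<close>

lemma single_vertex_extremal:
  fixes T :: "'a pair_pre_digraph"
  assumes t: "tr (pverts T) (parcs T)" and n: "card (pverts T) = 1"
  shows "extremal T"
    "balanced_tree_of_stars T \<and>
    (\<exists>k hom. graph_isomorphism hom (center_tree T) (path_graph k) \<and>
       (\<forall>v. light_center T v \<longrightarrow> path_endpoint k (iso_verts hom v)))"
proof -
  have single: "\<exists>v. G = \<lparr>pverts = {v}, parcs = {}\<rparr>" if G: "tr (pverts G) (parcs G)" "card (pverts G) = 1"
    for G :: "'a pair_pre_digraph"
  proof -
    obtain v where v: "pverts G = {v}" by (rule card_1_singletonE[OF G(2)])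
    then have "parcs G = {}" using tr_singleton[of v "parcs G"] G(1) by simp
    then show ?thesis using v by (intro exI[of _ v]) simp
  qed
  obtain v where T: "T = \<lparr>pverts = {v}, parcs = {}\<rparr>" using single[OF t n] by blast
  show "extremal T"
    unfolding extremal_def
  proof (intro conjI allI impI)
    show "graph_tree T" using t graph_tree_iff by blast
    fix T' :: "'a pair_pre_digraph"
    assume "graph_tree T' \<and> card (pverts T') = card (pverts T) \<and> stability_number T' = stability_number T"
    then obtain v' where "T' = \<lparr>pverts = {v'}, parcs = {}\<rparr>" using single[of T'] n graph_tree_iff by auto
    then show "num_stable_sets T \<le> num_stable_sets T'" unfolding num_stable_sets_eq T by simp
  qed
  have st: "star_tree (pverts T) (parcs T) {v}" unfolding T by (auto simp: star_tree_def tr_single nb_def)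
  have cen: "\<not> center T u" for u using star_tree_center[OF st] unfolding T by simp
  have "balanced_tree_of_stars T"
    unfolding balanced_tree_of_stars_def using cen tree_of_stars.single[of v] T by simp
  moreover have "center_path (pverts T) (parcs T) {v} (\<lambda>_. v)"
    unfolding path_order_def T by (simp add: bij_betw_def)
  then obtain hom where "graph_isomorphism hom (center_tree T) (path_graph (card (pverts T - {v})))"
    using center_path_iso[OF st] by blast
  moreover have "\<not> light_center T u" for u using cen unfolding light_center_def by blast
  ultimately show "balanced_tree_of_stars T \<and>
    (\<exists>k hom. graph_isomorphism hom (center_tree T) (path_graph k) \<and>
       (\<forall>v. light_center T v \<longrightarrow> path_endpoint k (iso_verts hom v)))" by blast
qed

theorem theorem3:
  fixes T :: "'a pair_pre_digraph" and n \<alpha> :: nat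
  assumes "graph_tree T"
    and "card (pverts T) = n"
    and "stability_number T = \<alpha>"
    and "real \<alpha> > real n / 2"
    and "light_count n \<alpha> \<le> 2"
  shows "extremal T \<longleftrightarrow>
    balanced_tree_of_stars T \<and>
    (\<exists>k hom. graph_isomorphism hom (center_tree T) (path_graph k) \<and>
       (\<forall>v. light_center T v \<longrightarrow> path_endpoint k (iso_verts hom v)))"
proof (cases "n = 1")
  case True
  then show ?thesis using single_vertex_extremal[of T] assms(1,2) graph_tree_iff by blast
next
  case False
  let ?V = "pverts T" and ?E = "parcs T" and ?l = "light_count n \<alpha>"
  have t: "tr ?V ?E" using graph_tree_tr[OF assms(1)] .
  have "n > 0" using assms(2) tr_finite[OF t] tr_nonempty[OF t] by (auto simp: card_gt_0_iff)
  then have n2: "card ?V \<ge> 2" using False assms(2) by simp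
  have na: "n < 2 * \<alpha>" using assms(4) by linarith
  obtain S where S: "S \<in> stab ?V ?E" "card S = \<alpha>" using stability_number_stab(1)[OF t] assms(3) by blast
  have an: "\<alpha> < n" using tr_no_full_stable[OF t n2 S(1)] S(2) assms(2) by simp
  have n3: "3 \<le> n" using na an by linarith
  have hs: "has_stable ?V ?E \<alpha>" using S unfolding has_stable_def by auto
  obtain k where k: "n - 1 + ?l = (n - \<alpha>) * k" using light_count_eq(1)[OF an] by blast
  note l = light_count_eq(2)[OF an]
  have opt_canonical: "\<exists>D f. canonical V E D f k ?l \<and> card D = \<alpha>" if "optimal V E \<alpha>" "card V = n" for V :: "'a set" and E
    using optimal_canonical[OF that(1), of ?l k] that(2) na n3 k l assms(5) by simp
  \<comment> \<open>A reference tree for both directions: an extremal \<open>T\<close> has at most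
    its number of stable sets, and a \<open>T\<close> with the three properties has the same
    number.\<close>
  obtain V0 :: "'a set" and E0 where opt0: "optimal V0 E0 \<alpha>" "card V0 = n"
    using ex_optimal[OF t hs] assms(2) by blast
  obtain D0 f0 where nice0: "canonical V0 E0 D0 f0 k ?l" "card D0 = \<alpha>" using opt_canonical[OF opt0] by blast
  have st0: "star_tree V0 E0 D0" using nice0 unfolding canonical_def by blast
  have light: "light_center T v \<longleftrightarrow> v \<in> ?V - D \<and> Suc (deg ?E v) = k" if "star_tree ?V ?E D" for D v
    using light_center_iff[OF that assms(2,3) an k l] .
  show ?thesis
  proof
    assume ext: "extremal T"
    have le0: "F ?V ?E \<le> F V0 E0"
    proof -
      \<comment> \<open>Extremality only speaks about trees with stability number exactly \<alpha>.
        The reference tree is a tree of stars, so its stability number is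
        \<open>card D0\<close>.\<close>
      let ?T0 = "\<lparr>pverts = V0, parcs = E0\<rparr>"
      have "graph_tree ?T0" using tr_graph_tree[of ?T0] staticD(1)[OF st0] by simp
      moreover have "stability_number ?T0 = \<alpha>" using star_tree_stability_number[of ?T0 D0] st0 nice0(2) by simp
      ultimately have "num_stable_sets T \<le> num_stable_sets ?T0"
        using ext assms(2,3) opt0(2) unfolding extremal_def by simp
      then show ?thesis unfolding num_stable_sets_eq by simp
    qed
    have "F ?V ?E \<le> F V' E'" if "tr V' E'" "card V' = card ?V" "has_stable V' E' \<alpha>" for V' :: "'a set" and E'
    proof -
      have "F V0 E0 \<le> F V' E'" using opt0 that assms(2) unfolding optimal_def by simp
      then show ?thesis using le0 by simp
    qed
    then have "optimal ?V ?E \<alpha>" using t hs unfolding optimal_def by blast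
    then obtain D f where canonical: "canonical ?V ?E D f k ?l" using opt_canonical assms(2) by blast
    have st: "star_tree ?V ?E D" and f: "center_path ?V ?E D f"
      and val: "\<And>c. c \<in> ?V - D \<Longrightarrow> deg ?E c = k \<or> Suc (deg ?E c) = k"
      and ends: "\<And>i. i < card (?V - D) \<Longrightarrow> Suc (deg ?E (f i)) = k \<Longrightarrow> i = 0 \<or> Suc i = card (?V - D)"
      using canonical unfolding canonical_def by blast+
    have "\<lparr>pverts = ?V, parcs = ?E\<rparr> = T" by (cases T) simp
    then have "tree_of_stars T" using star_tree_tree_of_stars[OF st] by metis
    moreover have "\<bar>int (degree T u) - int (degree T v)\<bar> \<le> 1" if "center T u" "center T v" for u v
    proof -
      have "u \<in> ?V - D" "v \<in> ?V - D" using that star_tree_center[OF st] by auto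
      then show ?thesis using val[of u] val[of v] unfolding degree_eq by linarith
    qed
    ultimately have "balanced_tree_of_stars T" unfolding balanced_tree_of_stars_def by blast
    moreover obtain hom where hom: "graph_isomorphism hom (center_tree T) (path_graph (card (?V - D)))"
      "\<And>i. i < card (?V - D) \<Longrightarrow> iso_verts hom (f i) = i"
      using center_path_iso[OF st f] by blast
    moreover have "path_endpoint (card (?V - D)) (iso_verts hom v)" if "light_center T v" for v
    proof -
      have v: "v \<in> ?V - D" "Suc (deg ?E v) = k" using that light[OF st] by auto
      have "v \<in> f ` {..<card (?V - D)}" using f v(1) unfolding path_order_def bij_betw_def by simp
      then obtain i where i: "i < card (?V - D)" "v = f i" by blast
      then show ?thesis using ends[OF i(1)] v(2) hom(2)[OF i(1)] unfolding path_endpoint_def by auto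
    qed
    ultimately show "balanced_tree_of_stars T \<and>
      (\<exists>k hom. graph_isomorphism hom (center_tree T) (path_graph k) \<and>
        (\<forall>v. light_center T v \<longrightarrow> path_endpoint k (iso_verts hom v)))" by blast
  next
    assume "balanced_tree_of_stars T \<and>
      (\<exists>k hom. graph_isomorphism hom (center_tree T) (path_graph k) \<and>
        (\<forall>v. light_center T v \<longrightarrow> path_endpoint k (iso_verts hom v)))"
    then obtain p hom where bal: "balanced_tree_of_stars T"
      and iso: "graph_isomorphism hom (center_tree T) (path_graph p)"
      and ends: "\<And>v. light_center T v \<Longrightarrow> path_endpoint p (iso_verts hom v)" by blast
    obtain D where st: "star_tree ?V ?E D" using tree_of_stars_star_tree bal unfolding balanced_tree_of_stars_def by blast
    have cD: "card D = \<alpha>" using star_tree_stability_number[OF st] assms(3) by simp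
    let ?C = "?V - D" and ?f = "the_inv_into (?V - D) (iso_verts hom)"
    note cp = iso_center_path[OF st iso]
    have cC: "card ?C = n - \<alpha>" using star_tree_sums(3)[OF st] cD assms(2) by simp
    have finC: "finite ?C" using tr_finite[OF t] by simp
    have "?C \<noteq> {}" using cC an by (metis card.empty zero_less_diff less_irrefl)
    then obtain c0 where c0: "c0 \<in> ?C" "\<And>v. v \<in> ?C \<Longrightarrow> deg ?E c0 \<le> deg ?E v"
      using arg_min_if_finite(1)[OF finC, of "deg ?E"] arg_min_least[OF finC, of _ "deg ?E"] by blast
    have b: "deg ?E c0 \<le> deg ?E c \<and> deg ?E c \<le> deg ?E c0 + 1" if c: "c \<in> ?C" for c
    proof -
      have "\<bar>int (degree T c) - int (degree T c0)\<bar> \<le> 1"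
        using bal c c0(1) star_tree_center[OF st] unfolding balanced_tree_of_stars_def by blast
      then show ?thesis using c0(2)[OF c] unfolding degree_eq by linarith
    qed
    have sum: "(\<Sum>c\<in>?C. deg ?E c) + ?l = card ?C * k" using star_tree_sums(1)[OF st] k cC assms(2) by simp
    have lC: "?l < card ?C" using l cC by simp
    note bv = balanced_values[OF finC sum lC b c0(1) refl]
    have "i = 0 \<or> Suc i = card ?C" if i: "i < card ?C" "Suc (deg ?E (?f i)) = k" for i
    proof -
      have ip: "i \<in> {..<p}" using i(1) cp(1) by simp
      have fi: "?f i \<in> ?C" "iso_verts hom (?f i) = i"
        using bij_betw_the_inv_into[OF cp(2)] f_the_inv_into_f_bij_betw[OF cp(2), of i] ip unfolding bij_betw_def by auto
      then have "light_center T (?f i)" using light[OF st] i(2) by blast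
      then show ?thesis using ends[of "?f i"] fi(2) cp(1) unfolding path_endpoint_def by auto
    qed
    then have canonical: "canonical ?V ?E D ?f k ?l" unfolding canonical_def using st cp(3) bv(1,2) by blast
    have "card (V0 - D0) = n - \<alpha>" using star_tree_sums(3)[OF st0] nice0(2) opt0(2) by simp
    then have eq: "F ?V ?E = F V0 E0"
      using canonical_F_eq[OF canonical nice0(1)] cC cD nice0(2) lC assms(5) by simp
    show "extremal T"
      unfolding extremal_def
    proof (intro conjI allI impI)
      show "graph_tree T" by (rule assms(1))
      fix T' :: "'a pair_pre_digraph"
      assume T': "graph_tree T' \<and> card (pverts T') = card (pverts T) \<and> stability_number T' = stability_number T"
      have t': "tr (pverts T') (parcs T')" using T' graph_tree_tr by blast
      obtain S' where "S' \<in> stab (pverts T') (parcs T')" "card S' = \<alpha>"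
        using stability_number_stab(1)[OF t'] T' assms(3) by auto
      then have "has_stable (pverts T') (parcs T') \<alpha>" unfolding has_stable_def by blast
      then have "F V0 E0 \<le> F (pverts T') (parcs T')"
        using opt0 t' T' assms(2) unfolding optimal_def by simp
      then show "num_stable_sets T \<le> num_stable_sets T'" unfolding num_stable_sets_eq eq .
    qed
  qed
qed

end
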